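(* There are exactly $13$ affine equivalence classes of Seifert geometric fibrations of compact, connected, flat $2$-orbifolds. There are two classes of type $(\,\cdot\,)$, two classes of type $[\,\cdot\,]$, three classes of type $[-]$, and six classes of type $(-)$.
   Context: A $2$-space group is a discrete group $\Gamma$ of isometries of the Euclidean plane $E^2$ with compact orbit space; compact, connected, flat $2$-orbifolds are, up to isometry, the orbit spaces $E^2/\Gamma$ of $2$-space groups. For $2$-dimensional orbifolds, a Seifert geometric fibration is the same as a co-Seifert one, i.e. a geometric fibration of the $2$-orbifold over a $1$-orbifold (a circle or a closed interval). Each is, up to affine equivalence, given by a pair $(\Gamma,N)$, where $\Gamma$ is a $2$-space group and $N$ is a normal subgroup of $\Gamma$ such that $\Gamma/N$ is infinite cyclic or infinite dihedral: with $V=\mathrm{Span}\{a\in E^2: (x\mapsto x+a)\in N\}$ (a line), it is the fibration $E^2/\Gamma\to(E^2/V)/(\Gamma/N)$, $\Gamma x\mapsto(\Gamma/N)(V+x)$, with generic fiber $V/N$ and base $(E^2/V)/(\Gamma/N)$. The affine equivalence classes of such fibrations correspond bijectively to the isomorphism classes of such pairs $(\Gamma,N)$, where $(\Gamma_1,N_1)$ and $(\Gamma_2,N_2)$ are isomorphic if there is a group isomorphism $\Gamma_1\to\Gamma_2$ mapping $N_1$ onto $N_2$. Types: parentheses mean the generic fiber is a circle (equivalently $N$ is infinite cyclic), square brackets mean the generic fiber is a closed interval (equivalently $N$ is infinite dihedral); a dot means the base is a circle (equivalently $\Gamma/N$ is infinite cyclic), a dash means the base is a closed interval (equivalently $\Gamma/N$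 is infinite dihedral). *)

theory Defs
  imports
    "HOL-Analysis.Analysis"
    "HOL-Algebra.Elementary_Groups"
    "HOL-Algebra.Group_Action"
begin

definition isometries_E2 :: "(real^2 \<Rightarrow> real^2) monoid" where
  "isometries_E2 =
     \<lparr>carrier = {f. bij f \<and> (\<forall>x y. dist (f x) (f y) = dist x y)}, mult = (\<circ>), one = id\<rparr>"

abbreviation isom_subgroup :: "(real^2 \<Rightarrow> real^2) set \<Rightarrow> (real^2 \<Rightarrow> real^2) monoid" where
  "isom_subgroup \<Gamma> \<equiv> isometries_E2\<lparr>carrier := \<Gamma>\<rparr>"

text \<open>The symmetries \<open>k \<mapsto> \<plusminus>k + c\<close> of the integers.\<close>

definition infinite_dihedral_group :: "(int \<Rightarrow> int) monoid" where
  "infinite_dihedral_group =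
     \<lparr>carrier = {\<lambda>k. s * k + c | s c. s \<in> {1, -1}}, mult = (\<circ>), one = id\<rparr>"

definition quotient_topology :: "'a topology \<Rightarrow> ('a \<Rightarrow> 'b) \<Rightarrow> 'b topology" where
  "quotient_topology X q =
     topology (\<lambda>U. U \<subseteq> q ` topspace X \<and> openin X {x \<in> topspace X. q x \<in> U})"

lemma openin_quotient_topology:
  "openin (quotient_topology X q) U \<longleftrightarrow>
     U \<subseteq> q ` topspace X \<and> openin X {x \<in> topspace X. q x \<in> U}"
proof -
  have "istopology (\<lambda>U. U \<subseteq> q ` topspace X \<and> openin X {x \<in> topspace X. q x \<in> U})"
    unfolding istopology_def
  proof (intro conjI allI impI)
    fix S T
    assume S: "S \<subseteq> q ` topspace X \<and> openin X {x \<in> topspace X. q x \<in> S}"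
      and T: "T \<subseteq> q ` topspace X \<and> openin X {x \<in> topspace X. q x \<in> T}"
    have "{x \<in> topspace X. q x \<in> S \<inter> T} =
        {x \<in> topspace X. q x \<in> S} \<inter> {x \<in> topspace X. q x \<in> T}"
      by auto
    with S T show "openin X {x \<in> topspace X. q x \<in> S \<inter> T}" by auto
    show "S \<inter> T \<subseteq> q ` topspace X" using S by auto
  next
    fix \<K>
    assume K: "\<forall>K\<in>\<K>. K \<subseteq> q ` topspace X \<and> openin X {x \<in> topspace X. q x \<in> K}"
    have "{x \<in> topspace X. q x \<in> \<Union>\<K>} = (\<Union>K\<in>\<K>. {x \<in> topspace X. q x \<in> K})"
      by auto
    with K show "openin X {x \<in> topspace X. q x \<in> \<Union>\<K>}" by auto
    show "\<Union>\<K> \<subseteq> q ` topspace X" using K by auto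
  qed
  then show ?thesis
    unfolding quotient_topology_def by (simp add: topology_inverse')
qed

lemma quotient_map_quotient_topology:
  "quotient_map X (quotient_topology X q) q"
proof -
  have "topspace (quotient_topology X q) = q ` topspace X"
  proof
    show "topspace (quotient_topology X q) \<subseteq> q ` topspace X"
      using openin_quotient_topology[of X q] openin_topspace by blast
    have "{x \<in> topspace X. q x \<in> q ` topspace X} = topspace X" by auto
    then have "openin (quotient_topology X q) (q ` topspace X)"
      by (simp add: openin_quotient_topology)
    then show "q ` topspace X \<subseteq> topspace (quotient_topology X q)"
      by (rule openin_subset)
  qed
  then show ?thesis
    by (auto simp: quotient_map_def openin_quotient_topology)
qed

definition orbit_E2 :: "(real^2 \<Rightarrow> real^2) set \<Rightarrow> real^2 \<Rightarrow> (real^2) set" where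
  "orbit_E2 \<Gamma> = orbit (isom_subgroup \<Gamma>) (\<lambda>\<gamma>. \<gamma>)"

definition orbit_space :: "(real^2 \<Rightarrow> real^2) set \<Rightarrow> (real^2) set topology" where
  "orbit_space \<Gamma> = quotient_topology euclidean (orbit_E2 \<Gamma>)"

text \<open>
  Here \<^const>\<open>discrete\<close> refers to the product topology on functions, i.e. to pointwise convergence;
  on isometries it agrees with the compact-open topology.
\<close>

definition two_space_group :: "(real^2 \<Rightarrow> real^2) set \<Rightarrow> bool" where
  "two_space_group \<Gamma> \<longleftrightarrow>
     subgroup \<Gamma> isometries_E2 \<and> discrete \<Gamma> \<and> compact_space (orbit_space \<Gamma>)"

type_synonym fibration = "(real^2 \<Rightarrow> real^2) set \<times> (real^2 \<Rightarrow> real^2) set"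

text \<open>The fibration of \<open>E\<^sup>2/\<Gamma>\<close> determined by \<open>N\<close> is represented by the pair \<open>(\<Gamma>, N)\<close>.\<close>

definition seifert_fibrations :: "fibration set" where
  "seifert_fibrations =
     {(\<Gamma>, N). two_space_group \<Gamma> \<and> N \<lhd> isom_subgroup \<Gamma> \<and>
        (isom_subgroup \<Gamma> Mod N \<cong> integer_group \<or>
         isom_subgroup \<Gamma> Mod N \<cong> infinite_dihedral_group)}"

definition fiber_direction :: "(real^2 \<Rightarrow> real^2) set \<Rightarrow> (real^2) set" where
  "fiber_direction N = span {a. (\<lambda>x. x + a) \<in> N}"

definition line_through :: "(real^2) set \<Rightarrow> real^2 \<Rightarrow> (real^2) set" where
  "line_through V x = (+) x ` V"

definition coset_action :: "(real^2 \<Rightarrow> real^2) set \<Rightarrow> (real^2) set \<Rightarrow> (real^2) set" where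
  "coset_action C L = (\<Union>\<gamma>\<in>C. \<gamma> ` L)"

text \<open>
  A coset \<open>\<gamma>N\<close> acts on \<open>E\<^sup>2/V\<close> by \<open>V + x \<mapsto> \<gamma>(V + x)\<close>. All members of the union
  in \<^const>\<open>coset_action\<close> agree in that case, since \<open>N\<close> maps every line \<open>V + x\<close> to itself.
\<close>

definition base_orbit :: "fibration \<Rightarrow> (real^2) set \<Rightarrow> (real^2) set set" where
  "base_orbit = (\<lambda>(\<Gamma>, N). orbit (isom_subgroup \<Gamma> Mod N) coset_action)"

definition base_space :: "fibration \<Rightarrow> (real^2) set set topology" where
  "base_space = (\<lambda>(\<Gamma>, N).
     quotient_topology (quotient_topology euclidean (line_through (fiber_direction N)))
       (base_orbit (\<Gamma>, N)))"

definition generic_fiber :: "fibration \<Rightarrow> (real^2) set topology" where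
  "generic_fiber = (\<lambda>(\<Gamma>, N).
     quotient_topology (top_of_set (fiber_direction N)) (orbit_E2 N))"

text \<open>The map \<open>\<Gamma>x \<mapsto> (\<Gamma>/N)(V + x)\<close>, which does not depend on the choice of \<open>x\<close> in the orbit.\<close>

definition fibration_projection :: "fibration \<Rightarrow> (real^2) set \<Rightarrow> (real^2) set set" where
  "fibration_projection = (\<lambda>(\<Gamma>, N) X.
     the_elem ((\<lambda>x. base_orbit (\<Gamma>, N) (line_through (fiber_direction N) x)) ` X))"

definition affinity :: "(real^2 \<Rightarrow> real^2) \<Rightarrow> bool" where
  "affinity \<phi> \<longleftrightarrow> (\<exists>A c. linear A \<and> bij A \<and> \<phi> = (\<lambda>x. A x + c))"

text \<open>
  An affine homeomorphism between orbit spaces is a map induced by an affinity that conjugates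
  one group onto the other. For the bases, the affinity of \<open>E\<^sup>2/V\<^sub>1\<close> onto \<open>E\<^sup>2/V\<^sub>2\<close> is in turn induced by an
  affinity \<open>\<psi>\<close> of the plane taking lines parallel to \<open>V\<^sub>1\<close> to lines parallel to \<open>V\<^sub>2\<close>.
\<close>

definition affine_homeo ::
  "(real^2 \<Rightarrow> real^2) set \<Rightarrow> (real^2 \<Rightarrow> real^2) set \<Rightarrow> ((real^2) set \<Rightarrow> (real^2) set) \<Rightarrow> bool" where
  "affine_homeo \<Gamma>1 \<Gamma>2 \<alpha> \<longleftrightarrow>
     (\<exists>\<phi>. affinity \<phi> \<and> (\<lambda>\<gamma>. \<phi> \<circ> \<gamma> \<circ> inv_into UNIV \<phi>) ` \<Gamma>1 = \<Gamma>2 \<and>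
        (\<forall>x. \<alpha> (orbit_E2 \<Gamma>1 x) = orbit_E2 \<Gamma>2 (\<phi> x)))"

definition affine_base_homeo ::
  "fibration \<Rightarrow> fibration \<Rightarrow> ((real^2) set set \<Rightarrow> (real^2) set set) \<Rightarrow> bool" where
  "affine_base_homeo = (\<lambda>(\<Gamma>1, N1) (\<Gamma>2, N2) \<beta>.
     let lines1 = range (line_through (fiber_direction N1));
         lines2 = range (line_through (fiber_direction N2))
     in \<exists>\<psi>. affinity \<psi> \<and> (image \<psi>) ` lines1 = lines2 \<and>
          (\<lambda>C. \<lambda>L\<in>lines2. \<psi> ` coset_action C (inv_into UNIV \<psi> ` L)) ` carrier (isom_subgroup \<Gamma>1 Mod N1) =
          (\<lambda>C. \<lambda>L\<in>lines2. coset_action C L) ` carrier (isom_subgroup \<Gamma>2 Mod N2) \<and>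
          (\<forall>L\<in>lines1. \<beta> (base_orbit (\<Gamma>1, N1) L) = base_orbit (\<Gamma>2, N2) (\<psi> ` L)))"

definition affinely_equivalent :: "fibration \<Rightarrow> fibration \<Rightarrow> bool" where
  "affinely_equivalent F1 F2 \<longleftrightarrow>
     (\<exists>\<alpha> \<beta>. affine_homeo (fst F1) (fst F2) \<alpha> \<and> affine_base_homeo F1 F2 \<beta> \<and>
        (\<forall>x. \<beta> (fibration_projection F1 (orbit_E2 (fst F1) x)) =
             fibration_projection F2 (\<alpha> (orbit_E2 (fst F1) x))))"

definition affine_equivalence :: "(fibration \<times> fibration) set" where
  "affine_equivalence =
     {(F1, F2). F1 \<in> seifert_fibrations \<and> F2 \<in> seifert_fibrations \<and> affinely_equivalent F1 F2}"

definition is_circle :: "'a topology \<Rightarrow> bool" where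
  "is_circle X \<longleftrightarrow> X homeomorphic_space top_of_set (sphere (0::real^2) 1)"

definition is_closed_interval :: "'a topology \<Rightarrow> bool" where
  "is_closed_interval X \<longleftrightarrow> X homeomorphic_space top_of_set {0..1::real}"

text \<open>
  The types: the first bracket describes the generic fiber (\<open>(\<dots>)\<close> a circle, \<open>[\<dots>]\<close> a closed
  interval), the inner symbol the base (a dot for a circle, a dash for a closed interval).
\<close>

definition paren_dot :: "fibration set" where
  "paren_dot = {F \<in> seifert_fibrations. is_circle (generic_fiber F) \<and> is_circle (base_space F)}"

definition bracket_dot :: "fibration set" where
  "bracket_dot =
     {F \<in> seifert_fibrations. is_closed_interval (generic_fiber F) \<and> is_circle (base_space F)}"

definition bracket_dash :: "fibration set" where
  "bracket_dash =
     {F \<in> seifert_fibrations. is_closed_interval (generic_fiber F) \<and> is_closed_interval (base_space F)}"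

definition paren_dash :: "fibration set" where
  "paren_dash =
     {F \<in> seifert_fibrations. is_circle (generic_fiber F) \<and> is_closed_interval (base_space F)}"

end

theory Submission
  imports Defs
begin

text \<open>
  Let \<open>(\<Gamma>, N)\<close> be a fibration. Compactness of the orbit space forces \<open>\<Gamma>\<close> to contain two independent translations:
  commutators of rotations are translations, and if a rotation of order greater than two is central among the orientation
  preserving elements, its displacement function is both bounded and unbounded. Mapping the translations to \<open>\<Gamma>/N\<close>, one finds a
  nonzero translation in \<open>N\<close>; by discreteness all translations in \<open>N\<close> are parallel to a line \<open>V\<close>. Hence \<open>\<Gamma>\<close> preserves the
  direction \<open>V\<close>, the group \<open>N\<close> is the kernel of the action on \<open>E\<^sup>2/V\<close>, and in suitable affine coordinates
  \<open>\<Gamma>\<close> acts by \<open>(x, y) \<mapsto> (\<plusminus>x + a, \<plusminus>y + n)\<close> with \<open>n\<close> an integer, where \<open>N\<close> consists of the maps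
  \<open>x \<mapsto> x + 2m\<close> or \<open>x \<mapsto> \<plusminus>x + 2m\<close>. The group is generated by \<open>N\<close> and a lift of \<open>y + 1\<close>, respectively lifts of
  \<open>-y\<close> and \<open>1 - y\<close>, and a shear, a translation and a flip of the base bring these into one of thirteen normal forms.

  An affine equivalence of fibrations is the same as an affinity conjugating both groups: the two maps of the base that make
  the square commute agree up to the countable group \<open>\<Gamma>/N\<close>, so the affinity of the total space preserves the fiber direction.
\<close>

section \<open>Fibrations as group extensions\<close>

text \<open>Affine normalization is what makes the list finite: shears, shifts and independent
  scalings of the two coordinates remove every continuous parameter. Scaling the translations of
  \<open>N\<close> to the even integers turns the half translations that can still occur into
  integers, so a normalized group is recorded by signs and parities, and it is determined by
  \<open>N\<close> and a lift of each generator of the quotient. That the thirteen normal forms are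
  inequivalent is shown by an invariant of the abstract pair that reduces to finitely many bits. The
  obstacle lies in the definition of equivalence: it involves one affinity for the total space and
  another for the base, linked only through orbits. Passing to a single affinity needs a coordinate
  transverse to the fibers, and for a general fibration this coordinate is taken from the
  classification itself.\<close>

abbreviation fun_inv :: "('a \<Rightarrow> 'a) \<Rightarrow> 'a \<Rightarrow> 'a" where
  "fun_inv \<equiv> inv_into UNIV"

text \<open>Isometry is left out on purpose: an affine conjugate of a group of isometries need not
  consist of isometries.\<close>

definition perm_group :: "('a \<Rightarrow> 'a) set \<Rightarrow> bool" where
  "perm_group G \<longleftrightarrow> id \<in> G \<and> (\<forall>g\<in>G. \<forall>h\<in>G. g \<circ> h \<in> G) \<and> (\<forall>g\<in>G. bij g \<and> fun_inv g \<in> G)"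

lemma perm_groupD:
  assumes "perm_group G"
  shows "id \<in> G" "g \<in> G \<Longrightarrow> h \<in> G \<Longrightarrow> g \<circ> h \<in> G" "g \<in> G \<Longrightarrow> bij g" "g \<in> G \<Longrightarrow> fun_inv g \<in> G"
    "g \<in> G \<Longrightarrow> g \<circ> fun_inv g = id" "g \<in> G \<Longrightarrow> fun_inv g \<circ> g = id"
  using assms unfolding perm_group_def
  by (auto simp: bij_is_surj bij_is_inj surj_iff[symmetric])

lemma group_isometries_E2: "group isometries_E2"
proof (rule groupI)
  fix f assume "f \<in> carrier isometries_E2"
  then have f: "bij f" "\<And>x y. dist (f x) (f y) = dist x y" by (auto simp: isometries_E2_def)
  have "fun_inv f \<circ> f = id" using f(1) by (simp add: bij_is_inj)
  moreover have "dist (fun_inv f x) (fun_inv f y) = dist x y" for x y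
    using f(2)[of "fun_inv f x" "fun_inv f y"] bij_is_surj[OF f(1)] by (simp add: surj_f_inv_f)
  ultimately show "\<exists>g\<in>carrier isometries_E2. g \<otimes>\<^bsub>isometries_E2\<^esub> f = \<one>\<^bsub>isometries_E2\<^esub>"
    using bij_imp_bij_inv[OF f(1)] by (auto simp: isometries_E2_def intro!: bexI[of _ "fun_inv f"])
qed (auto simp: isometries_E2_def bij_comp o_assoc)

lemma inv_isometries_E2:
  assumes "f \<in> carrier isometries_E2"
  shows "inv\<^bsub>isometries_E2\<^esub> f = fun_inv f"
proof -
  interpret group isometries_E2 by (rule group_isometries_E2)
  have "bij f" using assms by (auto simp: isometries_E2_def)
  then have "fun_inv f \<circ> f = id" by (simp add: bij_is_inj)
  moreover have "dist (fun_inv f x) (fun_inv f y) = dist x y" for x y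
  proof -
    have "dist (f (fun_inv f x)) (f (fun_inv f y)) = dist (fun_inv f x) (fun_inv f y)"
      using assms by (simp add: isometries_E2_def)
    then show ?thesis using bij_is_surj[OF \<open>bij f\<close>] by (simp add: surj_f_inv_f)
  qed
  ultimately show ?thesis
    using assms bij_imp_bij_inv[OF \<open>bij f\<close>]
    by (intro inv_equality) (auto simp: isometries_E2_def)
qed

lemma subgroup_isometries_E2_iff:
  "subgroup G isometries_E2 \<longleftrightarrow>
     perm_group G \<and> (\<forall>g\<in>G. \<forall>x y. dist (g x) (g y) = dist x y)"
proof -
  interpret group isometries_E2 by (rule group_isometries_E2)
  have c: "carrier isometries_E2 = {f. bij f \<and> (\<forall>x y. dist (f x) (f y) = dist x y)}"
    "\<And>f g. f \<otimes>\<^bsub>isometries_E2\<^esub> g = f \<circ> g" "\<one>\<^bsub>isometries_E2\<^esub> = id"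
    by (auto simp: isometries_E2_def)
  show ?thesis (is "?l = ?r")
  proof
    assume l: ?l
    then have "g \<in> carrier isometries_E2" if "g \<in> G" for g
      using that subgroup.subset by blast
    then show ?r
      using subgroup.one_closed[OF l] subgroup.m_closed[OF l] subgroup.m_inv_closed[OF l] c
        inv_isometries_E2
      unfolding perm_group_def by fastforce
  next
    assume r: ?r
    show ?l
    proof (rule subgroupI)
      show "G \<subseteq> carrier isometries_E2" using r by (auto simp: c perm_group_def)
      then show "a \<in> G \<Longrightarrow> inv\<^bsub>isometries_E2\<^esub> a \<in> G" for a
        using inv_isometries_E2[of a] r by (auto simp: perm_group_def)
    qed (use r in \<open>auto simp: c perm_group_def\<close>)
  qed
qed

lemma carrier_dihedral:
  "f \<in> carrier infinite_dihedral_group \<longleftrightarrow> (\<exists>s c. (s = 1 \<or> s = -1) \<and> f = (\<lambda>k. s * k + c))"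
  by (auto simp: infinite_dihedral_group_def)

lemma affine_eq_id: "(\<lambda>k. a * k + b) = id \<longleftrightarrow> a = 1 \<and> b = (0::int)"
proof
  assume "(\<lambda>k. a * k + b) = id"
  from fun_cong[OF this, of 0] fun_cong[OF this, of 1] show "a = 1 \<and> b = 0" by auto
qed (auto simp: fun_eq_iff)

lemma group_dihedral: "group infinite_dihedral_group"
proof (rule groupI)
  fix f assume "f \<in> carrier infinite_dihedral_group"
  then obtain s c where s: "s = 1 \<or> s = -1" and f: "f = (\<lambda>k. s * k + c)"
    by (auto simp: carrier_dihedral)
  have "(\<lambda>k. s * k + (- s * c)) \<in> carrier infinite_dihedral_group"
    using s unfolding carrier_dihedral by blast
  moreover have "(\<lambda>k. s * k + (- s * c)) \<circ> f = id"
    using s by (auto simp: f fun_eq_iff algebra_simps)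
  ultimately show "\<exists>g\<in>carrier infinite_dihedral_group.
      g \<otimes>\<^bsub>infinite_dihedral_group\<^esub> f = \<one>\<^bsub>infinite_dihedral_group\<^esub>"
    by (auto simp: infinite_dihedral_group_def)
next
  fix f g assume "f \<in> carrier infinite_dihedral_group" "g \<in> carrier infinite_dihedral_group"
  then obtain s c s' c' where *: "s = 1 \<or> s = -1" "f = (\<lambda>k. s * k + c)"
     "s' = 1 \<or> s' = -1" "g = (\<lambda>k. s' * k + c')"
    unfolding carrier_dihedral by blast
  then have "f \<circ> g = (\<lambda>k. (s * s') * k + (s * c' + c))" "s * s' = 1 \<or> s * s' = -1"
    by (auto simp: algebra_simps)
  then show "f \<otimes>\<^bsub>infinite_dihedral_group\<^esub> g \<in> carrier infinite_dihedral_group"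
    unfolding carrier_dihedral by (auto simp: infinite_dihedral_group_def)
next
  show "\<one>\<^bsub>infinite_dihedral_group\<^esub> \<in> carrier infinite_dihedral_group"
    unfolding carrier_dihedral
    by (intro exI[of _ 1] exI[of _ 0]) (auto simp: infinite_dihedral_group_def)
qed (auto simp: infinite_dihedral_group_def o_assoc)

text \<open>\<open>s\<close> and \<open>c\<close> are the linear part and the value at 0 of a
  homomorphism from \<open>G\<close> to the symmetries of the integers, with kernel
  \<open>N\<close>. By \<open>ex_t\<close> and \<open>ex_r\<close> its image is either all
  translations or the whole dihedral group, so one locale serves both kinds of quotient.\<close>

locale dihedral_extension =
  fixes G N :: "('a \<Rightarrow> 'a) set" and s c :: "('a \<Rightarrow> 'a) \<Rightarrow> int"
  assumes G: "perm_group G"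
    and s: "g \<in> G \<Longrightarrow> s g = 1 \<or> s g = -1"
    and s_comp: "g \<in> G \<Longrightarrow> h \<in> G \<Longrightarrow> s (g \<circ> h) = s g * s h"
    and c_comp: "g \<in> G \<Longrightarrow> h \<in> G \<Longrightarrow> c (g \<circ> h) = s g * c h + c g"
    and N_def: "N = {g \<in> G. s g = 1 \<and> c g = 0}"
    and ex_t: "\<exists>t\<in>G. s t = 1 \<and> c t = 1"
    and ex_r: "(\<exists>r\<in>G. s r = -1 \<and> c r = 0) \<or> (\<forall>g\<in>G. s g = 1)"
begin

lemmas G_id = perm_groupD(1)[OF G]
  and G_comp = perm_groupD(2)[OF G]
  and G_bij = perm_groupD(3)[OF G]
  and G_inv = perm_groupD(4)[OF G]
  and G_inv_r = perm_groupD(5)[OF G]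
  and G_inv_l = perm_groupD(6)[OF G]

lemma s_id: "s id = 1"
  using s_comp[OF G_id G_id] s[OF G_id] by auto

lemma c_id: "c id = 0"
  using c_comp[OF G_id G_id] s_id by auto

lemma N_sub: "N \<subseteq> G" by (auto simp: N_def)

lemma s_inv: assumes "g \<in> G" shows "s (fun_inv g) = s g"
  using s_comp[OF assms G_inv[OF assms]] G_inv_r[OF assms] s_id s[OF assms] s[OF G_inv[OF assms]]
  by auto

lemma c_inv: assumes "g \<in> G" shows "c (fun_inv g) = - s g * c g"
  using c_comp[OF G_inv[OF assms] assms] G_inv_l[OF assms] c_id s_inv[OF assms] by simp

lemma coset_N:
  assumes "g \<in> G" "h \<in> G" "s g = s h" "c g = c h"
  shows "g \<circ> fun_inv h \<in> N"
  using assms G_comp[OF assms(1) G_inv[OF assms(2)]] s[OF assms(2)]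
  by (auto simp: N_def s_comp c_comp G_inv s_inv c_inv)

lemma N_perm_group: "perm_group N"
  unfolding perm_group_def N_def
  using G_id G_comp G_bij G_inv s_id c_id s_comp c_comp s_inv c_inv by simp

lemma onto:
  shows "\<exists>g\<in>G. s g = 1 \<and> c g = k"
proof -
  obtain t where t: "t \<in> G" "s t = 1" "c t = 1" using ex_t by blast
  have nat: "\<exists>g\<in>G. s g = 1 \<and> c g = int n" for n
  proof (induction n)
    case 0 then show ?case using G_id s_id c_id by auto
  next
    case (Suc n)
    then obtain g where "g \<in> G" "s g = 1 \<and> c g = int n" by blast
    then have "t \<circ> g \<in> G" "s (t \<circ> g) = 1" "c (t \<circ> g) = int (Suc n)"
      using t by (simp_all add: G_comp s_comp c_comp)
    then show ?case by blast
  qed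
  show ?thesis
  proof (cases "k \<ge> 0")
    case True then show ?thesis using nat[of "nat k"] by auto
  next
    case False
    obtain g where "g \<in> G" "s g = 1 \<and> c g = int (nat (-k))" using nat by blast
    then show ?thesis
      using False by (intro bexI[of _ "fun_inv g"]) (auto simp: G_inv s_inv c_inv)
  qed
qed

lemma onto_reflection:
  assumes "g \<in> G" "s g = -1"
  shows "\<exists>g\<in>G. s g = -1 \<and> c g = k"
proof -
  obtain h where h: "h \<in> G" "s h = 1" "c h = k - c g" using onto by blast
  show ?thesis
    by (rule bexI[of _ "h \<circ> g"]) (use assms h in \<open>auto simp: G_comp s_comp c_comp\<close>)
qed

end

text \<open>\<open>h\<close> is the projection to the quotient followed by the isomorphism. It
  trades a condition on cosets for a homomorphism on \<open>K\<close>.\<close>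

lemma kernel_of_quotient_iso:
  assumes "N \<lhd> K" "K Mod N \<cong> H" "group H"
  obtains h where "h \<in> hom K H" "h ` carrier K = carrier H" "N = {g \<in> carrier K. h g = \<one>\<^bsub>H\<^esub>}"
proof -
  interpret normal N K by fact
  obtain f where f: "f \<in> iso (K Mod N) H" using assms(2) by (auto simp: is_iso_def)
  interpret Q: group "K Mod N" by (rule factorgroup_is_group)
  have fh: "f \<in> hom (K Mod N) H" and fb: "bij_betw f (carrier (K Mod N)) (carrier H)"
    using f by (auto simp: iso_def)
  interpret f: group_hom "K Mod N" H f
    using fh assms(3) Q.is_group by (simp add: group_hom_def group_hom_axioms_def)
  have f1: "f N = \<one>\<^bsub>H\<^esub>" using f.hom_one by simp
  let ?h = "\<lambda>g. f (N #>\<^bsub>K\<^esub> g)"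
  have "?h \<in> hom K H"
    using Group.hom_compose[OF r_coset_hom_Mod fh] by (simp add: comp_def)
  moreover have "?h ` carrier K = carrier H"
    using fb by (auto simp: bij_betw_def carrier_FactGroup image_image)
  moreover have "N = {g \<in> carrier K. ?h g = \<one>\<^bsub>H\<^esub>}"
  proof (intro equalityI subsetI CollectI conjI)
    fix g assume g: "g \<in> N"
    then show "g \<in> carrier K" "f (N #>\<^bsub>K\<^esub> g) = \<one>\<^bsub>H\<^esub>"
      using f1 by (auto simp: rcos_const[OF is_group] )
  next
    fix g assume "g \<in> {g \<in> carrier K. f (N #>\<^bsub>K\<^esub> g) = \<one>\<^bsub>H\<^esub>}"
    then have g: "g \<in> carrier K" "f (N #>\<^bsub>K\<^esub> g) = f N" using f1 by auto
    then have "N #>\<^bsub>K\<^esub> g = N"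
      using fb Q.one_closed by (auto simp: bij_betw_def carrier_FactGroup dest!: inj_onD)
    then show "g \<in> N" using rcos_self[OF g(1) subgroup_axioms] by simp
  qed
  ultimately show thesis by (rule that)
qed

lemma isometries_E2_simps [simp]:
  "f \<otimes>\<^bsub>isometries_E2\<^esub> g = f \<circ> g" "\<one>\<^bsub>isometries_E2\<^esub> = id"
  by (auto simp: isometries_E2_def)

lemma isom_subgroup_simps [simp]:
  "carrier (isom_subgroup G) = G" "f \<otimes>\<^bsub>isom_subgroup G\<^esub> g = f \<circ> g" "\<one>\<^bsub>isom_subgroup G\<^esub> = id"
  by (auto simp: isometries_E2_def)

text \<open>Normality and the isomorphism type of the quotient are absorbed into \<open>s\<close>
  and \<open>c\<close>; an infinite cyclic quotient is the case in which \<open>s\<close> is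
  constantly 1.\<close>

lemma seifert_fibrations_iff:
  "(G, N) \<in> seifert_fibrations \<longleftrightarrow> two_space_group G \<and> (\<exists>s c. dihedral_extension G N s c)"
proof
  assume F: "(G, N) \<in> seifert_fibrations"
  then have tsg: "two_space_group G" and nrm: "N \<lhd> isom_subgroup G"
    by (auto simp: seifert_fibrations_def)
  have pg: "perm_group G"
    using tsg by (auto simp: two_space_group_def subgroup_isometries_E2_iff)
  have "\<exists>s c. dihedral_extension G N s c"
  proof (cases "isom_subgroup G Mod N \<cong> integer_group")
    case True
    obtain h where h: "h \<in> hom (isom_subgroup G) integer_group" "h ` G = UNIV"
      "N = {g \<in> G. h g = 0}"
      using kernel_of_quotient_iso[OF nrm True] by auto
    have "dihedral_extension G N (\<lambda>_. 1) h"
    proof unfold_locales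
      show "\<exists>t\<in>G. (1::int) = 1 \<and> h t = 1" using h(2) by (metis UNIV_I image_iff)
      show "h (f \<circ> g) = 1 * h g + h f" if "f \<in> G" "g \<in> G" for f g
        using that h(1) by (auto simp: hom_def)
    qed (use h pg in auto)
    then show ?thesis by blast
  next
    case False
    then have D: "isom_subgroup G Mod N \<cong> infinite_dihedral_group"
      using F by (auto simp: seifert_fibrations_def)
    obtain h where h: "h \<in> hom (isom_subgroup G) infinite_dihedral_group"
      "h ` G = carrier infinite_dihedral_group" "N = {g \<in> G. h g = id}"
      using kernel_of_quotient_iso[OF nrm D group_dihedral]
      by (auto simp: infinite_dihedral_group_def)
    \<comment> \<open>An affine map of the integers is recovered from its values at 0 and 1.\<close>
    define s c where "s g = h g 1 - h g 0" and "c g = h g 0" for g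
    have hs: "(s g = 1 \<or> s g = -1) \<and> h g = (\<lambda>k. s g * k + c g)" if "g \<in> G" for g
    proof -
      have "h g \<in> carrier infinite_dihedral_group" using h(2) that by auto
      then obtain a b where "a = 1 \<or> a = -1" "h g = (\<lambda>k. a * k + b)"
        unfolding carrier_dihedral by blast
      then show ?thesis by (auto simp: s_def c_def)
    qed
    have hc: "h (f \<circ> g) = h f \<circ> h g" if "f \<in> G" "g \<in> G" for f g
      using h(1) that by (auto simp: hom_def infinite_dihedral_group_def)
    have ex: "\<exists>g\<in>G. s g = a \<and> c g = b" if "a = 1 \<or> a = -1" for a b
    proof -
      have "(\<lambda>k. a * k + b) \<in> h ` G" unfolding h(2) carrier_dihedral using that by blast
      then obtain g where "g \<in> G" "h g = (\<lambda>k. a * k + b)" by auto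
      then show ?thesis by (intro bexI[of _ g]) (auto simp: s_def c_def)
    qed
    have "dihedral_extension G N s c"
    proof unfold_locales
      fix f g assume fg: "f \<in> G" "g \<in> G"
      show "s (f \<circ> g) = s f * s g" "c (f \<circ> g) = s f * c g + c f"
        using hc[OF fg] hs[OF fg(1)] hs[OF fg(2)]
        unfolding s_def[of "f \<circ> g"] c_def[of "f \<circ> g"] by (auto simp: algebra_simps)
    next
      show "N = {g \<in> G. s g = 1 \<and> c g = 0}"
      proof -
        have "h g = id \<longleftrightarrow> s g = 1 \<and> c g = 0" if "g \<in> G" for g
          using hs[OF that] by (metis affine_eq_id)
        then show ?thesis unfolding h(3) by blast
      qed
    qed (use pg hs ex[of 1 1] ex[of "-1" 0] in auto)
    then show ?thesis by blast
  qed
  then show "two_space_group G \<and> (\<exists>s c. dihedral_extension G N s c)" using tsg by blast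
next
  assume "two_space_group G \<and> (\<exists>s c. dihedral_extension G N s c)"
  then obtain s c where tsg: "two_space_group G" and de: "dihedral_extension G N s c" by blast
  interpret dihedral_extension G N s c by fact
  interpret I: group isometries_E2 by (rule group_isometries_E2)
  interpret K: group "isom_subgroup G"
    using tsg I.subgroup_imp_group by (auto simp: two_space_group_def)
  have "N \<lhd> isom_subgroup G \<and>
    (isom_subgroup G Mod N \<cong> integer_group \<or> isom_subgroup G Mod N \<cong> infinite_dihedral_group)"
  proof (cases "\<forall>g\<in>G. s g = 1")
    case True
    interpret h: group_hom "isom_subgroup G" integer_group c
      unfolding group_hom_def group_hom_axioms_def hom_def
      using True K.is_group by (auto simp: c_comp)
    have "kernel (isom_subgroup G) integer_group c = N"
      using True by (auto simp: kernel_def N_def)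
    moreover have "c ` G = UNIV" using onto by (auto simp: image_iff) metis
    ultimately show ?thesis using h.FactGroup_iso h.normal_kernel by auto
  next
    case False
    let ?h = "\<lambda>g k. s g * k + c g"
    interpret h: group_hom "isom_subgroup G" infinite_dihedral_group ?h
    proof -
      have "?h \<in> hom (isom_subgroup G) infinite_dihedral_group"
      proof (rule homI)
        show "?h g \<in> carrier infinite_dihedral_group" if "g \<in> carrier (isom_subgroup G)" for g
          using s that unfolding carrier_dihedral by auto
      qed (auto simp: infinite_dihedral_group_def s_comp c_comp algebra_simps fun_eq_iff)
      then show "group_hom (isom_subgroup G) infinite_dihedral_group ?h"
        unfolding group_hom_def group_hom_axioms_def
        using K.is_group group_dihedral by auto
    qed
    have "kernel (isom_subgroup G) infinite_dihedral_group ?h = N"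
      by (auto simp: kernel_def N_def infinite_dihedral_group_def affine_eq_id)
    moreover have "?h ` G = carrier infinite_dihedral_group"
    proof (intro equalityI subsetI)
      fix f assume "f \<in> carrier infinite_dihedral_group"
      then obtain a b where ab: "a = 1 \<or> a = -1" "f = (\<lambda>k. a * k + b)"
        unfolding carrier_dihedral by blast
      obtain g where "g \<in> G" "s g = a" "c g = b"
        using ab(1) onto[of b] False onto_reflection[of _ b] s by metis
      then show "f \<in> ?h ` G" using ab by auto
    qed (use h.hom_closed in auto)
    ultimately show ?thesis using h.FactGroup_iso h.normal_kernel by auto
  qed
  then show "(G, N) \<in> seifert_fibrations" using tsg by (auto simp: seifert_fibrations_def)
qed

section \<open>Affine conjugation\<close>

definition conjugate :: "('a \<Rightarrow> 'a) \<Rightarrow> ('a \<Rightarrow> 'a) set \<Rightarrow> ('a \<Rightarrow> 'a) set" where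
  "conjugate \<phi> S = (\<lambda>\<gamma>. \<phi> \<circ> \<gamma> \<circ> fun_inv \<phi>) ` S"

lemma bij_inv_simps:
  assumes "bij \<phi>"
  shows "\<phi> (fun_inv \<phi> x) = x" "fun_inv \<phi> (\<phi> x) = x" "\<phi> \<circ> fun_inv \<phi> = id" "fun_inv \<phi> \<circ> \<phi> = id"
  using assms by (auto simp: bij_is_surj bij_is_inj surj_f_inv_f surj_iff[symmetric])

lemma conjugate_id [simp]: "conjugate id S = S"
  by (simp add: conjugate_def)

lemma conjugate_conjugate:
  assumes "bij \<phi>" "bij \<psi>"
  shows "conjugate \<phi> (conjugate \<psi> S) = conjugate (\<phi> \<circ> \<psi>) S"
  using assms by (simp add: conjugate_def image_image o_inv_distrib o_assoc)

lemma conjugate_inv: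
  assumes "bij \<phi>"
  shows "conjugate (fun_inv \<phi>) (conjugate \<phi> S) = S"
  using assms by (simp add: conjugate_conjugate bij_imp_bij_inv bij_inv_simps)

lemma in_conjugate_iff:
  assumes "bij \<phi>"
  shows "g \<in> conjugate \<phi> S \<longleftrightarrow> fun_inv \<phi> \<circ> g \<circ> \<phi> \<in> S"
proof
  assume "g \<in> conjugate \<phi> S"
  then obtain h where "h \<in> S" "g = \<phi> \<circ> h \<circ> fun_inv \<phi>" by (auto simp: conjugate_def)
  then show "fun_inv \<phi> \<circ> g \<circ> \<phi> \<in> S"
    using assms by (simp add: comp_def bij_inv_simps)
next
  assume "fun_inv \<phi> \<circ> g \<circ> \<phi> \<in> S"
  moreover have "g = \<phi> \<circ> (fun_inv \<phi> \<circ> g \<circ> \<phi>) \<circ> fun_inv \<phi>"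
    using assms by (simp add: fun_eq_iff bij_inv_simps)
  ultimately show "g \<in> conjugate \<phi> S" unfolding conjugate_def by blast
qed

lemma affinity_bij:
  assumes "affinity \<phi>" shows "bij \<phi>"
proof -
  obtain A c where A: "linear A" "bij A" "\<phi> = (\<lambda>x. A x + c)" using assms by (auto simp: affinity_def)
  then have "\<phi> = (\<lambda>x. x + c) \<circ> A" by auto
  moreover have "bij (\<lambda>x. x + c)"
    by (metis (no_types, lifting) add.commute bij_betw_cong bij_plus)
  ultimately show ?thesis using A(2) bij_comp by blast
qed

lemma affinity_id: "affinity id"
  unfolding affinity_def by (intro exI[of _ id] exI[of _ 0]) (auto simp: linear_iff)

lemma affinity_comp:
  assumes "affinity \<phi>" "affinity \<psi>" shows "affinity (\<phi> \<circ> \<psi>)"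
proof -
  obtain A c B d where A: "linear A" "bij A" "\<phi> = (\<lambda>x. A x + c)"
    and B: "linear B" "bij B" "\<psi> = (\<lambda>x. B x + d)"
    using assms unfolding affinity_def by blast
  show ?thesis unfolding affinity_def
    by (intro exI[of _ "A \<circ> B"] exI[of _ "A d + c"])
      (use A B in \<open>auto simp: linear_compose bij_comp linear_add fun_eq_iff\<close>)
qed

lemma affinity_inv:
  assumes "affinity \<phi>" shows "affinity (fun_inv \<phi>)"
proof -
  obtain A c where A: "linear A" "bij A" "\<phi> = (\<lambda>x. A x + c)" using assms by (auto simp: affinity_def)
  let ?B = "fun_inv A"
  have B: "linear ?B" "bij ?B"
    using A(1,2) by (auto simp: bij_imp_bij_inv bij_is_inj intro!: inj_linear_imp_inv_linear)
  have "fun_inv \<phi> = (\<lambda>x. ?B x + (- ?B c))"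
  proof
    fix x
    have "\<phi> (?B x + (- ?B c)) = x"
      using bij_inv_simps(1)[OF A(2)] A(1,3) by (simp add: linear_diff)
    then show "fun_inv \<phi> x = ?B x + (- ?B c)"
      using bij_inv_simps(2)[OF affinity_bij[OF assms]] by metis
  qed
  then show ?thesis unfolding affinity_def using B by blast
qed

text \<open>The relation that is really classified. It agrees with
  \<open>affinely_equivalent\<close> on fibrations (\<open>affinely_equivalent_iff\<close>), but
  speaks of one affinity and of no orbit spaces.\<close>

definition affinely_conjugate :: "fibration \<Rightarrow> fibration \<Rightarrow> bool" where
  "affinely_conjugate F1 F2 \<longleftrightarrow>
     (\<exists>\<phi>. affinity \<phi> \<and> conjugate \<phi> (fst F1) = fst F2 \<and> conjugate \<phi> (snd F1) = snd F2)"

lemma affinely_conjugate_refl: "affinely_conjugate F F"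
  unfolding affinely_conjugate_def using affinity_id by force

lemma affinely_conjugate_sym:
  assumes "affinely_conjugate F1 F2" shows "affinely_conjugate F2 F1"
  using assms affinity_inv affinity_bij conjugate_inv unfolding affinely_conjugate_def by metis

lemma affinely_conjugate_trans:
  assumes "affinely_conjugate F1 F2" "affinely_conjugate F2 F3" shows "affinely_conjugate F1 F3"
proof -
  obtain \<phi> \<psi> where "affinity \<phi>" "affinity \<psi>" "conjugate \<phi> (fst F1) = fst F2" "conjugate \<phi> (snd F1) = snd F2"
    "conjugate \<psi> (fst F2) = fst F3" "conjugate \<psi> (snd F2) = snd F3"
    using assms unfolding affinely_conjugate_def by blast
  then show ?thesis unfolding affinely_conjugate_def
    by (intro exI[of _ "\<psi> \<circ> \<phi>"]) (auto simp: affinity_comp conjugate_conjugate[symmetric] affinity_bij)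
qed

lemma conj_comp:
  assumes "bij \<phi>"
  shows "fun_inv \<phi> \<circ> (g \<circ> h) \<circ> \<phi> = (fun_inv \<phi> \<circ> g \<circ> \<phi>) \<circ> (fun_inv \<phi> \<circ> h \<circ> \<phi>)"
  using assms by (simp add: fun_eq_iff bij_inv_simps)

lemma perm_group_conjugate:
  assumes "bij \<phi>" "perm_group G" shows "perm_group (conjugate \<phi> G)"
  unfolding perm_group_def
proof (intro conjI ballI)
  show "id \<in> conjugate \<phi> G"
    using assms by (simp add: in_conjugate_iff bij_inv_simps perm_groupD(1))
next
  fix g h assume "g \<in> conjugate \<phi> G" "h \<in> conjugate \<phi> G"
  then show "g \<circ> h \<in> conjugate \<phi> G"
    using assms by (simp add: in_conjugate_iff conj_comp perm_groupD(2))
next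
  fix g assume "g \<in> conjugate \<phi> G"
  then obtain h where h: "h \<in> G" "g = \<phi> \<circ> h \<circ> fun_inv \<phi>" by (auto simp: conjugate_def)
  have bh: "bij h" using perm_groupD(3)[OF assms(2) h(1)] .
  show b: "bij g" using h(2) bh assms(1) by (auto intro!: bij_comp bij_imp_bij_inv)
  have "fun_inv g = \<phi> \<circ> fun_inv h \<circ> fun_inv \<phi>"
    unfolding h(2) using bh assms(1) by (simp add: o_inv_distrib bij_comp bij_imp_bij_inv inv_inv_eq o_assoc)
  then show "fun_inv g \<in> conjugate \<phi> G"
    using perm_groupD(4)[OF assms(2) h(1)] by (auto simp: conjugate_def)
qed

lemma dihedral_extension_conjugate:
  assumes "bij \<phi>" "dihedral_extension G N s c"
  shows "dihedral_extension (conjugate \<phi> G) (conjugate \<phi> N)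
    (\<lambda>g. s (fun_inv \<phi> \<circ> g \<circ> \<phi>)) (\<lambda>g. c (fun_inv \<phi> \<circ> g \<circ> \<phi>))"
proof -
  interpret dihedral_extension G N s c by fact
  note ic = in_conjugate_iff[OF assms(1)]
  have mem: "\<phi> \<circ> g \<circ> fun_inv \<phi> \<in> conjugate \<phi> G" if "g \<in> G" for g
    using that by (auto simp: conjugate_def)
  have unconj: "fun_inv \<phi> \<circ> (\<phi> \<circ> g \<circ> fun_inv \<phi>) \<circ> \<phi> = g" for g
    using assms(1) by (simp add: fun_eq_iff bij_inv_simps)
  show ?thesis
  proof
    show "perm_group (conjugate \<phi> G)" using perm_group_conjugate[OF assms(1) G] .
    show "\<exists>t\<in>conjugate \<phi> G. s (fun_inv \<phi> \<circ> t \<circ> \<phi>) = 1 \<and> c (fun_inv \<phi> \<circ> t \<circ> \<phi>) = 1"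
      using ex_t mem unconj by metis
    show "(\<exists>r\<in>conjugate \<phi> G. s (fun_inv \<phi> \<circ> r \<circ> \<phi>) = -1 \<and> c (fun_inv \<phi> \<circ> r \<circ> \<phi>) = 0) \<or>
      (\<forall>g\<in>conjugate \<phi> G. s (fun_inv \<phi> \<circ> g \<circ> \<phi>) = 1)"
      using ex_r mem unconj ic by metis
    show "conjugate \<phi> N = {g \<in> conjugate \<phi> G.
        s (fun_inv \<phi> \<circ> g \<circ> \<phi>) = 1 \<and> c (fun_inv \<phi> \<circ> g \<circ> \<phi>) = 0}"
      by (intro equalityI subsetI) (auto simp: ic N_def)
  qed (simp_all only: ic conj_comp[OF assms(1)] s s_comp c_comp)
qed

section \<open>Orbits, and a coordinate transverse to the fibers\<close>

lemma orbit_E2_eq: "orbit_E2 G x = (\<lambda>g. g x) ` G"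
  by (auto simp: orbit_E2_def orbit_def)

lemma orbit_E2_cong_iff:
  assumes "perm_group G"
  shows "orbit_E2 G x = orbit_E2 G y \<longleftrightarrow> (\<exists>g\<in>G. g x = y)"
proof
  assume "orbit_E2 G x = orbit_E2 G y"
  moreover have "y \<in> orbit_E2 G y"
    using imageI[OF perm_groupD(1)[OF assms], of "\<lambda>g. g y"] by (simp add: orbit_E2_eq)
  ultimately have "y \<in> orbit_E2 G x" by simp
  then show "\<exists>g\<in>G. g x = y" by (auto simp: orbit_E2_eq)
next
  assume "\<exists>g\<in>G. g x = y"
  then obtain g where g: "g \<in> G" "g x = y" by blast
  have "h y \<in> orbit_E2 G x" if "h \<in> G" for h
    using g(2) imageI[OF perm_groupD(2)[OF assms that g(1)], of "\<lambda>g. g x"]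
    by (simp add: orbit_E2_eq)
  moreover have "h x \<in> orbit_E2 G y" if "h \<in> G" for h
  proof -
    have "(h \<circ> fun_inv g) y = h x"
      using g perm_groupD(3)[OF assms g(1)] by (auto simp: bij_inv_simps)
    then show ?thesis
      using imageI[OF perm_groupD(2)[OF assms that perm_groupD(4)[OF assms g(1)]], of "\<lambda>g. g y"]
      by (simp add: orbit_E2_eq)
  qed
  ultimately show "orbit_E2 G x = orbit_E2 G y" by (auto simp: orbit_E2_eq)
qed

text \<open>\<open>Y\<close> identifies the set of lines parallel to the fiber direction with the
  reals, scaled so that \<open>G\<close> acts on it by the symmetries of the integers given by
  \<open>s\<close> and \<open>c\<close>. Statements about the base become statements about values of
  \<open>Y\<close>.\<close>

locale fibered_plane = dihedral_extension G N s c
  for G N :: "(real^2 \<Rightarrow> real^2) set" and s c +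
  fixes Y :: "real^2 \<Rightarrow> real"
  assumes Y_affine: "\<exists>l k. linear l \<and> Y = (\<lambda>x. l x + k)"
    and Y_surj: "surj Y"
    and Y_line: "line_through (fiber_direction N) x = {y. Y y = Y x}"
    and Y_act: "g \<in> G \<Longrightarrow> Y (g x) = of_int (s g) * Y x + of_int (c g)"
begin

abbreviation "V \<equiv> fiber_direction N"

lemma Y_combine: "Y (x + t *\<^sub>R (y - x)) = Y x + t * (Y y - Y x)"
  using Y_affine by (auto simp: linear_add linear_scale linear_diff)

text \<open>Evaluating the action where \<open>Y\<close> is 0 and 1 recovers \<open>c g\<close> and
  \<open>s g\<close>. Thus \<open>N\<close> can be read off from \<open>G\<close> and the level sets
  of \<open>Y\<close>, which is how \<open>conjugate_if_affinely_equivalent\<close> recognizes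
  it.\<close>

lemma N_iff: "g \<in> N \<longleftrightarrow> g \<in> G \<and> (\<forall>x. Y (g x) = Y x)"
proof -
  have "s g = 1 \<and> c g = 0" if "g \<in> G" "\<forall>x. Y (g x) = Y x"
  proof -
    obtain p q where "Y p = 0" "Y q = 1" using Y_surj by (metis surj_def)
    then show ?thesis using that Y_act[of g p] Y_act[of g q] by auto
  qed
  then show ?thesis using Y_act by (auto simp: N_def)
qed

lemma line_eq_iff: "line_through V x = line_through V y \<longleftrightarrow> Y x = Y y"
  unfolding Y_line by auto

lemma coset_action_line:
  assumes "g \<in> G"
  shows "coset_action (N #>\<^bsub>isom_subgroup G\<^esub> g) (line_through V x) = line_through V (g x)"
proof -
  have "(\<Union>n\<in>N. (n \<circ> g) ` {y. Y y = Y x}) = {y. Y y = Y (g x)}"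
  proof (intro equalityI subsetI)
    fix z assume "z \<in> (\<Union>n\<in>N. (n \<circ> g) ` {y. Y y = Y x})"
    then show "z \<in> {y. Y y = Y (g x)}"
      using assms by (auto simp: N_iff Y_act)
  next
    fix z assume z: "z \<in> {y. Y y = Y (g x)}"
    let ?y = "fun_inv g z"
    have g: "g ?y = z" using bij_inv_simps(1)[OF G_bij[OF assms]] .
    have "Y (g ?y) = Y (g x)" using z g by simp
    then have "Y ?y = Y x" using Y_act[OF assms] s[OF assms] by auto
    moreover have "id \<in> N" using N_perm_group by (simp add: perm_group_def)
    ultimately show "z \<in> (\<Union>n\<in>N. (n \<circ> g) ` {y. Y y = Y x})"
      using g by (intro UN_I[of id] image_eqI[of _ _ ?y]) auto
  qed
  then show ?thesis
    unfolding coset_action_def Y_line by (auto simp: r_coset_def)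
qed

lemma base_orbit_line:
  "base_orbit (G, N) (line_through V x) = (\<lambda>g. line_through V (g x)) ` G"
  unfolding base_orbit_def orbit_def case_prod_conv Setcompr_eq_image carrier_FactGroup
    image_image isom_subgroup_simps
  by (rule image_cong[OF refl coset_action_line])

lemma base_orbit_eq_iff:
  "base_orbit (G, N) (line_through V x) = base_orbit (G, N) (line_through V y) \<longleftrightarrow>
     (\<exists>g\<in>G. Y (g x) = Y y)"
proof
  assume *: "base_orbit (G, N) (line_through V x) = base_orbit (G, N) (line_through V y)"
  have "line_through V y \<in> base_orbit (G, N) (line_through V y)"
    unfolding base_orbit_line using imageI[OF G_id, of "\<lambda>g. line_through V (g y)"] by simp
  then have "line_through V y \<in> base_orbit (G, N) (line_through V x)" using * by simp
  then show "\<exists>g\<in>G. Y (g x) = Y y"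
    unfolding base_orbit_line using line_eq_iff by fastforce
next
  assume "\<exists>g\<in>G. Y (g x) = Y y"
  then obtain g where g: "g \<in> G" "Y (g x) = Y y" by blast
  have "line_through V (h y) \<in> base_orbit (G, N) (line_through V x)" if "h \<in> G" for h
  proof -
    have "Y ((h \<circ> g) x) = Y (h y)" using g that by (simp add: Y_act)
    then have "line_through V (h y) = line_through V ((h \<circ> g) x)" using line_eq_iff by auto
    then show ?thesis unfolding base_orbit_line using G_comp[OF that g(1)] by blast
  qed
  moreover have "line_through V (h x) \<in> base_orbit (G, N) (line_through V y)" if "h \<in> G" for h
  proof -
    have "Y ((h \<circ> fun_inv g) (g x)) = Y ((h \<circ> fun_inv g) y)"
      using g that Y_act[OF G_comp[OF that G_inv[OF g(1)]]] by simp
    then have "line_through V (h x) = line_through V ((h \<circ> fun_inv g) y)"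
      using line_eq_iff bij_inv_simps(2)[OF G_bij[OF g(1)]] by auto
    then show ?thesis unfolding base_orbit_line using G_comp[OF that G_inv[OF g(1)]] by blast
  qed
  ultimately show "base_orbit (G, N) (line_through V x) = base_orbit (G, N) (line_through V y)"
    unfolding base_orbit_line by blast
qed

lemma fibration_projection_orbit:
  "fibration_projection (G, N) (orbit_E2 G x) = base_orbit (G, N) (line_through V x)"
proof -
  have "base_orbit (G, N) (line_through V (g x)) = base_orbit (G, N) (line_through V x)"
    if "g \<in> G" for g
    using that base_orbit_eq_iff by metis
  then have "(\<lambda>x. base_orbit (G, N) (line_through V x)) ` orbit_E2 G x =
      {base_orbit (G, N) (line_through V x)}"
    using G_id by (auto simp: orbit_E2_eq)
  then show ?thesis unfolding fibration_projection_def by simp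
qed

end

section \<open>Affine equivalence as conjugation by one affinity\<close>

lemma fiber_direction_conjugate:
  assumes A: "linear A" "bij A" "\<phi> = (\<lambda>x. A x + c)"
  shows "fiber_direction (conjugate \<phi> N) = A ` fiber_direction N"
proof -
  have "affinity \<phi>" unfolding affinity_def using A by blast
  then have b: "bij \<phi>" by (rule affinity_bij)
  have tr: "fun_inv \<phi> \<circ> (\<lambda>x. x + A a) \<circ> \<phi> = (\<lambda>x. x + a)" for a
  proof
    fix x
    have "\<phi> x + A a = \<phi> (x + a)" using A by (simp add: linear_add)
    then show "(fun_inv \<phi> \<circ> (\<lambda>x. x + A a) \<circ> \<phi>) x = x + a" using b by (simp add: bij_inv_simps)
  qed
  have "{a. (\<lambda>x. x + a) \<in> conjugate \<phi> N} = A ` {a. (\<lambda>x. x + a) \<in> N}"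
  proof (intro equalityI subsetI)
    fix a assume a: "a \<in> {a. (\<lambda>x. x + a) \<in> conjugate \<phi> N}"
    have "a = A (fun_inv A a)" using bij_inv_simps(1)[OF A(2)] by simp
    then show "a \<in> A ` {a. (\<lambda>x. x + a) \<in> N}"
      using a tr[of "fun_inv A a"] by (auto simp: in_conjugate_iff[OF b])
  qed (auto simp: in_conjugate_iff[OF b] tr)
  then show ?thesis unfolding fiber_direction_def using A(1) by (simp add: linear_span_image)
qed

lemma line_through_conjugate:
  assumes "affinity \<phi>"
  shows "line_through (fiber_direction (conjugate \<phi> N)) (\<phi> x) = \<phi> ` line_through (fiber_direction N) x"
proof -
  obtain A c where A: "linear A" "bij A" "\<phi> = (\<lambda>x. A x + c)" using assms by (auto simp: affinity_def)
  show ?thesis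
    unfolding fiber_direction_conjugate[OF A] line_through_def image_image
    by (auto simp: A linear_add[OF A(1)] algebra_simps intro!: image_cong)
qed

text \<open>Transport of structure: it suffices to exhibit \<open>Y\<close> for the models.\<close>

lemma fibered_plane_conjugate:
  assumes "affinity \<phi>" "fibered_plane G N s c Y"
  shows "fibered_plane (conjugate \<phi> G) (conjugate \<phi> N)
    (\<lambda>g. s (fun_inv \<phi> \<circ> g \<circ> \<phi>)) (\<lambda>g. c (fun_inv \<phi> \<circ> g \<circ> \<phi>)) (Y \<circ> fun_inv \<phi>)"
proof -
  interpret fibered_plane G N s c Y by fact
  have b: "bij \<phi>" using affinity_bij assms(1) .
  interpret C: dihedral_extension "conjugate \<phi> G" "conjugate \<phi> N"
    "\<lambda>g. s (fun_inv \<phi> \<circ> g \<circ> \<phi>)" "\<lambda>g. c (fun_inv \<phi> \<circ> g \<circ> \<phi>)"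
    using dihedral_extension_conjugate[OF b dihedral_extension_axioms] .
  show ?thesis
  proof
    obtain l k where l: "linear l" "Y = (\<lambda>x. l x + k)" using Y_affine by blast
    obtain A d where A: "linear A" "fun_inv \<phi> = (\<lambda>x. A x + d)"
      using affinity_inv[OF assms(1)] by (auto simp: affinity_def)
    show "\<exists>l k. linear l \<and> Y \<circ> fun_inv \<phi> = (\<lambda>x. l x + k)"
      by (intro exI[of _ "l \<circ> A"] exI[of _ "l d + k"])
        (use l A in \<open>auto simp: linear_compose linear_add fun_eq_iff\<close>)
    show "surj (Y \<circ> fun_inv \<phi>)"
      using Y_surj b by (metis bij_imp_bij_inv bij_is_surj comp_surj)
    show "line_through (fiber_direction (conjugate \<phi> N)) x = {y. (Y \<circ> fun_inv \<phi>) y = (Y \<circ> fun_inv \<phi>) x}" for x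
    proof -
      have "line_through (fiber_direction (conjugate \<phi> N)) x = \<phi> ` {y. Y y = Y (fun_inv \<phi> x)}"
        using line_through_conjugate[OF assms(1), of N "fun_inv \<phi> x"] bij_inv_simps(1)[OF b] Y_line by metis
      also have "\<dots> = {y. (Y \<circ> fun_inv \<phi>) y = (Y \<circ> fun_inv \<phi>) x}"
        using b by (auto simp: bij_inv_simps image_iff) (metis bij_inv_simps(1))
      finally show ?thesis .
    qed
    fix g x assume g: "g \<in> conjugate \<phi> G"
    have "(Y \<circ> fun_inv \<phi>) (g x) = Y ((fun_inv \<phi> \<circ> g \<circ> \<phi>) (fun_inv \<phi> x))"
      using b by (simp add: bij_inv_simps)
    then show "(Y \<circ> fun_inv \<phi>) (g x) = of_int (s (fun_inv \<phi> \<circ> g \<circ> \<phi>)) * (Y \<circ> fun_inv \<phi>) x + of_int (c (fun_inv \<phi> \<circ> g \<circ> \<phi>))"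
      using Y_act[of "fun_inv \<phi> \<circ> g \<circ> \<phi>" "fun_inv \<phi> x"] g in_conjugate_iff[OF b] by simp
  qed
qed

text \<open>The conjugating affinity plays both roles. Images under it give the map of orbit spaces,
  images of images the map of bases, and it also induces the affinity between the spaces of
  lines.\<close>

lemma affinely_equivalent_if_conjugate:
  assumes "fibered_plane G1 N1 s1 c1 Y1" "affinely_conjugate (G1, N1) (G2, N2)"
  shows "affinely_equivalent (G1, N1) (G2, N2)"
proof -
  interpret F1: fibered_plane G1 N1 s1 c1 Y1 by fact
  obtain \<phi> where \<phi>: "affinity \<phi>" and G2: "G2 = conjugate \<phi> G1" and N2: "N2 = conjugate \<phi> N1"
    using assms(2) by (auto simp: affinely_conjugate_def)
  interpret F2: fibered_plane G2 N2 "\<lambda>g. s1 (fun_inv \<phi> \<circ> g \<circ> \<phi>)" "\<lambda>g. c1 (fun_inv \<phi> \<circ> g \<circ> \<phi>)"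
    "Y1 \<circ> fun_inv \<phi>"
    unfolding G2 N2 using fibered_plane_conjugate[OF \<phi> assms(1)] .
  have b: "bij \<phi>" using affinity_bij \<phi> .
  note line = line_through_conjugate[OF \<phi>, of N1, folded N2]
  let ?\<gamma> = "\<lambda>g. \<phi> \<circ> g \<circ> fun_inv \<phi>"
  have G2_im: "G2 = ?\<gamma> ` G1" by (simp add: G2 conjugate_def)
  have orb: "\<phi> ` orbit_E2 G1 x = orbit_E2 G2 (\<phi> x)" for x
    unfolding orbit_E2_eq G2_im image_image by (simp add: bij_inv_simps[OF b])
  have borb: "(image \<phi>) ` base_orbit (G1, N1) (line_through F1.V x) =
      base_orbit (G2, N2) (line_through F2.V (\<phi> x))" for x
    unfolding F1.base_orbit_line F2.base_orbit_line
    unfolding G2_im image_image by (simp add: bij_inv_simps[OF b] line[symmetric])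
  have lines: "(image \<phi>) ` range (line_through F1.V) = range (line_through F2.V)"
  proof -
    have "range (line_through F2.V) = range (\<lambda>x. line_through F2.V (\<phi> x))"
      using image_image[of "line_through F2.V" \<phi> UNIV] bij_is_surj[OF b] by simp
    then show ?thesis by (simp add: image_image line)
  qed
  have act: "(\<lambda>L\<in>range (line_through F2.V). \<phi> ` coset_action (N1 #>\<^bsub>isom_subgroup G1\<^esub> g) (fun_inv \<phi> ` L)) =
     (\<lambda>L\<in>range (line_through F2.V). coset_action (N2 #>\<^bsub>isom_subgroup G2\<^esub> (?\<gamma> g)) L)"
    if g: "g \<in> G1" for g
  proof (rule restrict_ext)
    fix L assume "L \<in> range (line_through F2.V)"
    then obtain y where y: "L = line_through F2.V (\<phi> y)"
      using bij_inv_simps(1)[OF b] by (metis rangeE)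
    have inv_L: "fun_inv \<phi> ` L = line_through F1.V y"
      unfolding y line using b by (simp add: image_image bij_inv_simps)
    have mem: "?\<gamma> g \<in> G2" using g by (simp add: G2_im)
    have "\<phi> ` coset_action (N1 #>\<^bsub>isom_subgroup G1\<^esub> g) (fun_inv \<phi> ` L) = line_through F2.V (\<phi> (g y))"
      by (simp only: inv_L F1.coset_action_line[OF g] line)
    also have "\<dots> = coset_action (N2 #>\<^bsub>isom_subgroup G2\<^esub> (?\<gamma> g)) L"
      by (simp only: y F2.coset_action_line[OF mem] comp_apply bij_inv_simps[OF b])
    finally show "\<phi> ` coset_action (N1 #>\<^bsub>isom_subgroup G1\<^esub> g) (fun_inv \<phi> ` L) =
        coset_action (N2 #>\<^bsub>isom_subgroup G2\<^esub> (?\<gamma> g)) L" .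
  qed
  have im_G2: "f ` G2 = (\<lambda>g. f (?\<gamma> g)) ` G1" for f :: "(real^2 \<Rightarrow> real^2) \<Rightarrow> (real^2) set \<Rightarrow> (real^2) set"
    by (simp only: G2_im image_image)
  have "affine_homeo G1 G2 (image \<phi>)"
    unfolding affine_homeo_def using \<phi> orb by (intro exI[of _ \<phi>]) (auto simp: G2_im)
  moreover have "affine_base_homeo (G1, N1) (G2, N2) (image (image \<phi>))"
    unfolding affine_base_homeo_def Let_def case_prod_conv
  proof (intro exI[of _ \<phi>] conjI)
    show "(\<lambda>C. \<lambda>L\<in>range (line_through F2.V). \<phi> ` coset_action C (fun_inv \<phi> ` L)) `
        carrier (isom_subgroup G1 Mod N1) =
      (\<lambda>C. restrict (coset_action C) (range (line_through F2.V))) ` carrier (isom_subgroup G2 Mod N2)"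
      unfolding carrier_FactGroup image_image isom_subgroup_simps im_G2
      by (rule image_cong[OF refl act])
    show "\<forall>L\<in>range (line_through F1.V).
        (image \<phi>) ` base_orbit (G1, N1) L = base_orbit (G2, N2) (\<phi> ` L)"
      using borb line by auto
  qed (use \<phi> lines in auto)
  moreover have "(image (image \<phi>)) (fibration_projection (G1, N1) (orbit_E2 G1 x)) =
      fibration_projection (G2, N2) (\<phi> ` orbit_E2 G1 x)" for x
    unfolding orb F1.fibration_projection_orbit F2.fibration_projection_orbit borb ..
  ultimately show ?thesis
    unfolding affinely_equivalent_def by auto
qed

text \<open>Commutativity of the square only says that \<open>Y2 (\<phi> x)\<close> and
  \<open>Y2 (\<psi> x)\<close> are related by a symmetry of the integers that may vary with
  \<open>x\<close>. This still forces \<open>Y2 \<circ> \<phi>\<close> to be constant on the level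
  sets of \<open>Y1\<close>, hence to be an affine function of \<open>Y1\<close> with nonzero slope.
  So \<phi> matches the two families of lines, and by \<open>N_iff\<close> the elements fixing all
  lines correspond.\<close>

lemma conjugate_if_affinely_equivalent:
  assumes "fibered_plane G1 N1 s1 c1 Y1" "fibered_plane G2 N2 s2 c2 Y2"
    and "affinely_equivalent (G1, N1) (G2, N2)"
  shows "affinely_conjugate (G1, N1) (G2, N2)"
proof -
  interpret F1: fibered_plane G1 N1 s1 c1 Y1 by fact
  interpret F2: fibered_plane G2 N2 s2 c2 Y2 by fact
  obtain \<alpha> \<beta> where \<alpha>: "affine_homeo G1 G2 \<alpha>" and \<beta>: "affine_base_homeo (G1, N1) (G2, N2) \<beta>"
    and comm: "\<And>x. \<beta> (fibration_projection (G1, N1) (orbit_E2 G1 x)) =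
                  fibration_projection (G2, N2) (\<alpha> (orbit_E2 G1 x))"
    using assms(3) unfolding affinely_equivalent_def by auto
  obtain \<phi> where \<phi>: "affinity \<phi>" and G2: "conjugate \<phi> G1 = G2"
    and \<alpha>': "\<And>x. \<alpha> (orbit_E2 G1 x) = orbit_E2 G2 (\<phi> x)"
    using \<alpha> unfolding affine_homeo_def conjugate_def by blast
  obtain \<psi> where \<psi>: "affinity \<psi>" and lines: "(image \<psi>) ` range (line_through F1.V) = range (line_through F2.V)"
    and \<beta>': "\<And>x. \<beta> (base_orbit (G1, N1) (line_through F1.V x)) = base_orbit (G2, N2) (\<psi> ` line_through F1.V x)"
    using \<beta> unfolding affine_base_homeo_def Let_def by auto
  have b: "bij \<phi>" using affinity_bij \<phi> .
  have \<psi>_line: "\<psi> ` line_through F1.V x = line_through F2.V (\<psi> x)" for x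
  proof -
    have "\<psi> ` line_through F1.V x \<in> range (line_through F2.V)" using lines by blast
    then obtain y where y: "\<psi> ` line_through F1.V x = line_through F2.V y" by auto
    have "\<psi> x \<in> line_through F2.V y" using y F1.Y_line by auto
    then show ?thesis using y F2.Y_line F2.line_eq_iff by auto
  qed
  have \<psi>_const: "Y2 (\<psi> x) = Y2 (\<psi> y)" if "Y1 x = Y1 y" for x y
    using that \<psi>_line F1.line_eq_iff F2.line_eq_iff by metis
  have rel: "\<exists>\<epsilon> n. (\<epsilon> = 1 \<or> \<epsilon> = -1) \<and> Y2 (\<phi> x) = \<epsilon> * Y2 (\<psi> x) + of_int n" for x
  proof -
    have "base_orbit (G2, N2) (line_through F2.V (\<psi> x)) = base_orbit (G2, N2) (line_through F2.V (\<phi> x))"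
      using comm[of x] \<alpha>'[of x] \<beta>'[of x] \<psi>_line[of x]
      by (simp add: F1.fibration_projection_orbit F2.fibration_projection_orbit)
    then obtain g where g: "g \<in> G2" "Y2 (g (\<psi> x)) = Y2 (\<phi> x)"
      unfolding F2.base_orbit_eq_iff by blast
    then show ?thesis using F2.Y_act[OF g(1)] F2.s[OF g(1)]
      by (intro exI[of _ "of_int (s2 g)"] exI[of _ "c2 g"]) auto
  qed
  obtain l k where l: "linear l" "Y2 = (\<lambda>x. l x + k)" using F2.Y_affine by blast
  obtain A d where A: "linear A" "\<phi> = (\<lambda>x. A x + d)" using \<phi> by (auto simp: affinity_def)
  have aff: "Y2 (\<phi> (x + t *\<^sub>R (y - x))) = Y2 (\<phi> x) + t * (Y2 (\<phi> y) - Y2 (\<phi> x))" for x y t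
    using l A by (simp add: linear_add linear_scale linear_diff algebra_simps)
  have \<phi>_const: "Y2 (\<phi> x) = Y2 (\<phi> y)" if xy: "Y1 x = Y1 y" for x y
  proof (rule ccontr)
    assume ne: "Y2 (\<phi> x) \<noteq> Y2 (\<phi> y)"
    let ?z = "\<lambda>t. x + t *\<^sub>R (y - x)"
    let ?u = "Y2 (\<psi> x)"
    \<comment> \<open>On the line through \<open>x\<close> and \<open>y\<close> the affine function \<open>Y2 \<circ> \<phi>\<close> would take every real value, but
      its values lie in \<open>\<plusminus>?u + \<int>\<close>, which cannot contain both \<open>?u + 1/3\<close> and \<open>?u + 1/4\<close>.\<close>
    have "Y2 (\<psi> (?z t)) = ?u" for t
      using \<psi>_const[of "?z t" x] F1.Y_combine[of x t y] xy by simp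
    then have "\<exists>\<epsilon> n. (\<epsilon> = 1 \<or> \<epsilon> = -1) \<and> v = \<epsilon> * ?u + of_int n" for v
      using rel[of "?z ((v - Y2 (\<phi> x)) / (Y2 (\<phi> y) - Y2 (\<phi> x)))"] ne by (simp add: aff)
    from this[of "?u + 1/3"] this[of "?u + 1/4"] obtain \<epsilon> n \<epsilon>' m where
      e: "\<epsilon> = 1 \<or> \<epsilon> = -1" "\<epsilon>' = 1 \<or> \<epsilon>' = -1" and
      eq: "?u + 1/3 = \<epsilon> * ?u + of_int n" "?u + 1/4 = \<epsilon>' * ?u + of_int m" by blast
    \<comment> \<open>A sign 1 would make 1/3 or 1/4 an integer; if both signs are -1, subtracting
      the two equations gives \<open>1/12 = n - m\<close>.\<close>
    have n: "3 * real_of_int a \<noteq> 1" "4 * real_of_int a \<noteq> 1" "12 * real_of_int a \<noteq> 1" for a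
    proof -
      have "3 * a \<noteq> 1" "4 * a \<noteq> 1" "12 * a \<noteq> 1" by presburger+
      then have "real_of_int (3 * a) \<noteq> real_of_int 1" "real_of_int (4 * a) \<noteq> real_of_int 1"
        "real_of_int (12 * a) \<noteq> real_of_int 1" by (simp_all only: of_int_eq_iff not_False_eq_True)
      then show "3 * real_of_int a \<noteq> 1" "4 * real_of_int a \<noteq> 1" "12 * real_of_int a \<noteq> 1" by simp_all
    qed
    show False
      using e eq n[of n] n[of m] n(3)[of "n - m"] by (auto simp: algebra_simps)
  qed
  obtain p q where pq: "Y1 p = 0" "Y1 q = 1" using F1.Y_surj by (metis surj_def)
  define a where "a = Y2 (\<phi> q) - Y2 (\<phi> p)"
  have Y21: "Y2 (\<phi> x) = Y2 (\<phi> p) + Y1 x * a" for x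
  proof -
    have "Y1 (p + Y1 x *\<^sub>R (q - p)) = Y1 x" using F1.Y_combine pq by simp
    from \<phi>_const[OF this] show ?thesis using aff[of p "Y1 x" q] by (simp add: a_def)
  qed
  have a0: "a \<noteq> 0"
  proof
    assume "a = 0"
    then have const: "Y2 (\<phi> x) = Y2 (\<phi> p)" for x using Y21 by simp
    obtain y where "Y2 y = Y2 (\<phi> p) + 1" using F2.Y_surj by (metis surj_def)
    then have "Y2 (\<phi> (fun_inv \<phi> y)) = Y2 (\<phi> p) + 1" by (simp add: bij_inv_simps(1)[OF b])
    then show False using const[of "fun_inv \<phi> y"] by simp
  qed
  have "conjugate \<phi> N1 = N2"
  proof (intro equalityI subsetI)
    fix g assume "g \<in> conjugate \<phi> N1"
    then obtain h where h: "h \<in> N1" "g = \<phi> \<circ> h \<circ> fun_inv \<phi>" by (auto simp: conjugate_def)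
    have "Y2 (g x) = Y2 x" for x
      using Y21[of "h (fun_inv \<phi> x)"] Y21[of "fun_inv \<phi> x"] h by (simp add: F1.N_iff bij_inv_simps[OF b])
    moreover have "g \<in> G2" using h F1.N_sub G2 by (auto simp: conjugate_def)
    ultimately show "g \<in> N2" by (simp add: F2.N_iff)
  next
    fix g assume g: "g \<in> N2"
    then obtain h where h: "h \<in> G1" "g = \<phi> \<circ> h \<circ> fun_inv \<phi>" using F2.N_sub G2 by (auto simp: conjugate_def)
    have "Y1 (h x) = Y1 x" for x
    proof -
      have "g (\<phi> x) = \<phi> (h x)" using h(2) by (simp add: bij_inv_simps[OF b])
      then have "Y2 (\<phi> (h x)) = Y2 (\<phi> x)" using g by (metis F2.N_iff)
      then show ?thesis using Y21[of x] Y21[of "h x"] a0 by simp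
    qed
    then have "h \<in> N1" using h F1.N_iff by simp
    then show "g \<in> conjugate \<phi> N1" using h by (auto simp: conjugate_def)
  qed
  then show ?thesis unfolding affinely_conjugate_def using \<phi> G2 by auto
qed

section \<open>Model groups\<close>

text \<open>The affine maps that preserve the horizontal direction. Elements of normalized groups
  have no shear, so \<open>c\<close> is 0 for them; a nonzero shear occurs only in conjugating
  maps.\<close>

definition tri :: "real \<Rightarrow> real \<Rightarrow> real \<Rightarrow> real \<Rightarrow> real \<Rightarrow> real^2 \<Rightarrow> real^2" where
  "tri p c d q w = (\<lambda>v. vector [p * v$1 + c * v$2 + d, q * v$2 + w])"

lemma vec2_eq_iff: "(v :: real^2) = u \<longleftrightarrow> v$1 = u$1 \<and> v$2 = u$2"
  by (simp add: vec_eq_iff forall_2)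

lemma tri_nth [simp]:
  "tri p c d q w v $ 1 = p * v$1 + c * v$2 + d" "tri p c d q w v $ 2 = q * v$2 + w"
  by (simp_all add: tri_def)

lemma tri_comp:
  "tri p c d q w \<circ> tri p' c' d' q' w' =
     tri (p * p') (p * c' + c * q') (p * d' + c * w' + d) (q * q') (q * w' + w)"
  by (simp add: fun_eq_iff vec2_eq_iff algebra_simps)

lemma tri_id: "tri 1 0 0 1 0 = id"
  by (simp add: fun_eq_iff vec2_eq_iff)

lemma tri_eq_iff:
  "tri p c d q w = tri p' c' d' q' w' \<longleftrightarrow> p = p' \<and> c = c' \<and> d = d' \<and> q = q' \<and> w = w'"
proof
  assume *: "tri p c d q w = tri p' c' d' q' w'"
  have "tri p c d q w v $ i = tri p' c' d' q' w' v $ i" for v i using * by simp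
  from this[of 0 1] this[of 0 2] this[of "vector [1,0]" 1] this[of "vector [0,1]" 1]
    this[of "vector [0,1]" 2]
  show "p = p' \<and> c = c' \<and> d = d' \<and> q = q' \<and> w = w'" by simp
qed auto

lemma tri_inverse:
  assumes "p \<noteq> 0" "q \<noteq> 0"
  shows "bij (tri p c d q w)"
    and "fun_inv (tri p c d q w) = tri (1/p) (- c/(p*q)) (c*w/(p*q) - d/p) (1/q) (- w/q)"
proof -
  let ?g = "tri (1/p) (- c/(p*q)) (c*w/(p*q) - d/p) (1/q) (- w/q)"
  have *: "tri p c d q w \<circ> ?g = id" "?g \<circ> tri p c d q w = id"
    using assms unfolding tri_comp tri_id[symmetric] tri_eq_iff by (auto simp: field_simps)
  show "bij (tri p c d q w)" using o_bij[OF *(2,1)] .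
  then show "fun_inv (tri p c d q w) = ?g"
    using * by (metis inv_unique_comp)
qed

lemma affinity_tri:
  assumes "p \<noteq> 0" "q \<noteq> 0"
  shows "affinity (tri p c d q w)"
  unfolding affinity_def
proof (intro exI conjI)
  show "linear (tri p c 0 q 0)" by (auto simp: linear_iff vec2_eq_iff algebra_simps)
  show "bij (tri p c 0 q 0)" using tri_inverse assms by blast
  show "tri p c d q w = (\<lambda>x. tri p c 0 q 0 x + vector [d, w])"
    by (simp add: fun_eq_iff vec2_eq_iff)
qed

lemma norm_vec2: "norm (v :: real^2) = sqrt ((v$1)\<^sup>2 + (v$2)\<^sup>2)"
  by (simp add: norm_eq_sqrt_inner inner_vec_def sum_2 power2_eq_square)

lemma dist_tri:
  assumes "p\<^sup>2 = 1" "q\<^sup>2 = 1"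
  shows "dist (tri p 0 d q w x) (tri p 0 d q w y) = dist x y"
proof -
  have "(p * a - p * b)\<^sup>2 = (a - b)\<^sup>2" if "p\<^sup>2 = 1" for p a b :: real
    using that by (metis mult.left_neutral power_mult_distrib right_diff_distrib)
  then show ?thesis using assms by (simp add: dist_norm norm_vec2)
qed

text \<open>Signs are coded by booleans so that multiplying them becomes \<open>\<noteq>\<close>,
  the same operation as adding parities.\<close>

definition sg :: "bool \<Rightarrow> real" where
  "sg e = (if e then - 1 else 1)"

lemma sg_simps [simp]: "sg True = - 1" "sg False = 1" "(sg e)\<^sup>2 = 1" "sg e \<noteq> 0" "sg e * sg e = 1"
  "sg e = 1 \<longleftrightarrow> \<not> e" "sg e = sg e' \<longleftrightarrow> e = e'"
  by (auto simp: sg_def)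

lemma sg_mult: "sg e * sg e' = sg (e \<noteq> e')"
  by (auto simp: sg_def)

lemma sg_xor: "sg (e \<noteq> e') = sg e * sg e'" "sg (e = (\<not> e')) = sg e * sg e'"
  by (auto simp: sg_def)

lemma sg_of_int: "sg e * of_int A = of_int (if e then - A else A)"
  by (auto simp: sg_def)

text \<open>
  The groups in the classification are the preimages of subspaces \<open>H\<close> of \<open>bool\<^sup>4\<close> under the homomorphism that
  sends \<open>(x, y) \<mapsto> (\<plusminus>x + A, \<plusminus>y + M)\<close> to its two signs and the parities of \<open>A\<close> and \<open>M\<close>.
\<close>

definition pattern_group :: "(bool \<Rightarrow> bool \<Rightarrow> bool \<Rightarrow> bool \<Rightarrow> bool) \<Rightarrow> (real^2 \<Rightarrow> real^2) set" where
  "pattern_group H = {tri (sg e) 0 (of_int A) (sg d) (of_int M) | e A d M. H e (odd A) d (odd M)}"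

text \<open>The period is 2 and not 1 so that a shift by half a period, the only one that survives
  normalization, is an integer and is detected by its parity.\<close>

definition pattern_fiber :: "bool \<Rightarrow> (real^2 \<Rightarrow> real^2) set" where
  "pattern_fiber f = {tri (sg e) 0 (of_int A) 1 0 | e A. even A \<and> (e \<longrightarrow> f)}"

text \<open>\<open>s\<close> and \<open>c\<close> for the models: slope and value at 0 of the
  induced map of the second coordinate, taken from the map itself so that no choice of parameters
  enters.\<close>

definition line_sign :: "(real^2 \<Rightarrow> real^2) \<Rightarrow> int" where
  "line_sign g = (if g (vector [0,1]) $ 2 - g 0 $ 2 = 1 then 1 else - 1)"

definition line_shift :: "(real^2 \<Rightarrow> real^2) \<Rightarrow> int" where
  "line_shift g = \<lfloor>g 0 $ 2\<rfloor>"

lemma line_tri [simp]: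
  "line_sign (tri p c d q w) = (if q = 1 then 1 else - 1)"
  "line_shift (tri p c d q w) = \<lfloor>w\<rfloor>"
  by (simp_all add: line_sign_def line_shift_def)

text \<open>\<open>H_add\<close> is closure under addition over the field with two elements.
  \<open>H_fiber\<close> fixes the part lying over the identity pattern of the base to be that of
  \<open>pattern_fiber f\<close>. The last two conditions provide a lift of \<open>y + 1\<close>
  and, precisely if \<open>b\<close>, a lift of a reflection. So \<open>f\<close> and
  \<open>b\<close> tell whether fiber and base are intervals.\<close>

locale pattern =
  fixes H :: "bool \<Rightarrow> bool \<Rightarrow> bool \<Rightarrow> bool \<Rightarrow> bool" and f b :: bool
  assumes H_add: "H e a d n \<Longrightarrow> H e' a' d' n' \<Longrightarrow> H (e \<noteq> e') (a \<noteq> a') (d \<noteq> d') (n \<noteq> n')"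
    and H_fiber: "H e a False False \<longleftrightarrow> \<not> a \<and> (e \<longrightarrow> f)"
    and H_translation: "\<exists>e a. H e a False True"
    and H_reflection: "(\<exists>e a. H e a True False) \<longleftrightarrow> b"
begin

lemma H_base: "H e a d n \<Longrightarrow> d \<Longrightarrow> b"
proof -
  assume H: "H e a d n" d
  obtain e' a' where "H e' a' False True" using H_translation by blast
  from H_add[OF H(1) this] H show b using H_reflection by (cases n) auto
qed

lemma pattern_groupE:
  assumes "g \<in> pattern_group H"
  obtains e A d M where "g = tri (sg e) 0 (of_int A) (sg d) (of_int M)" "H e (odd A) d (odd M)"
  using assms by (auto simp: pattern_group_def)

lemma pattern_groupI:
  assumes "H e (odd A) d (odd M)"
  shows "tri (sg e) 0 (of_int A) (sg d) (of_int M) \<in> pattern_group H"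
  using assms unfolding pattern_group_def by blast

text \<open>A change of sign keeps the parity of an integer. Hence composition acts on the four
  booleans by \<open>\<noteq>\<close>, and an inverse has the same booleans.\<close>

lemma perm_group_pattern: "perm_group (pattern_group H)"
  unfolding perm_group_def
proof (intro conjI ballI)
  have "H False (odd (0::int)) False (odd (0::int))" using H_fiber by simp
  then have "tri (sg False) 0 (of_int 0) (sg False) (of_int 0) \<in> pattern_group H"
    unfolding pattern_group_def by blast
  then show "id \<in> pattern_group H" by (simp add: tri_id)
next
  fix g h assume "g \<in> pattern_group H" "h \<in> pattern_group H"
  then obtain e A d M e' A' d' M' where
    g: "g = tri (sg e) 0 (of_int A) (sg d) (of_int M)" "H e (odd A) d (odd M)" and
    h: "h = tri (sg e') 0 (of_int A') (sg d') (of_int M')" "H e' (odd A') d' (odd M')"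
    by (elim pattern_groupE)
  have "g \<circ> h = tri (sg (e \<noteq> e')) 0 (of_int ((if e then - A' else A') + A)) (sg (d \<noteq> d'))
      (of_int ((if d then - M' else M') + M))"
    by (simp only: g h tri_comp sg_mult sg_of_int of_int_add) simp
  moreover have "H (e \<noteq> e') (odd ((if e then - A' else A') + A)) (d \<noteq> d') (odd ((if d then - M' else M') + M))"
  proof -
    have "odd ((if e then - A' else A') + A) \<longleftrightarrow> odd A \<noteq> odd A'"
      "odd ((if d then - M' else M') + M) \<longleftrightarrow> odd M \<noteq> odd M'" by auto
    then show ?thesis using H_add[OF g(2) h(2)] by simp
  qed
  ultimately show "g \<circ> h \<in> pattern_group H" unfolding pattern_group_def by blast
next
  fix g assume "g \<in> pattern_group H"
  then obtain e A d M where g: "g = tri (sg e) 0 (of_int A) (sg d) (of_int M)" "H e (odd A) d (odd M)"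
    by (elim pattern_groupE)
  show "bij g" unfolding g by (rule tri_inverse) auto
  have "fun_inv g = tri (sg e) 0 (of_int (if e then A else - A)) (sg d) (of_int (if d then M else - M))"
    unfolding g(1) by (subst tri_inverse) (auto simp: tri_eq_iff)
  moreover have "H e (odd (if e then A else - A)) d (odd (if d then M else - M))"
    using g(2) by (cases e; cases d) simp_all
  ultimately show "fun_inv g \<in> pattern_group H" unfolding pattern_group_def by blast
qed

lemma dihedral_extension_pattern:
  "dihedral_extension (pattern_group H) (pattern_fiber f) line_sign line_shift"
proof
  show "perm_group (pattern_group H)" by (rule perm_group_pattern)
  show "line_sign g = 1 \<or> line_sign g = -1" for g by (simp add: line_sign_def)
  fix g h assume "g \<in> pattern_group H" "h \<in> pattern_group H"
  then obtain e A d M e' A' d' M' where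
    g: "g = tri (sg e) 0 (of_int A) (sg d) (of_int M)" and
    h: "h = tri (sg e') 0 (of_int A') (sg d') (of_int M')"
    by (elim pattern_groupE)
  show "line_sign (g \<circ> h) = line_sign g * line_sign h"
    "line_shift (g \<circ> h) = line_sign g * line_shift h + line_shift g"
    by (auto simp: g h tri_comp sg_mult sg_of_int simp flip: of_int_add)
next
  show "pattern_fiber f = {g \<in> pattern_group H. line_sign g = 1 \<and> line_shift g = 0}"
    (is "?L = ?R")
  proof (intro equalityI subsetI)
    fix g assume "g \<in> ?L"
    then obtain e A where g: "g = tri (sg e) 0 (of_int A) 1 0" "even A" "e \<longrightarrow> f"
      by (auto simp: pattern_fiber_def)
    have "g = tri (sg e) 0 (of_int A) (sg False) (of_int 0)" "H e (odd A) False (odd (0::int))"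
      using g H_fiber by auto
    then have "g \<in> pattern_group H" unfolding pattern_group_def by blast
    then show "g \<in> ?R" by (simp add: g)
  next
    fix g assume gR: "g \<in> ?R"
    then obtain e A d M where g: "g = tri (sg e) 0 (of_int A) (sg d) (of_int M)" "H e (odd A) d (odd M)"
      using pattern_groupE by blast
    have "\<not> d" "M = 0" using gR by (auto simp: g(1) split: if_splits)
    then show "g \<in> ?L" using g H_fiber by (auto simp: pattern_fiber_def)
  qed
next
  obtain e a where H: "H e a False True" using H_translation by blast
  have "tri (sg e) 0 (of_int (if a then 1 else 0)) (sg False) (of_int 1) \<in> pattern_group H"
    using H by (intro pattern_groupI) auto
  then show "\<exists>t\<in>pattern_group H. line_sign t = 1 \<and> line_shift t = 1"
    by (rule bexI[rotated]) simp
  show "(\<exists>r\<in>pattern_group H. line_sign r = -1 \<and> line_shift r = 0) \<or>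
    (\<forall>g\<in>pattern_group H. line_sign g = 1)"
  proof (cases b)
    case True
    then obtain e a where H: "H e a True False" using H_reflection by blast
    have "tri (sg e) 0 (of_int (if a then 1 else 0)) (sg True) (of_int 0) \<in> pattern_group H"
      using H by (intro pattern_groupI) auto
    then have "\<exists>r\<in>pattern_group H. line_sign r = -1 \<and> line_shift r = 0"
      by (rule bexI[rotated]) simp
    then show ?thesis ..
  next
    case False
    then show ?thesis using H_base by (auto elim!: pattern_groupE)
  qed
qed

lemma discrete_pattern: "discrete (pattern_group H)"
proof (rule discreteI)
  fix g assume gG: "g \<in> pattern_group H"
  \<comment> \<open>The image of 0 yields \<open>A\<close> and \<open>M\<close>; the image of (1, 1)
    then yields both signs. All coordinates involved are integers, so radius 1 separates
    them.\<close>
  let ?p = "vector [1, 1] :: real^2"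
  let ?T = "(\<lambda>h. h 0) -` ball (g 0) 1 \<inter> (\<lambda>h. h ?p) -` ball (g ?p) 1"
  have "open ?T"
    by (intro open_Int open_vimage open_ball continuous_on_product_coordinates)
  moreover have "?T \<inter> pattern_group H = {g}"
  proof (intro equalityI subsetI)
    fix h assume h': "h \<in> ?T \<inter> pattern_group H"
    obtain e A d M where g: "g = tri (sg e) 0 (of_int A) (sg d) (of_int M)" using gG by (elim pattern_groupE)
    obtain e' A' d' M' where h: "h = tri (sg e') 0 (of_int A') (sg d') (of_int M')"
      using h' by (auto elim: pattern_groupE)
    have "norm (g 0 - h 0) < 1" "norm (g ?p - h ?p) < 1" using h' by (auto simp: dist_norm)
    then have lt: "\<bar>(g 0 - h 0) $ i\<bar> < 1" "\<bar>(g ?p - h ?p) $ i\<bar> < 1" for i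
      using component_le_norm_cart le_less_trans by blast+
    have int_small: "x = y" if "\<bar>real_of_int x - real_of_int y\<bar> < 1" for x y using that by linarith
    have 1: "A = A'" "M = M'" using lt(1)[of 1] lt(1)[of 2] int_small by (auto simp: g h)
    have 2: "sg e = sg e'" "sg d = sg d'" using lt(2)[of 1] lt(2)[of 2] 1 by (auto simp: g h sg_def split: if_splits)
    then show "h \<in> {g}" using 1 by (simp add: g h)
  qed (use gG in auto)
  ultimately show "g isolated_in pattern_group H" unfolding isolated_in_def using gG by blast
qed

lemma translation_in_pattern: "even A \<Longrightarrow> even M \<Longrightarrow> tri 1 0 (of_int A) 1 (of_int M) \<in> pattern_group H"
proof -
  assume *: "even A" "even M"
  have "tri (sg False) 0 (of_int A) (sg False) (of_int M) \<in> pattern_group H"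
    using * H_fiber by (intro pattern_groupI) auto
  then show ?thesis by simp
qed

text \<open>All translations by pairs of even integers are in the group, so a square of side 2 meets
  every orbit.\<close>

lemma compact_orbit_space_pattern: "compact_space (orbit_space (pattern_group H))"
proof -
  let ?q = "orbit_E2 (pattern_group H)" and ?K = "cbox 0 (vector [2, 2]) :: (real^2) set"
  have q: "quotient_map euclidean (orbit_space (pattern_group H)) ?q"
    unfolding orbit_space_def by (rule quotient_map_quotient_topology)
  have "?q ` ?K = ?q ` UNIV"
  proof (intro equalityI subsetI)
    fix Q assume "Q \<in> ?q ` UNIV"
    then obtain v where v: "Q = ?q v" by blast
    let ?g = "tri 1 0 (of_int (-2 * \<lfloor>v$1/2\<rfloor>)) 1 (of_int (-2 * \<lfloor>v$2/2\<rfloor>))"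
    have "?g \<in> pattern_group H" by (rule translation_in_pattern) auto
    then have "Q = ?q (?g v)" unfolding v orbit_E2_cong_iff[OF perm_group_pattern] by blast
    moreover have "?g v \<in> ?K"
      by (simp add: mem_box_cart forall_2) linarith
    ultimately show "Q \<in> ?q ` ?K" by blast
  qed auto
  moreover have "compactin (orbit_space (pattern_group H)) (?q ` ?K)"
    by (rule image_compactin[OF _ quotient_imp_continuous_map[OF q]]) (simp add: compact_cbox)
  ultimately show ?thesis
    using quotient_imp_surjective_map[OF q] by (simp add: compact_space_def)
qed

lemma two_space_group_pattern: "two_space_group (pattern_group H)"
  unfolding two_space_group_def subgroup_isometries_E2_iff
  using perm_group_pattern discrete_pattern compact_orbit_space_pattern
  by (auto elim!: pattern_groupE simp: dist_tri)

lemma pattern_seifert: "(pattern_group H, pattern_fiber f) \<in> seifert_fibrations"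
  unfolding seifert_fibrations_iff
  using two_space_group_pattern dihedral_extension_pattern by blast

lemma fiber_direction_pattern: "fiber_direction (pattern_fiber f) = {v. v$2 = 0}"
  unfolding fiber_direction_def
proof (intro equalityI)
  have tr: "(\<lambda>x. x + a) = tri 1 0 (a$1) 1 (a$2)" for a
    by (simp add: fun_eq_iff vec2_eq_iff)
  have "subspace {v :: real^2. v$2 = 0}" by (simp add: subspace_def)
  moreover have "{a. (\<lambda>x. x + a) \<in> pattern_fiber f} \<subseteq> {v. v$2 = 0}"
    unfolding tr by (auto simp: pattern_fiber_def tri_eq_iff)
  ultimately show "span {a. (\<lambda>x. x + a) \<in> pattern_fiber f} \<subseteq> {v. v$2 = 0}"
    using span_minimal by blast
  let ?u = "vector [2, 0] :: real^2"
  have "tri (sg False) 0 (of_int 2) 1 0 \<in> pattern_fiber f"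
  proof -
    have "even (2::int) \<and> (False \<longrightarrow> f)" by simp
    then show ?thesis unfolding pattern_fiber_def by blast
  qed
  then have u: "?u \<in> {a. (\<lambda>x. x + a) \<in> pattern_fiber f}" unfolding tr by simp
  show "{v. v$2 = 0} \<subseteq> span {a. (\<lambda>x. x + a) \<in> pattern_fiber f}"
  proof
    fix v :: "real^2" assume "v \<in> {v. v$2 = 0}"
    then have "v = (v$1 / 2) *\<^sub>R ?u" by (simp add: vec2_eq_iff)
    then show "v \<in> span {a. (\<lambda>x. x + a) \<in> pattern_fiber f}"
      using span_scale[OF span_base[OF u]] by metis
  qed
qed

lemma fibered_plane_pattern:
  "fibered_plane (pattern_group H) (pattern_fiber f) line_sign line_shift (\<lambda>v. v$2)"
proof -
  interpret dihedral_extension "pattern_group H" "pattern_fiber f" line_sign line_shift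
    by (rule dihedral_extension_pattern)
  show ?thesis
  proof
    show "\<exists>l k. linear l \<and> (\<lambda>v::real^2. v$2) = (\<lambda>x. l x + k)"
      by (intro exI[of _ "\<lambda>v. v$2"] exI[of _ 0]) (auto simp: linear_iff)
    show "surj (\<lambda>v::real^2. v$2)"
      unfolding surj_def by (metis vector_2(2))
    show "line_through (fiber_direction (pattern_fiber f)) x = {y. y$2 = x$2}" for x :: "real^2"
    proof (intro equalityI subsetI)
      fix y assume "y \<in> {y :: real^2. y$2 = x$2}"
      then show "y \<in> line_through (fiber_direction (pattern_fiber f)) x"
        unfolding line_through_def fiber_direction_pattern
        by (intro image_eqI[of _ _ "y - x"]) auto
    qed (auto simp: line_through_def fiber_direction_pattern)
    show "(g x)$2 = of_int (line_sign g) * x$2 + of_int (line_shift g)" if "g \<in> pattern_group H" for g and x :: "real^2"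
      using that by (auto elim!: pattern_groupE simp: sg_def)
  qed
qed

end

section \<open>Generic fibers and bases\<close>

lemma homeomorphic_space_if_same_fibers:
  assumes f: "quotient_map X Y f" and g: "quotient_map X Z g"
    and fib: "\<And>x y. x \<in> topspace X \<Longrightarrow> y \<in> topspace X \<Longrightarrow> f x = f y \<longleftrightarrow> g x = g y"
  shows "Y homeomorphic_space Z"
proof -
  obtain h where h: "continuous_map Y Z h" "\<And>x. x \<in> topspace X \<Longrightarrow> h (f x) = g x"
    using quotient_map_lift_exists[OF f quotient_imp_continuous_map[OF g]] fib by metis
  obtain k where k: "continuous_map Z Y k" "\<And>x. x \<in> topspace X \<Longrightarrow> k (g x) = f x"
    using quotient_map_lift_exists[OF g quotient_imp_continuous_map[OF f]] fib by metis
  have "homeomorphic_maps Y Z h k"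
    unfolding homeomorphic_maps_def
    using h k by (auto simp flip: quotient_imp_surjective_map[OF f] quotient_imp_surjective_map[OF g])
  then show ?thesis unfolding homeomorphic_space_def by blast
qed

text \<open>In the applications \<open>X\<close> is a line or the plane, hence not compact.
  Restricted to \<open>K\<close> the map is closed and therefore a quotient map, and this passes to
  the map on all of \<open>X\<close>.\<close>

lemma quotient_map_if_compact_onto:
  assumes f: "continuous_map X Y f" and K: "compactin X K" "f ` K = topspace Y"
    and Y: "Hausdorff_space Y"
  shows "quotient_map X Y f"
proof -
  have sub: "K \<subseteq> topspace X" using K(1) compactin_subset_topspace by blast
  have c: "continuous_map (subtopology X K) Y f"
    using f by (rule continuous_map_from_subtopology)
  moreover have "closed_map (subtopology X K) Y f"
    using continuous_imp_closed_map_gen[of "subtopology X K" Y f] c K(1) Y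
    by (simp add: compact_space_subtopology Hausdorff_imp_kc_space)
  ultimately have "quotient_map (subtopology X K) Y f"
    by (rule continuous_closed_imp_quotient_map) (use K(2) sub in \<open>simp add: Int_absorb1\<close>)
  then have "quotient_map (subtopology X K) Y (f \<circ> id)" by simp
  then show ?thesis
    using quotient_map_from_composition[of "subtopology X K" X id Y f] f by simp
qed

lemma cos_eq_iff: "cos x = cos y \<longleftrightarrow> (\<exists>n::int. x = y + 2 * pi * n \<or> x = - y + 2 * pi * n)"
proof
  assume c: "cos x = cos y"
  have "(sin x)\<^sup>2 = (sin y)\<^sup>2" using c by (simp add: sin_squared_eq)
  then have "sin x = sin y \<or> sin x = sin (- y)" by (simp add: power2_eq_iff)
  then show "\<exists>n::int. x = y + 2 * pi * n \<or> x = - y + 2 * pi * n"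
    using c sin_cos_eq_iff[of x y] sin_cos_eq_iff[of x "- y"] by auto
next
  assume "\<exists>n::int. x = y + 2 * pi * n \<or> x = - y + 2 * pi * n"
  then show "cos x = cos y"
    using sin_cos_eq_iff[of x y] sin_cos_eq_iff[of x "- y"] by auto
qed

text \<open>Winding the coordinate \<open>T\<close> around the unit circle gives a quotient map with
  the same fibers as \<open>q\<close>.\<close>

lemma is_circle_if_translation_fibers:
  assumes q: "quotient_map X Q q" and T: "continuous_map X euclideanreal T"
    and K: "compactin X K" "{0..1} \<subseteq> T ` K"
    and fib: "\<And>x y. x \<in> topspace X \<Longrightarrow> y \<in> topspace X \<Longrightarrow> q x = q y \<longleftrightarrow> (\<exists>n::int. T x = T y + n)"
  shows "is_circle Q"
proof -
  let ?S = "top_of_set (sphere (0::real^2) 1)"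
  let ?g = "\<lambda>x. vector [cos (2 * pi * T x), sin (2 * pi * T x)] :: real^2"
  have on_S: "vector [cos t, sin t] \<in> sphere (0::real^2) 1" for t
    by (simp add: norm_vec2)
  have cv: "continuous_on UNIV (\<lambda>t. vector [cos t, sin t] :: real^2)"
  proof -
    have vec: "(vector [x, y] :: real^2) = (\<chi> i. if i = 1 then x else y)" for x y :: real
      by (simp add: vec2_eq_iff)
    have "continuous_on UNIV (\<lambda>t::real. if i = 1 then cos t else sin t)" for i :: 2
      by (cases "i = 1") (auto intro!: continuous_intros)
    then show ?thesis unfolding vec by (rule continuous_on_vec_lambda)
  qed
  have "continuous_map euclideanreal euclidean (\<lambda>t. vector [cos (2 * pi * t), sin (2 * pi * t)] :: real^2)"
    by (simp, rule continuous_on_compose2[OF cv]) (auto intro!: continuous_intros)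
  then have "continuous_map X euclidean ((\<lambda>t. vector [cos (2 * pi * t), sin (2 * pi * t)] :: real^2) \<circ> T)"
    by (rule continuous_map_compose[OF T])
  then have c: "continuous_map X ?S ?g"
    by (simp add: continuous_map_in_subtopology comp_def image_subset_iff norm_vec2)
  have "quotient_map X ?S ?g"
  proof (rule quotient_map_if_compact_onto[OF c K(1)])
    show "?g ` K = topspace ?S"
    proof (intro equalityI subsetI)
      fix v assume "v \<in> topspace ?S"
      then have "(v$1)\<^sup>2 + (v$2)\<^sup>2 = 1" by (simp add: norm_vec2)
      then obtain t where t: "0 \<le> t" "t < 2 * pi" "v$1 = cos t" "v$2 = sin t"
        using sincos_total_2pi by metis
      then have "t / (2 * pi) \<in> {0..1}" by (simp add: field_simps)
      then obtain x where "x \<in> K" "T x = t / (2 * pi)" using K(2) by fastforce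
      then show "v \<in> ?g ` K" using t by (intro image_eqI[of _ _ x]) (auto simp: vec2_eq_iff)
    qed (use on_S in auto)
    show "Hausdorff_space ?S" by (simp add: Hausdorff_space_subtopology)
  qed
  moreover have "q x = q y \<longleftrightarrow> ?g x = ?g y" if "x \<in> topspace X" "y \<in> topspace X" for x y
  proof -
    have "?g x = ?g y \<longleftrightarrow> (\<exists>n::int. 2 * pi * T x = 2 * pi * T y + 2 * pi * n)"
      using sin_cos_eq_iff[of "2 * pi * T x" "2 * pi * T y"] by (auto simp: vec2_eq_iff)
    also have "\<dots> \<longleftrightarrow> (\<exists>n::int. T x = T y + n)"
      by (simp flip: distrib_left)
    finally show ?thesis using fib[OF that] by simp
  qed
  ultimately show ?thesis
    unfolding is_circle_def using homeomorphic_space_if_same_fibers[OF q] by blast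
qed

text \<open>The cosine identifies exactly the points that differ by a full period or a change of
  sign; shifting and halving it gives values in the unit interval.\<close>

lemma is_closed_interval_if_dihedral_fibers:
  assumes q: "quotient_map X Q q" and T: "continuous_map X euclideanreal T"
    and K: "compactin X K" "{0..1} \<subseteq> T ` K"
    and fib: "\<And>x y. x \<in> topspace X \<Longrightarrow> y \<in> topspace X \<Longrightarrow>
      q x = q y \<longleftrightarrow> (\<exists>n::int. T x = T y + n \<or> T x = - T y + n)"
  shows "is_closed_interval Q"
proof -
  let ?S = "top_of_set {0..1::real}"
  let ?g = "\<lambda>x. (1 + cos (2 * pi * T x)) / 2"
  have on_S: "(1 + cos t) / 2 \<in> {0..1}" for t :: real
  proof -
    have "0 \<le> 1 + cos t" using cos_ge_minus_one[of t] by linarith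
    then show ?thesis using cos_le_one[of t] by simp
  qed
  have "continuous_map euclideanreal euclideanreal (\<lambda>t. (1 + cos (2 * pi * t)) / 2)"
    by (simp) (intro continuous_intros; simp)
  then have "continuous_map X euclideanreal ((\<lambda>t. (1 + cos (2 * pi * t)) / 2) \<circ> T)"
    by (rule continuous_map_compose[OF T])
  then have c: "continuous_map X ?S ?g"
    using on_S by (simp add: continuous_map_in_subtopology comp_def image_subset_iff)
  have "quotient_map X ?S ?g"
  proof (rule quotient_map_if_compact_onto[OF c K(1)])
    show "?g ` K = topspace ?S"
    proof (intro equalityI subsetI)
      fix v assume "v \<in> topspace ?S"
      then have v: "- 1 \<le> 2 * v - 1" "2 * v - 1 \<le> 1" by auto
      then obtain t where t: "0 \<le> t" "t \<le> pi" "cos t = 2 * v - 1"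
        using cos_total by metis
      then have "t / (2 * pi) \<in> {0..1}" using pi_gt_zero by (simp add: field_simps)
      then obtain x where "x \<in> K" "T x = t / (2 * pi)" using K(2) by fastforce
      then show "v \<in> ?g ` K" using t by (intro image_eqI[of _ _ x]) auto
    qed (use on_S in auto)
    show "Hausdorff_space ?S" by (simp add: Hausdorff_space_subtopology)
  qed
  moreover have "q x = q y \<longleftrightarrow> ?g x = ?g y" if "x \<in> topspace X" "y \<in> topspace X" for x y
  proof -
    have "?g x = ?g y \<longleftrightarrow> (\<exists>n::int. 2 * pi * T x = 2 * pi * T y + 2 * pi * n \<or>
        2 * pi * T x = - (2 * pi * T y) + 2 * pi * n)"
      using cos_eq_iff[of "2 * pi * T x" "2 * pi * T y"] by simp
    also have "\<dots> \<longleftrightarrow> (\<exists>n::int. T x = T y + n \<or> T x = - T y + n)"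
    proof -
      have "2 * pi * T x = - (2 * pi * T y) + 2 * pi * n \<longleftrightarrow> T x = - T y + n"
        "2 * pi * T x = 2 * pi * T y + 2 * pi * n \<longleftrightarrow> T x = T y + n" for n :: int
      proof -
        have "- (2 * pi * T y) + 2 * pi * n = 2 * pi * (- T y + n)"
          "2 * pi * T y + 2 * pi * n = 2 * pi * (T y + n)" by (simp_all add: algebra_simps)
        then show "2 * pi * T x = - (2 * pi * T y) + 2 * pi * n \<longleftrightarrow> T x = - T y + n"
          "2 * pi * T x = 2 * pi * T y + 2 * pi * n \<longleftrightarrow> T x = T y + n"
          by (simp_all only: mult_cancel_left) auto
      qed
      then show ?thesis by simp
    qed
    finally show ?thesis using fib[OF that] by simp
  qed
  ultimately show ?thesis
    unfolding is_closed_interval_def using homeomorphic_space_if_same_fibers[OF q] by blast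
qed

lemma homeomorphic_if_homeomorphic_space:
  assumes "top_of_set S homeomorphic_space top_of_set T" shows "S homeomorphic T"
proof -
  obtain f g where fg: "homeomorphic_maps (top_of_set S) (top_of_set T) f g"
    using assms unfolding homeomorphic_space_def by blast
  then have c: "continuous_on S f" "continuous_on T g" "f ` S \<subseteq> T" "g ` T \<subseteq> S"
    and i: "\<forall>x\<in>S. g (f x) = x" "\<forall>y\<in>T. f (g y) = y"
    by (auto simp: homeomorphic_maps_def continuous_map_in_subtopology)
  have "f ` S = T" "g ` T = S" using c i by (metis image_subset_iff subset_antisym image_eqI subsetI)+
  then show ?thesis unfolding homeomorphic_def homeomorphism_def using c i by blast
qed

text \<open>Contractibility separates the two, so a fibration has only one type.\<close>

lemma circle_not_closed_interval:
  assumes "is_circle X" shows "\<not> is_closed_interval X"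
proof
  assume "is_closed_interval X"
  then have "top_of_set (sphere (0::real^2) 1) homeomorphic_space top_of_set {0..1::real}"
    using assms unfolding is_circle_def is_closed_interval_def
    by (metis homeomorphic_space_sym homeomorphic_space_trans)
  then have "sphere (0::real^2) 1 homeomorphic {0..1::real}"
    by (rule homeomorphic_if_homeomorphic_space)
  then have "contractible (sphere (0::real^2) 1) \<longleftrightarrow> contractible {0..1::real}"
    by (rule homeomorphic_contractible_eq)
  then show False by (simp add: contractible_sphere convex_imp_contractible)
qed

section \<open>Topology of the bases and of the generic fibers\<close>

context fibered_plane
begin

lemma continuous_Y: "continuous_on A Y"
proof -
  obtain l k where l: "linear l" "Y = (\<lambda>x. l x + k)" using Y_affine by blast
  then show ?thesis
    using linear_continuous_on[of l] by (auto intro!: continuous_intros simp: linear_linear)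
qed

lemma quotient_map_base_space:
  "quotient_map euclidean (base_space (G, N)) (\<lambda>x. base_orbit (G, N) (line_through V x))"
  unfolding base_space_def
  using quotient_map_compose[OF quotient_map_quotient_topology quotient_map_quotient_topology]
  by (auto simp: comp_def)

lemma compact_onto_unit_interval: "\<exists>K. compactin euclidean K \<and> {0..1} \<subseteq> Y ` K"
proof -
  obtain p q where pq: "Y p = 0" "Y q = 1" using Y_surj by (metis surj_def)
  have "t \<in> Y ` closed_segment p q" if "t \<in> {0..1}" for t
  proof (rule image_eqI)
    show "t = Y (p + t *\<^sub>R (q - p))" using Y_combine pq by simp
    show "p + t *\<^sub>R (q - p) \<in> closed_segment p q"
      using that unfolding closed_segment_def by (auto simp: algebra_simps intro!: exI[of _ t])
  qed
  then show ?thesis by (intro exI[of _ "closed_segment p q"]) auto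
qed

lemma base_space_circle:
  assumes "\<forall>g\<in>G. s g = 1"
  shows "is_circle (base_space (G, N))"
proof -
  obtain K where K: "compactin euclidean K" "{0..1} \<subseteq> Y ` K" using compact_onto_unit_interval by blast
  have fib: "(\<exists>g\<in>G. Y (g x) = Y y) \<longleftrightarrow> (\<exists>n::int. Y x = Y y + n)" for x y
  proof
    assume "\<exists>g\<in>G. Y (g x) = Y y"
    then obtain g where "g \<in> G" "Y (g x) = Y y" by blast
    then show "\<exists>n::int. Y x = Y y + n" using Y_act assms by (intro exI[of _ "- c g"]) auto
  next
    assume "\<exists>n::int. Y x = Y y + n"
    then obtain n :: int where "Y x = Y y + n" by blast
    moreover obtain g where "g \<in> G" "s g = 1" "c g = - n" using onto by blast
    ultimately show "\<exists>g\<in>G. Y (g x) = Y y" using Y_act by (intro bexI[of _ g]) auto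
  qed
  show ?thesis
    by (rule is_circle_if_translation_fibers[OF quotient_map_base_space _ K])
      (simp_all add: continuous_Y base_orbit_eq_iff fib)
qed

lemma base_space_interval:
  assumes "\<not> (\<forall>g\<in>G. s g = 1)"
  shows "is_closed_interval (base_space (G, N))"
proof -
  obtain K where K: "compactin euclidean K" "{0..1} \<subseteq> Y ` K" using compact_onto_unit_interval by blast
  have fib: "(\<exists>g\<in>G. Y (g x) = Y y) \<longleftrightarrow> (\<exists>n::int. Y x = Y y + n \<or> Y x = - Y y + n)" for x y
  proof
    assume "\<exists>g\<in>G. Y (g x) = Y y"
    then obtain g where "g \<in> G" "Y (g x) = Y y" by blast
    then show "\<exists>n::int. Y x = Y y + n \<or> Y x = - Y y + n"
      using Y_act s[of g] by (intro exI[of _ "- s g * c g"]) auto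
  next
    assume "\<exists>n::int. Y x = Y y + n \<or> Y x = - Y y + n"
    then obtain n :: int where "Y x = Y y + n \<or> Y x = - Y y + n" by blast
    moreover obtain g where "g \<in> G" "s g = 1" "c g = - n" using onto by blast
    moreover obtain h where "h \<in> G" "s h = -1" "c h = n"
      using assms s onto_reflection by metis
    ultimately show "\<exists>g\<in>G. Y (g x) = Y y" using Y_act[of g x] Y_act[of h x] by auto
  qed
  show ?thesis
    by (rule is_closed_interval_if_dihedral_fibers[OF quotient_map_base_space _ K])
      (simp_all add: continuous_Y base_orbit_eq_iff fib)
qed

end

lemma affinity_continuous:
  assumes "affinity \<phi>" shows "continuous_on A \<phi>"
proof -
  obtain B k where B: "linear B" "\<phi> = (\<lambda>x. B x + k)" using assms by (auto simp: affinity_def)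
  then show ?thesis
    using linear_continuous_on[of B] by (auto intro!: continuous_intros simp: linear_linear)
qed

context pattern
begin

context
  fixes \<phi> :: "real^2 \<Rightarrow> real^2"
  assumes aff: "affinity \<phi>"
begin

interpretation C: fibered_plane "conjugate \<phi> (pattern_group H)" "conjugate \<phi> (pattern_fiber f)"
  "\<lambda>g. line_sign (fun_inv \<phi> \<circ> g \<circ> \<phi>)" "\<lambda>g. line_shift (fun_inv \<phi> \<circ> g \<circ> \<phi>)" "(\<lambda>v. v$2) \<circ> fun_inv \<phi>"
  by (rule fibered_plane_conjugate[OF aff fibered_plane_pattern])

text \<open>A general fibration is known only as an affine conjugate of a model, so its base, and
  below its generic fiber, is determined for such conjugates.\<close>

lemma base_space_conjugate:
  shows "\<not> b \<Longrightarrow> is_circle (base_space (conjugate \<phi> (pattern_group H), conjugate \<phi> (pattern_fiber f)))"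
    and "b \<Longrightarrow> is_closed_interval (base_space (conjugate \<phi> (pattern_group H), conjugate \<phi> (pattern_fiber f)))"
proof -
  interpret D: dihedral_extension "pattern_group H" "pattern_fiber f" line_sign line_shift
    by (rule dihedral_extension_pattern)
  have unconj: "fun_inv \<phi> \<circ> (\<phi> \<circ> h \<circ> fun_inv \<phi>) \<circ> \<phi> = h" for h
    by (simp add: fun_eq_iff bij_inv_simps[OF affinity_bij[OF aff]])
  have iff: "(\<forall>g\<in>conjugate \<phi> (pattern_group H). line_sign (fun_inv \<phi> \<circ> g \<circ> \<phi>) = 1) \<longleftrightarrow>
      (\<forall>g\<in>pattern_group H. line_sign g = 1)"
    unfolding conjugate_def ball_simps unconj ..
  have "(\<forall>g\<in>pattern_group H. line_sign g = 1) \<longleftrightarrow> \<not> b"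
  proof
    assume *: "\<forall>g\<in>pattern_group H. line_sign g = 1"
    show "\<not> b"
    proof
      assume b
      then obtain e a where "H e a True False" using H_reflection by blast
      then have "H e (odd (if a then 1 else 0 :: int)) True (odd (0::int))" by (cases a) simp_all
      from pattern_groupI[OF this] * show False by fastforce
    qed
  next
    assume "\<not> b"
    then show "\<forall>g\<in>pattern_group H. line_sign g = 1" using H_base by (auto elim!: pattern_groupE)
  qed
  then show "\<not> b \<Longrightarrow> is_circle (base_space (conjugate \<phi> (pattern_group H), conjugate \<phi> (pattern_fiber f)))"
    "b \<Longrightarrow> is_closed_interval (base_space (conjugate \<phi> (pattern_group H), conjugate \<phi> (pattern_fiber f)))"
    using C.base_space_circle C.base_space_interval iff by blast+
qed

lemma generic_fiber_conjugate:
  shows "\<not> f \<Longrightarrow> is_circle (generic_fiber (conjugate \<phi> (pattern_group H), conjugate \<phi> (pattern_fiber f)))"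
    and "f \<Longrightarrow> is_closed_interval (generic_fiber (conjugate \<phi> (pattern_group H), conjugate \<phi> (pattern_fiber f)))"
proof -
  let ?N = "conjugate \<phi> (pattern_fiber f)" and ?i = "fun_inv \<phi>"
  let ?V = "fiber_direction ?N"
  \<comment> \<open>In model coordinates the translations of the fiber group are the even integers;
    halving makes its period 1.\<close>
  let ?T = "\<lambda>x. ?i x $ 1 / 2"
  have bij: "bij \<phi>" using affinity_bij[OF aff] .
  have V: "?V = {y. ?i y $ 2 = ?i 0 $ 2}"
    using C.Y_line[of 0] by (simp add: line_through_def)
  have q: "quotient_map (top_of_set ?V) (generic_fiber (conjugate \<phi> (pattern_group H), ?N)) (orbit_E2 ?N)"
    unfolding generic_fiber_def by (simp add: quotient_map_quotient_topology)
  have T: "continuous_map (top_of_set ?V) euclideanreal ?T"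
    using affinity_continuous[OF affinity_inv[OF aff]] by (auto intro!: continuous_intros)
  \<comment> \<open>A segment covering one period. \<open>?V\<close> passes through 0, whose height
    in model coordinates is \<open>?i 0 $ 2\<close> and need not vanish.\<close>
  let ?S = "closed_segment (vector [0, ?i 0 $ 2]) (vector [2, ?i 0 $ 2]) :: (real^2) set"
  let ?K = "\<phi> ` ?S"
  have S2: "v $ 2 = ?i 0 $ 2" if "v \<in> ?S" for v
    using that unfolding closed_segment_def by (auto simp: left_diff_distrib)
  have "?K \<subseteq> ?V"
  proof
    fix y assume "y \<in> ?K"
    then obtain v where v: "v \<in> ?S" "y = \<phi> v" by (rule imageE)
    then show "y \<in> ?V" unfolding V using S2[OF v(1)] by (simp add: bij_inv_simps(2)[OF bij])
  qed
  moreover have "compact ?K"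
    using compact_continuous_image[OF affinity_continuous[OF aff] compact_segment] .
  ultimately have K: "compactin (top_of_set ?V) ?K"
    by (simp only: compactin_subtopology compactin_euclidean_iff)
  have KT: "{0..1} \<subseteq> ?T ` ?K"
  proof
    fix t :: real assume t: "t \<in> {0..1}"
    let ?v = "vector [2 * t, ?i 0 $ 2] :: real^2"
    have "?v \<in> ?S" using t unfolding closed_segment_def
      by (auto simp: vec2_eq_iff algebra_simps intro!: exI[of _ t])
    moreover have "t = ?T (\<phi> ?v)" by (simp add: bij_inv_simps[OF bij])
    ultimately show "t \<in> ?T ` ?K" by blast
  qed
  have fib: "orbit_E2 ?N x = orbit_E2 ?N y \<longleftrightarrow>
      (\<exists>e A. even (A::int) \<and> (e \<longrightarrow> f) \<and> sg e * ?i x $ 1 + A = ?i y $ 1)"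
    if "x \<in> ?V" "y \<in> ?V" for x y
  proof -
    have "orbit_E2 ?N x = orbit_E2 ?N y \<longleftrightarrow> (\<exists>g\<in>?N. g x = y)"
      using orbit_E2_cong_iff[OF C.N_perm_group] .
    also have "\<dots> \<longleftrightarrow> (\<exists>g\<in>pattern_fiber f. \<phi> (g (?i x)) = y)"
      by (simp add: conjugate_def)
    also have "\<dots> \<longleftrightarrow> (\<exists>g\<in>pattern_fiber f. g (?i x) = ?i y)"
      using bij_inv_simps[OF bij] by metis
    also have "\<dots> \<longleftrightarrow> (\<exists>e A. even (A::int) \<and> (e \<longrightarrow> f) \<and> tri (sg e) 0 (of_int A) 1 0 (?i x) = ?i y)"
      unfolding pattern_fiber_def by auto
    finally show ?thesis using that by (simp add: vec2_eq_iff V)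
  qed
  show "is_circle (generic_fiber (conjugate \<phi> (pattern_group H), ?N))" if "\<not> f"
  proof (rule is_circle_if_translation_fibers[OF q T K KT])
    fix x y assume "x \<in> topspace (top_of_set ?V)" "y \<in> topspace (top_of_set ?V)"
    then have "orbit_E2 ?N x = orbit_E2 ?N y \<longleftrightarrow> (\<exists>A. even (A::int) \<and> ?i x $ 1 + A = ?i y $ 1)"
      using fib[of x y] that by (simp add: ex_bool_eq)
    also have "\<dots> \<longleftrightarrow> (\<exists>n::int. ?T x = ?T y + n)"
    proof
      assume "\<exists>A. even (A::int) \<and> ?i x $ 1 + A = ?i y $ 1"
      then obtain A :: int where "?i x $ 1 + (2 * A) = ?i y $ 1" by (auto elim!: evenE)
      then show "\<exists>n::int. ?T x = ?T y + n" by (intro exI[of _ "- A"]) (auto simp: field_simps)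
    next
      assume "\<exists>n::int. ?T x = ?T y + n"
      then obtain n :: int where "?T x = ?T y + n" by blast
      then show "\<exists>A. even (A::int) \<and> ?i x $ 1 + A = ?i y $ 1"
        by (intro exI[of _ "- 2 * n"]) (auto simp: field_simps)
    qed
    finally show "orbit_E2 ?N x = orbit_E2 ?N y \<longleftrightarrow> (\<exists>n::int. ?T x = ?T y + n)" .
  qed
  show "is_closed_interval (generic_fiber (conjugate \<phi> (pattern_group H), ?N))" if f
  proof (rule is_closed_interval_if_dihedral_fibers[OF q T K KT])
    fix x y assume "x \<in> topspace (top_of_set ?V)" "y \<in> topspace (top_of_set ?V)"
    then have "orbit_E2 ?N x = orbit_E2 ?N y \<longleftrightarrow> (\<exists>e A. even (A::int) \<and> sg e * ?i x $ 1 + A = ?i y $ 1)"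
      using fib[of x y] that by (simp add: ex_bool_eq)
    also have "\<dots> \<longleftrightarrow> (\<exists>n::int. ?T x = ?T y + n \<or> ?T x = - ?T y + n)"
    proof
      assume "\<exists>e A. even (A::int) \<and> sg e * ?i x $ 1 + A = ?i y $ 1"
      then obtain e and A :: int where "sg e * ?i x $ 1 + (2 * A) = ?i y $ 1" by (auto elim!: evenE)
      then show "\<exists>n::int. ?T x = ?T y + n \<or> ?T x = - ?T y + n"
        by (intro exI[of _ "if e then A else - A"]) (auto simp: field_simps sg_def)
    next
      assume "\<exists>n::int. ?T x = ?T y + n \<or> ?T x = - ?T y + n"
      then obtain n :: int where n: "?T x = ?T y + n \<or> ?T x = - ?T y + n" by blast
      show "\<exists>e A. even (A::int) \<and> sg e * ?i x $ 1 + A = ?i y $ 1"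
      proof (cases "?T x = ?T y + n")
        case True
        then show ?thesis by (intro exI[of _ False] exI[of _ "- 2 * n"]) (auto simp: field_simps)
      next
        case False
        then have "?T x = - ?T y + n" using n by blast
        then show ?thesis by (intro exI[of _ True] exI[of _ "2 * n"]) (auto simp: field_simps)
      qed
    qed
    finally show "orbit_E2 ?N x = orbit_E2 ?N y \<longleftrightarrow> (\<exists>n::int. ?T x = ?T y + n \<or> ?T x = - ?T y + n)" .
  qed
qed

end

end

section \<open>Translations in plane groups\<close>

text \<open>The trace of cocompactness that the search for translations relies on. It makes sense
  for a mere set of maps, so it passes easily to the orientation preserving elements and then to the
  translations.\<close>

definition coarsely_transitive :: "(real^2 \<Rightarrow> real^2) set \<Rightarrow> bool" where
  "coarsely_transitive S \<longleftrightarrow> (\<exists>R. \<forall>x. \<exists>g\<in>S. norm (g x) < R)"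

lemma isometry_continuous:
  fixes g :: "real^2 \<Rightarrow> real^2"
  assumes "\<And>x y. dist (g x) (g y) = dist x y"
  shows "continuous_on A g"
  unfolding continuous_on_iff using assms by auto

text \<open>The images of the open balls around 0 form an open cover of the orbit space; the largest
  ball of a finite subcover gives the radius.\<close>

lemma coarsely_transitive_if_compact:
  assumes "two_space_group G" shows "coarsely_transitive G"
proof -
  have G: "perm_group G" and iso: "\<And>g x y. g \<in> G \<Longrightarrow> dist (g x) (g y) = dist x y"
    and cpt: "compact_space (orbit_space G)"
    using assms by (auto simp: two_space_group_def subgroup_isometries_E2_iff)
  let ?q = "orbit_E2 G"
  have q: "quotient_map euclidean (orbit_space G) ?q"
    unfolding orbit_space_def by (rule quotient_map_quotient_topology)
  have top: "topspace (orbit_space G) = range ?q"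
    using quotient_imp_surjective_map[OF q] by simp
  let ?U = "\<lambda>n::nat. ?q ` ball 0 (real n)"
  have U: "openin (orbit_space G) (?U n)" for n
  proof -
    have "{x. ?q x \<in> ?U n} = (\<Union>g\<in>G. g -` ball 0 (real n))"
    proof (intro equalityI subsetI)
      fix x assume "x \<in> {x. ?q x \<in> ?U n}"
      then obtain y where "?q x = ?q y" "y \<in> ball 0 (real n)" by blast
      then show "x \<in> (\<Union>g\<in>G. g -` ball 0 (real n))"
        unfolding orbit_E2_cong_iff[OF G] by auto
    next
      fix x assume "x \<in> (\<Union>g\<in>G. g -` ball 0 (real n))"
      then obtain g where "g \<in> G" "g x \<in> ball 0 (real n)" by blast
      then show "x \<in> {x. ?q x \<in> ?U n}"
        using orbit_E2_cong_iff[OF G, of x "g x"] by blast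
    qed
    moreover have "open (g -` ball 0 (real n))" if "g \<in> G" for g
      by (intro open_vimage open_ball isometry_continuous iso[OF that])
    ultimately have "open {x. ?q x \<in> ?U n}" by auto
    then show ?thesis
      unfolding orbit_space_def openin_quotient_topology by auto
  qed
  have cover: "topspace (orbit_space G) \<subseteq> \<Union> (range ?U)"
  proof
    fix Q assume "Q \<in> topspace (orbit_space G)"
    then obtain x where "Q = ?q x" unfolding top by blast
    moreover obtain n :: nat where "norm x < real n" using reals_Archimedean2 by blast
    ultimately have "Q \<in> ?U n" by auto
    then show "Q \<in> \<Union> (range ?U)" by blast
  qed
  obtain F where F: "finite F" "F \<subseteq> range ?U" "topspace (orbit_space G) \<subseteq> \<Union> F"
    using cpt cover U unfolding compact_space_alt by (metis (no_types, lifting) imageE)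
  obtain I where I: "finite I" "F = ?U ` I" using finite_subset_image[OF F(1,2)] by blast
  have "\<exists>g\<in>G. norm (g x) < real (Max (insert 0 I))" for x
  proof -
    have "?q x \<in> \<Union> (?U ` I)" using F(3) I(2) top by blast
    then obtain n y where ny: "n \<in> I" "?q x = ?q y" "norm y < real n" by auto
    then obtain g where g: "g \<in> G" "g x = y" using orbit_E2_cong_iff[OF G] by blast
    have "n \<le> Max (insert 0 I)" using ny(1) I(1) by simp
    then show ?thesis using g ny(3) by (intro bexI[of _ g]) auto
  qed
  then show ?thesis unfolding coarsely_transitive_def by blast
qed

text \<open>Following an element by the fixed isometry \<open>h\<close> enlarges the radius by at
  most \<open>norm (h 0)\<close>. It is applied with \<open>T\<close> a subgroup of index two and
  \<open>h\<close> an element of the other coset.\<close>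

lemma coarsely_transitive_index_two:
  assumes S: "coarsely_transitive S" and h: "\<And>x y. dist (h x) (h y) = dist x y"
    and sub: "\<And>g. g \<in> S \<Longrightarrow> g \<notin> T \<Longrightarrow> h \<circ> g \<in> T"
  shows "coarsely_transitive T"
proof -
  obtain R where R: "\<And>x. \<exists>g\<in>S. norm (g x) < R" using S by (auto simp: coarsely_transitive_def)
  have "\<exists>g\<in>T. norm (g x) < R + norm (h 0)" for x
  proof -
    obtain g where g: "g \<in> S" "norm (g x) < R" using R by blast
    show ?thesis
    proof (cases "g \<in> T")
      case True
      then show ?thesis using g norm_ge_zero[of "h 0"] by (intro bexI[of _ g]) linarith+
    next
      case False
      have "norm (h (g x)) \<le> norm (h (g x) - h 0) + norm (h 0)"
        using norm_triangle_ineq[of "h (g x) - h 0" "h 0"] by simp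
      also have "norm (h (g x) - h 0) = norm (g x)" using h[of "g x" 0] by (simp add: dist_norm)
      finally show ?thesis using g sub[OF g(1) False] by (intro bexI[of _ "h \<circ> g"]) auto
    qed
  qed
  then show ?thesis unfolding coarsely_transitive_def by blast
qed

text \<open>For the values used, \<sigma> is the determinant of the linear part, and
  \<open>a\<close>, \<open>b\<close> form its first column.\<close>

definition rigid :: "real \<Rightarrow> real \<Rightarrow> real \<Rightarrow> real \<Rightarrow> real \<Rightarrow> real^2 \<Rightarrow> real^2" where
  "rigid \<sigma> a b k l = (\<lambda>v. vector [a * v$1 - \<sigma> * b * v$2 + k, b * v$1 + \<sigma> * a * v$2 + l])"

lemma rigid_nth [simp]:
  "rigid \<sigma> a b k l v $ 1 = a * v$1 - \<sigma> * b * v$2 + k"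
  "rigid \<sigma> a b k l v $ 2 = b * v$1 + \<sigma> * a * v$2 + l"
  by (simp_all add: rigid_def)

lemma inner_vec2: "(u::real^2) \<bullet> v = u$1 * v$1 + u$2 * v$2"
  by (simp add: inner_vec_def sum_2)

text \<open>A unit vector orthogonal to the first column of the linear part is, up to sign, that
  column turned by a right angle; the sign is the determinant.\<close>

lemma isometry_rigid:
  fixes g :: "real^2 \<Rightarrow> real^2"
  assumes "\<And>x y. dist (g x) (g y) = dist x y"
  obtains \<sigma> a b k l where "\<sigma> = 1 \<or> \<sigma> = -1" "a\<^sup>2 + b\<^sup>2 = 1" "g = rigid \<sigma> a b k l"
proof -
  define A where "A x = g x - g 0" for x
  have "orthogonal_transformation A"
    unfolding orthogonal_transformation_isometry using assms by (simp add: A_def dist_norm)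
  then have lin: "linear A" and ip: "\<And>u v. A u \<bullet> A v = u \<bullet> v"
    by (auto simp: orthogonal_transformation_def)
  define a b p q where "a = A (vector [1,0]) $ 1" and "b = A (vector [1,0]) $ 2"
    and "p = A (vector [0,1]) $ 1" and "q = A (vector [0,1]) $ 2"
  have ab: "a\<^sup>2 + b\<^sup>2 = 1" and pq: "p\<^sup>2 + q\<^sup>2 = 1" and o: "a * p + b * q = 0"
    using ip[of "vector [1,0]" "vector [1,0]"] ip[of "vector [0,1]" "vector [0,1]"]
      ip[of "vector [1,0]" "vector [0,1]"]
    by (simp_all add: inner_vec2 a_def b_def p_def q_def power2_eq_square)
  define \<sigma> where "\<sigma> = a * q - b * p"
  have "p = (a\<^sup>2 + b\<^sup>2) * p - a * (a * p + b * q)" using ab o by simp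
  then have p: "p = - \<sigma> * b" by (simp add: \<sigma>_def algebra_simps power2_eq_square)
  have "q = (a\<^sup>2 + b\<^sup>2) * q - b * (a * p + b * q)" using ab o by simp
  then have q: "q = \<sigma> * a" by (simp add: \<sigma>_def algebra_simps power2_eq_square)
  have "\<sigma>\<^sup>2 * (a\<^sup>2 + b\<^sup>2) = 1"
    using pq unfolding p q by (simp add: algebra_simps power2_eq_square)
  then have \<sigma>: "\<sigma> = 1 \<or> \<sigma> = -1" using ab by (simp add: power2_eq_1_iff)
  have "g = rigid \<sigma> a b (g 0 $ 1) (g 0 $ 2)"
  proof
    fix v :: "real^2"
    have "v = v$1 *\<^sub>R vector [1,0] + v$2 *\<^sub>R vector [0,1]" by (simp add: vec2_eq_iff)
    from arg_cong[OF this, of A]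
    have "A v = v$1 *\<^sub>R A (vector [1,0]) + v$2 *\<^sub>R A (vector [0,1])"
      by (simp only: linear_add[OF lin] linear_scale[OF lin])
    then have "A v $ 1 = v$1 * a + v$2 * p" "A v $ 2 = v$1 * b + v$2 * q"
      by (simp_all add: a_def b_def p_def q_def)
    then have "g v $ 1 = v$1 * a + v$2 * p + g 0 $ 1" "g v $ 2 = v$1 * b + v$2 * q + g 0 $ 2"
      by (simp_all add: A_def)
    then show "g v = rigid \<sigma> a b (g 0 $ 1) (g 0 $ 2) v"
      by (simp add: vec2_eq_iff p q algebra_simps)
  qed
  then show thesis using that \<sigma> ab by blast
qed

lemma rigid_comp:
  assumes "\<sigma> = 1 \<or> \<sigma> = -1"
  shows "rigid \<sigma> a b k l \<circ> rigid \<sigma>' a' b' k' l' =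
    rigid (\<sigma> * \<sigma>') (a * a' - \<sigma> * b * b') (b * a' + \<sigma> * a * b')
      (a * k' - \<sigma> * b * l' + k) (b * k' + \<sigma> * a * l' + l)"
  using assms by (auto simp: fun_eq_iff vec2_eq_iff algebra_simps)

abbreviation translation :: "real^2 \<Rightarrow> real^2 \<Rightarrow> real^2" where
  "translation u \<equiv> (\<lambda>x. x + u)"

definition det2 :: "real^2 \<Rightarrow> real^2 \<Rightarrow> real" where
  "det2 u v = u$1 * v$2 - u$2 * v$1"

text \<open>The displacement of \<open>g\<^sub>0\<close> is invariant under its centralizer, hence bounded if the centralizer is coarsely transitive.\<close>

lemma rotation_centralizer_not_coarsely_transitive:
  assumes S: "coarsely_transitive S" and b: "b \<noteq> 0" and ab: "a\<^sup>2 + b\<^sup>2 = 1"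
    and iso: "\<And>g x y. g \<in> S \<Longrightarrow> dist (g x) (g y) = dist x y"
    and comm: "\<And>g x. g \<in> S \<Longrightarrow> rigid 1 a b k l (g x) = g (rigid 1 a b k l x)"
  shows False
proof -
  let ?h = "rigid 1 a b k l"
  obtain R where R: "\<And>x. \<exists>g\<in>S. norm (g x) < R" using S by (auto simp: coarsely_transitive_def)
  have hd: "dist (?h x) (?h y) = dist x y" for x y
  proof -
    have "(a * p - b * q)\<^sup>2 + (b * p + a * q)\<^sup>2 = (a\<^sup>2 + b\<^sup>2) * (p\<^sup>2 + q\<^sup>2)" for p q :: real
      by (simp add: algebra_simps power2_eq_square)
    from this[of "x$1 - y$1" "x$2 - y$2"] show ?thesis
      unfolding dist_norm norm_vec2 using ab by (simp add: algebra_simps)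
  qed
  have bound: "norm (?h x - x) \<le> 2 * R + norm (?h 0)" for x
  proof -
    obtain g where g: "g \<in> S" "norm (g x) < R" using R by blast
    have "norm (?h x - x) = norm (?h (g x) - g x)"
      using iso[OF g(1), of "?h x" x] comm[OF g(1), of x] by (simp add: dist_norm)
    also have "\<dots> \<le> norm (?h (g x) - ?h 0) + norm (?h 0) + norm (g x)"
      using norm_triangle_ineq4[of "?h (g x)" "g x"] norm_triangle_ineq[of "?h (g x) - ?h 0" "?h 0"] by simp
    also have "norm (?h (g x) - ?h 0) = norm (g x)" using hd[of "g x" 0] by (simp add: dist_norm)
    finally show ?thesis using g(2) by simp
  qed
  let ?B = "2 * R + norm (?h 0)"
  \<comment> \<open>On the first axis the second component of the displacement is \<open>b\<close>
    times the position plus \<open>l\<close>; the position is chosen to make it exceed the bound by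
    1.\<close>
  let ?x = "vector [(?B + 1 - l) / b, 0] :: real^2"
  have "(?h ?x - ?x) $ 2 = ?B + 1" using b by simp
  moreover have "\<bar>(?h ?x - ?x) $ 2\<bar> \<le> ?B" using component_le_norm_cart bound order_trans by blast
  ultimately show False by linarith
qed

text \<open>A translation that brings a point at distance \<open>R\<close> into the open ball of
  radius \<open>R\<close> cannot be zero. If that point lies perpendicular to the first translation
  found, the second one has a nonzero component in the perpendicular direction.\<close>

lemma translations_if_coarsely_transitive:
  assumes "coarsely_transitive (translation ` T)"
  obtains u v where "u \<in> T" "v \<in> T" "det2 u v \<noteq> 0"
proof -
  obtain R where R: "\<And>x. \<exists>u\<in>T. norm (x + u) < R"
    using assms by (auto simp: coarsely_transitive_def)
  have R0: "R > 0" using R[of 0] norm_ge_zero le_less_trans by blast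
  have "norm (vector [R, 0] :: real^2) = R" using R0 by (simp add: norm_vec2)
  then obtain w where w: "w \<in> T" "w \<noteq> 0" using R[of "vector [R, 0]"] by force
  let ?w' = "vector [- w$2, w$1] :: real^2"
  have n: "norm ?w' > 0" using w(2) by (auto simp: vec2_eq_iff)
  obtain v where v: "v \<in> T" "norm ((R / norm ?w') *\<^sub>R ?w' + v) < R" using R by blast
  have "\<bar>((R / norm ?w') *\<^sub>R ?w' + v) \<bullet> ?w'\<bar> \<le> norm ((R / norm ?w') *\<^sub>R ?w' + v) * norm ?w'"
    by (rule Cauchy_Schwarz_ineq2)
  also have "\<dots> < R * norm ?w'" using v(2) n by simp
  finally have "\<bar>R * norm ?w' + v \<bullet> ?w'\<bar> < R * norm ?w'"
    using n by (simp add: inner_left_distrib power2_norm_eq_inner[symmetric] power2_eq_square)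
  then have "v \<bullet> ?w' \<noteq> 0" by auto
  then have "det2 w v \<noteq> 0" by (simp add: det2_def inner_vec2 algebra_simps)
  then show thesis using that w v by blast
qed

text \<open>If \<open>P\<close> contains a rotation by an angle other than 0 and a half turn, a
  nontrivial commutator with it is a translation, and rotating that translation gives a second,
  independent one. Otherwise \<open>P\<close> consists of translations and half turns, so the
  translations have index at most two in it.\<close>

lemma two_independent_translations:
  assumes G: "perm_group G" and iso: "\<And>g x y. g \<in> G \<Longrightarrow> dist (g x) (g y) = dist x y"
    and ct: "coarsely_transitive G"
  obtains u v where "translation u \<in> G" "translation v \<in> G" "det2 u v \<noteq> 0"
proof -
  define P where "P = {g \<in> G. \<exists>a b k l. a\<^sup>2 + b\<^sup>2 = 1 \<and> g = rigid 1 a b k l}"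
  have iso': "dist (g x) (g y) = dist x y" if "g \<in> P" for g x y using iso that by (auto simp: P_def)
  have ctP: "coarsely_transitive P"
  proof (cases "G \<subseteq> P")
    case True
    then have "G = P" by (auto simp: P_def)
    then show ?thesis using ct by simp
  next
    case False
    then obtain h where h: "h \<in> G" "h \<notin> P" by blast
    have form: "\<exists>a b k l. a\<^sup>2 + b\<^sup>2 = 1 \<and> g = rigid (-1) a b k l" if gGP: "g \<in> G" "g \<notin> P" for g
    proof -
      obtain \<sigma> a b k l where g: "\<sigma> = 1 \<or> \<sigma> = -1" "a\<^sup>2 + b\<^sup>2 = 1" "g = rigid \<sigma> a b k l"
        using isometry_rigid[OF iso[OF gGP(1)]] by metis
      have "\<sigma> \<noteq> 1"
      proof
        assume "\<sigma> = 1"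
        then have "g \<in> P" using g gGP(1) unfolding P_def by blast
        then show False using gGP(2) by blast
      qed
      then show ?thesis using g by blast
    qed
    have "h \<circ> g \<in> P" if g: "g \<in> G" "g \<notin> P" for g
    proof -
      obtain a b k l where 1: "a\<^sup>2 + b\<^sup>2 = 1" "h = rigid (-1) a b k l" using form h by blast
      obtain a' b' k' l' where 2: "a'\<^sup>2 + b'\<^sup>2 = 1" "g = rigid (-1) a' b' k' l'" using form g by blast
      have "(a * a' + b * b')\<^sup>2 + (b * a' - a * b')\<^sup>2 = (a\<^sup>2 + b\<^sup>2) * (a'\<^sup>2 + b'\<^sup>2)"
        by (simp add: algebra_simps power2_eq_square)
      then show ?thesis
        using perm_groupD(2)[OF G h(1) g(1)] 1(1) 2(1) unfolding P_def 1(2) 2(2)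
        by (simp add: rigid_comp) blast
    qed
    then show ?thesis using coarsely_transitive_index_two[OF ct iso[OF h(1)]] by blast
  qed
  show thesis
  proof (cases "\<exists>a b k l. rigid 1 a b k l \<in> P \<and> a\<^sup>2 + b\<^sup>2 = 1 \<and> b \<noteq> 0")
    case True
    then obtain a b k l where h: "rigid 1 a b k l \<in> P" "a\<^sup>2 + b\<^sup>2 = 1" "b \<noteq> 0" by blast
    let ?h = "rigid 1 a b k l"
    have hG: "?h \<in> G" using h(1) by (simp add: P_def)
    obtain g x where g: "g \<in> P" "?h (g x) \<noteq> g (?h x)"
      using rotation_centralizer_not_coarsely_transitive[OF ctP h(3,2) iso'] by blast
    then obtain a' b' k' l' where g': "g = rigid 1 a' b' k' l'" "g \<in> G" by (auto simp: P_def)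
    \<comment> \<open>The linear parts of plane rotations commute, so the discrepancy between the
      two orders of composition is the same at every point.\<close>
    define w where "w = ?h (g x) - g (?h x)"
    have "?h (g y) = g (?h y) + w" for y
      by (simp add: w_def g' vec2_eq_iff algebra_simps)
    then have hg: "?h \<circ> g = translation w \<circ> (g \<circ> ?h)" by (simp add: fun_eq_iff)
    have ghG: "g \<circ> ?h \<in> G" using perm_groupD(2)[OF G g'(2) hG] .
    have "(?h \<circ> g) \<circ> fun_inv (g \<circ> ?h) = translation w"
      unfolding hg using perm_groupD(5)[OF G ghG] by (simp add: fun_eq_iff)
    then have tw: "translation w \<in> G"
      using perm_groupD(2)[OF G perm_groupD(2)[OF G hG g'(2)] perm_groupD(4)[OF G ghG]] by simp
    \<comment> \<open>The conjugate of the translation by \<open>w\<close> under \<open>?h\<close>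
      is the translation by the rotated vector, which is independent of \<open>w\<close> because
      \<open>b\<close> is not 0.\<close>
    define w' where "w' = (vector [a * w$1 - b * w$2, b * w$1 + a * w$2] :: real^2)"
    have ht: "?h \<circ> translation w = translation w' \<circ> ?h"
      by (simp add: fun_eq_iff vec2_eq_iff w'_def algebra_simps)
    have "(?h \<circ> translation w) \<circ> fun_inv ?h = translation w'"
      unfolding ht using perm_groupD(5)[OF G hG] by (simp add: fun_eq_iff)
    then have tw': "translation w' \<in> G"
      using perm_groupD(2)[OF G perm_groupD(2)[OF G hG tw] perm_groupD(4)[OF G hG]] by simp
    have "w \<noteq> 0" using g(2) by (simp add: w_def)
    then have "(w$1)\<^sup>2 + (w$2)\<^sup>2 \<noteq> 0" by (simp add: vec2_eq_iff sum_power2_eq_zero_iff)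
    moreover have "det2 w w' = b * ((w$1)\<^sup>2 + (w$2)\<^sup>2)"
      by (simp add: det2_def w'_def algebra_simps power2_eq_square)
    ultimately show thesis using that[OF tw tw'] h(3) by simp
  next
    case False
    define T where "T = {u. translation u \<in> G}"
    have form: "(\<exists>u. g = translation u) \<or> (\<exists>u. g = (\<lambda>x. u - x))" if gP: "g \<in> P" for g
    proof -
      obtain a b k l where g: "a\<^sup>2 + b\<^sup>2 = 1" "g = rigid 1 a b k l" using gP by (auto simp: P_def)
      then have "b = 0" using False gP by blast
      then have "a = 1 \<or> a = -1" using g(1) by (simp add: power2_eq_1_iff)
      then have "g = translation (vector [k, l]) \<or> g = (\<lambda>x. vector [k, l] - x)"
        by (auto simp: g(2) \<open>b = 0\<close> fun_eq_iff vec2_eq_iff)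
      then show ?thesis by blast
    qed
    have "coarsely_transitive (translation ` T)"
    proof (cases "P \<subseteq> translation ` T")
      case True
      then show ?thesis using ctP unfolding coarsely_transitive_def by (meson subset_iff)
    next
      case False
      then obtain h where h: "h \<in> P" "h \<notin> translation ` T" by blast
      have refl: "\<exists>u. g = (\<lambda>x. u - x)" if "g \<in> P" "g \<notin> translation ` T" for g
        using form[OF that(1)] that by (auto simp: T_def P_def)
      show ?thesis
      proof (rule coarsely_transitive_index_two[OF ctP iso'[OF h(1)]])
        fix g assume g: "g \<in> P" "g \<notin> translation ` T"
        obtain u v where "h = (\<lambda>x. u - x)" "g = (\<lambda>x. v - x)" using refl h g by metis
        then have "h \<circ> g = translation (u - v)" by (simp add: fun_eq_iff)
        moreover have "h \<circ> g \<in> G" using perm_groupD(2)[OF G] g h by (auto simp: P_def)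
        ultimately show "h \<circ> g \<in> translation ` T" by (auto simp: T_def)
      qed
    qed
    from translations_if_coarsely_transitive[OF this] show thesis using that by (auto simp: T_def)
  qed
qed

text \<open>Otherwise the quotients of successive members of a convergent sequence would tend to \<open>id\<close> pointwise.\<close>

lemma finite_bounded_displacement:
  fixes G :: "(real^2 \<Rightarrow> real^2) set"
  assumes G: "perm_group G" and iso: "\<And>g x y. g \<in> G \<Longrightarrow> dist (g x) (g y) = dist x y"
    and d: "discrete G"
  shows "finite {g \<in> G. norm (g 0) \<le> R}"
proof (rule ccontr)
  let ?S = "{g \<in> G. norm (g 0) \<le> R}"
  assume "infinite ?S"
  then obtain f :: "nat \<Rightarrow> real^2 \<Rightarrow> real^2" where f: "inj f" "range f \<subseteq> ?S"
    using infinite_countable_subset by blast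
  have fG: "f n \<in> G" and fR: "norm (f n 0) \<le> R" for n using f(2) by auto
  let ?e1 = "vector [1,0] :: real^2" and ?e2 = "vector [0,1] :: real^2"
  \<comment> \<open>A plane isometry is affine, hence determined by its values at 0 and at the two
    basis vectors; convergence at these three points is convergence everywhere.\<close>
  let ?F = "\<lambda>n. (f n 0, f n ?e1, f n ?e2)"
  have fe: "norm (f n e) \<le> R + norm e" for n e
    using iso[OF fG, of n e 0] fR[of n] norm_triangle_ineq[of "f n e - f n 0" "f n 0"]
    by (simp add: dist_norm)
  have "bounded (range ?F)"
  proof (rule bounded_subset)
    show "bounded (cball 0 R \<times> cball 0 (R + norm ?e1) \<times> cball (0::real^2) (R + norm ?e2))"
      by (intro bounded_Times bounded_cball)
    show "range ?F \<subseteq> cball 0 R \<times> cball 0 (R + norm ?e1) \<times> cball (0::real^2) (R + norm ?e2)"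
      using fR fe by auto
  qed
  then obtain l r where r: "strict_mono r" "(?F \<circ> r) \<longlonglongrightarrow> l"
    using bounded_imp_convergent_subsequence by blast
  define g where "g n = fun_inv (f (r n)) \<circ> f (r (Suc n))" for n
  have gG: "g n \<in> G" for n unfolding g_def using perm_groupD(2,4)[OF G] fG by simp
  have g_id: "g n \<noteq> id" for n
  proof
    assume "g n = id"
    then have "f (r n) \<circ> g n = f (r n)" by simp
    then have "f (r (Suc n)) = f (r n)"
      unfolding g_def using perm_groupD(5)[OF G fG] by (simp add: o_assoc)
    then show False using f(1) r(1) by (metis Suc_n_not_le_n injD order_refl strict_mono_eq)
  qed
  have disp: "norm (g n e - e) = norm (f (r (Suc n)) e - f (r n) e)" for n e
  proof -
    have "f (r n) (g n e) = f (r (Suc n)) e"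
      unfolding g_def using bij_inv_simps(1)[OF perm_groupD(3)[OF G fG]] by simp
    then show ?thesis using iso[OF fG, of "r n" "g n e" e] by (simp add: dist_norm)
  qed
  have lim: "(\<lambda>n. g n e) \<longlonglongrightarrow> e" if "(\<lambda>n. f (r n) e) \<longlonglongrightarrow> m" for e m
  proof -
    have "(\<lambda>n. f (r (Suc n)) e - f (r n) e) \<longlonglongrightarrow> m - m"
      by (intro tendsto_diff that LIMSEQ_Suc)
    then have "(\<lambda>n. norm (g n e - e)) \<longlonglongrightarrow> 0"
      unfolding disp by (simp add: tendsto_norm_zero)
    then show ?thesis by (simp add: LIM_zero_iff tendsto_norm_zero_iff)
  qed
  obtain l0 l1 l2 where l: "l = (l0, l1, l2)" by (cases l)
  have "(\<lambda>n. fst ((?F \<circ> r) n)) \<longlonglongrightarrow> fst l" "(\<lambda>n. fst (snd ((?F \<circ> r) n))) \<longlonglongrightarrow> fst (snd l)"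
    "(\<lambda>n. snd (snd ((?F \<circ> r) n))) \<longlonglongrightarrow> snd (snd l)"
    by (intro tendsto_fst tendsto_snd r(2))+
  then have l0: "(\<lambda>n. g n 0) \<longlonglongrightarrow> 0" and l1: "(\<lambda>n. g n ?e1) \<longlonglongrightarrow> ?e1" and l2: "(\<lambda>n. g n ?e2) \<longlonglongrightarrow> ?e2"
    by (auto intro: lim)
  have "(\<lambda>n. g n x) \<longlonglongrightarrow> x" for x
  proof -
    have "g n x = g n 0 + x$1 *\<^sub>R (g n ?e1 - g n 0) + x$2 *\<^sub>R (g n ?e2 - g n 0)" for n
      by (rule isometry_rigid[OF iso[OF gG[of n]]]) (simp add: vec2_eq_iff algebra_simps)
    moreover have "(\<lambda>n. g n 0 + x$1 *\<^sub>R (g n ?e1 - g n 0) + x$2 *\<^sub>R (g n ?e2 - g n 0))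
        \<longlonglongrightarrow> 0 + x$1 *\<^sub>R (?e1 - 0) + x$2 *\<^sub>R (?e2 - 0)"
      by (intro tendsto_intros l0 l1 l2)
    moreover have "0 + x$1 *\<^sub>R (?e1 - 0) + x$2 *\<^sub>R (?e2 - 0) = x" by (simp add: vec2_eq_iff)
    ultimately show ?thesis by simp
  qed
  then have "limitin (product_topology (\<lambda>_. euclidean) UNIV) g id sequentially"
    unfolding limitin_componentwise by simp
  then have "g \<longlonglongrightarrow> id" unfolding euclidean_product_topology by simp
  moreover obtain U where U: "open U" "U \<inter> G = {id}"
    using discreteD[OF d perm_groupD(1)[OF G]] unfolding isolated_in_def by blast
  ultimately have "eventually (\<lambda>n. g n \<in> U) sequentially"
    using topological_tendstoD[of g id sequentially U] by auto
  then obtain n where "g n \<in> U" by (meson eventually_sequentially order_refl)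
  then show False using U(2) gG g_id by blast
qed

section \<open>Normal coordinates\<close>

text \<open>\<open>p\<close> is the least positive element, which exists by local finiteness;
  division with remainder by \<open>p\<close> leaves remainder 0.\<close>

lemma discrete_subgroup_of_reals:
  fixes S :: "real set"
  assumes diff: "\<And>a b. a \<in> S \<Longrightarrow> b \<in> S \<Longrightarrow> a - b \<in> S"
    and fin: "\<And>R. finite {a \<in> S. \<bar>a\<bar> \<le> R}" and a0: "a0 \<in> S" "a0 \<noteq> 0"
  obtains p where "p > 0" "S = range (\<lambda>k::int. of_int k * p)"
proof -
  have zero: "0 \<in> S" using diff[OF a0(1) a0(1)] by simp
  have neg: "- a \<in> S" if "a \<in> S" for a using diff[OF zero that] by simp
  have add: "a + b \<in> S" if "a \<in> S" "b \<in> S" for a b using diff[OF that(1) neg[OF that(2)]] by simp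
  let ?P = "{a \<in> S. 0 < a \<and> a \<le> \<bar>a0\<bar>}"
  have finP: "finite ?P" by (rule finite_subset[OF _ fin[of "\<bar>a0\<bar>"]]) auto
  have "\<bar>a0\<bar> \<in> ?P" using a0 neg by (auto simp: abs_if)
  then have ne: "?P \<noteq> {}" by blast
  define p where "p = Min ?P"
  have p: "p \<in> S" "0 < p" "p \<le> \<bar>a0\<bar>" using Min_in[OF finP ne] by (auto simp: p_def)
  have nat: "of_nat n * p \<in> S" for n
    by (induction n) (auto simp: zero algebra_simps intro: add p(1))
  have int: "of_int k * p \<in> S" for k
    using nat[of "nat k"] neg[OF nat[of "nat (- k)"]] by (cases "k \<ge> 0") auto
  have "a \<in> range (\<lambda>k::int. of_int k * p)" if "a \<in> S" for a
  proof -
    let ?r = "a - of_int \<lfloor>a / p\<rfloor> * p"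
    have r: "?r \<in> S" using diff[OF that int] .
    have "0 \<le> ?r" "?r < p"
      using floor_divide_lower[OF p(2), of a] floor_divide_upper[OF p(2), of a]
      by (simp_all add: algebra_simps)
    moreover have "\<not> (0 < ?r \<and> ?r < p)"
    proof
      assume *: "0 < ?r \<and> ?r < p"
      then have "?r \<in> ?P" using r p(3) by auto
      then have "p \<le> ?r" unfolding p_def using finP by (rule Min_le[rotated])
      then show False using * by simp
    qed
    ultimately have "a = of_int \<lfloor>a / p\<rfloor> * p" by linarith
    then show ?thesis by blast
  qed
  then have "S = range (\<lambda>k::int. of_int k * p)" using int by auto
  then show thesis using that p(2) by blast
qed

context dihedral_extension
begin

lemma N_normal:
  assumes "g \<in> G" "n \<in> N" shows "g \<circ> n \<circ> fun_inv g \<in> N"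
proof -
  have n: "n \<in> G" "s n = 1" "c n = 0" using assms(2) by (auto simp: N_def)
  show ?thesis
    using coset_N[OF G_comp[OF assms(1) n(1)] assms(1)] assms(1) n
    by (simp add: s_comp c_comp)
qed

end

lemma translation_multiple:
  fixes u :: "real^2"
  assumes "dihedral_extension G N s c" "translation u \<in> G" "s (translation u) = 1"
  shows "translation (of_int k *\<^sub>R u) \<in> G \<and> s (translation (of_int k *\<^sub>R u)) = 1 \<and>
    c (translation (of_int k *\<^sub>R u)) = k * c (translation u)"
proof -
  interpret dihedral_extension G N s c by fact
  have nat: "translation (of_nat n *\<^sub>R u) \<in> G \<and> s (translation (of_nat n *\<^sub>R u)) = 1 \<and>
    c (translation (of_nat n *\<^sub>R u)) = int n * c (translation u)" for n
  proof (induction n)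
    case 0
    have "translation (0::real^2) = id" by auto
    then show ?case using G_id s_id c_id by simp
  next
    case (Suc n)
    have eq: "translation (of_nat (Suc n) *\<^sub>R u) = translation u \<circ> translation (of_nat n *\<^sub>R u)"
      by (auto simp: algebra_simps)
    show ?case
      unfolding eq using Suc assms(2,3) by (simp add: G_comp s_comp c_comp algebra_simps del: o_apply)
  qed
  show ?thesis
  proof (cases "k \<ge> 0")
    case True
    then show ?thesis using nat[of "nat k"] by simp
  next
    case False
    let ?t = "translation (of_nat (nat (- k)) *\<^sub>R u)"
    have t: "?t \<in> G" using nat by blast
    have "translation (of_int k *\<^sub>R u) \<circ> ?t = id" using False by (auto simp: algebra_simps)
    moreover have "?t \<circ> translation (of_int k *\<^sub>R u) = id" using False by (auto simp: algebra_simps)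
    ultimately have "fun_inv ?t = translation (of_int k *\<^sub>R u)" by (metis inv_unique_comp)
    then show ?thesis using G_inv[OF t] s_inv[OF t] c_inv[OF t] nat[of "nat (- k)"] False by simp
  qed
qed

text \<open>Doubling makes the sign trivial, and on translations with trivial sign \<open>c\<close>
  is additive. The combination of the two doubled vectors with coefficients \<open>n\<close> and
  \<open>-m\<close> is therefore in the kernel, and it is nonzero by independence.\<close>

lemma nonzero_translation_in_kernel:
  fixes G :: "(real^2 \<Rightarrow> real^2) set"
  assumes de: "dihedral_extension G N s c"
    and u: "translation u \<in> G" and v: "translation v \<in> G" and ind: "det2 u v \<noteq> 0"
  obtains w where "translation w \<in> N" "w \<noteq> 0"
proof -
  interpret dihedral_extension G N s c by fact
  have sq: "translation (2 *\<^sub>R x) \<in> G \<and> s (translation (2 *\<^sub>R x)) = 1" if "translation x \<in> G" for x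
  proof -
    have "translation (2 *\<^sub>R x) = translation x \<circ> translation x" by (auto simp: scaleR_2)
    then show ?thesis using G_comp[OF that that] s_comp[OF that that] s[OF that] by auto
  qed
  define m n where "m = c (translation (2 *\<^sub>R u))" and "n = c (translation (2 *\<^sub>R v))"
  have un: "u \<noteq> 0" using ind by (auto simp: det2_def)
  show thesis
  proof (cases "m = 0 \<and> n = 0")
    case True
    then have "translation (2 *\<^sub>R u) \<in> N" using sq[OF u] by (simp add: N_def m_def)
    then show thesis using that un by force
  next
    case False
    let ?a = "of_int n *\<^sub>R (2 *\<^sub>R u)" and ?b = "of_int (- m) *\<^sub>R (2 *\<^sub>R v)"
    have a: "translation ?a \<in> G" "s (translation ?a) = 1" "c (translation ?a) = n * m"
      using translation_multiple[OF de, of "2 *\<^sub>R u" n] sq[OF u] by (simp_all add: m_def)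
    have b: "translation ?b \<in> G" "s (translation ?b) = 1" "c (translation ?b) = - m * n"
      using translation_multiple[OF de, of "2 *\<^sub>R v" "- m"] sq[OF v] by (simp_all add: n_def)
    have eq: "translation (?a + ?b) = translation ?b \<circ> translation ?a" by (simp add: fun_eq_iff add.assoc)
    have "s (translation ?b \<circ> translation ?a) = 1" "c (translation ?b \<circ> translation ?a) = 0"
      using s_comp[OF b(1) a(1)] c_comp[OF b(1) a(1)] a b by simp_all
    then have "translation (?a + ?b) \<in> N"
      unfolding eq N_def using G_comp[OF b(1) a(1)] by blast
    moreover have "?a + ?b \<noteq> 0"
    proof
      assume "?a + ?b = 0"
      then have "det2 (?a + ?b) v = 0" "det2 u (?a + ?b) = 0" by (simp_all add: det2_def)
      then have "2 * n * det2 u v = 0" "2 * m * det2 u v = 0"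
        by (auto simp: det2_def algebra_simps)
      then show False using ind False by (auto simp: det2_def)
    qed
    ultimately show thesis using that by blast
  qed
qed

text \<open>Two independent translations in \<open>N\<close> would give each of the infinitely many cosets of \<open>N\<close> a
  representative that moves the origin by a bounded amount.\<close>

lemma kernel_translations_parallel:
  fixes G :: "(real^2 \<Rightarrow> real^2) set"
  assumes de: "dihedral_extension G N s c" and fin: "\<And>R. finite {g \<in> G. norm (g 0) \<le> R}"
    and u: "translation u \<in> N" and v: "translation v \<in> N"
  shows "det2 u v = 0"
proof (rule ccontr)
  assume ind: "det2 u v \<noteq> 0"
  interpret dihedral_extension G N s c by fact
  let ?R = "norm u + norm v"
  let ?S = "{g \<in> G. norm (g 0) \<le> ?R}"
  have uG: "translation u \<in> G" "s (translation u) = 1" "c (translation u) = 0"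
    and vG: "translation v \<in> G" "s (translation v) = 1" "c (translation v) = 0"
    using u v by (auto simp: N_def)
  have "k \<in> c ` ?S" for k
  proof -
    obtain g where g: "g \<in> G" "c g = k" using onto by blast
    define x where "x = g 0"
    \<comment> \<open>Cramer's rule for \<open>x\<close> in the basis \<open>u\<close>,
      \<open>v\<close>. Elements of \<open>N\<close> then remove the integer parts of the
      coordinates without changing \<open>c\<close>.\<close>
    define \<alpha> \<beta> where "\<alpha> = det2 x v / det2 u v" and "\<beta> = det2 u x / det2 u v"
    have x: "x = \<alpha> *\<^sub>R u + \<beta> *\<^sub>R v"
    proof -
      have "det2 u v *\<^sub>R x = det2 x v *\<^sub>R u + det2 u x *\<^sub>R v"
        by (simp add: vec2_eq_iff det2_def algebra_simps)
      then have "(1 / det2 u v) *\<^sub>R (det2 u v *\<^sub>R x) = (1 / det2 u v) *\<^sub>R (det2 x v *\<^sub>R u + det2 u x *\<^sub>R v)"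
        by (rule arg_cong)
      then show ?thesis using ind by (simp add: \<alpha>_def \<beta>_def scaleR_add_right)
    qed
    let ?a = "of_int (- \<lfloor>\<alpha>\<rfloor>) *\<^sub>R u" and ?b = "of_int (- \<lfloor>\<beta>\<rfloor>) *\<^sub>R v"
    let ?h = "translation ?b \<circ> (translation ?a \<circ> g)"
    have a: "translation ?a \<in> G" "s (translation ?a) = 1" "c (translation ?a) = 0"
      using translation_multiple[OF de uG(1,2), of "- \<lfloor>\<alpha>\<rfloor>"] uG(3) by auto
    have b: "translation ?b \<in> G" "s (translation ?b) = 1" "c (translation ?b) = 0"
      using translation_multiple[OF de vG(1,2), of "- \<lfloor>\<beta>\<rfloor>"] vG(3) by auto
    have ag: "translation ?a \<circ> g \<in> G" "c (translation ?a \<circ> g) = k"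
      using G_comp[OF a(1) g(1)] c_comp[OF a(1) g(1)] a g by auto
    have h: "?h \<in> G" "c ?h = k"
      using G_comp[OF b(1) ag(1)] c_comp[OF b(1) ag(1)] b ag by auto
    have "?h 0 = (\<alpha> - of_int \<lfloor>\<alpha>\<rfloor>) *\<^sub>R u + (\<beta> - of_int \<lfloor>\<beta>\<rfloor>) *\<^sub>R v"
      using x by (simp add: x_def algebra_simps)
    then have "norm (?h 0) \<le> \<bar>\<alpha> - of_int \<lfloor>\<alpha>\<rfloor>\<bar> * norm u + \<bar>\<beta> - of_int \<lfloor>\<beta>\<rfloor>\<bar> * norm v"
      using norm_triangle_ineq by (metis norm_scaleR)
    also have "\<dots> \<le> 1 * norm u + 1 * norm v"
      by (intro add_mono mult_right_mono) (linarith | simp)+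
    finally have "?h \<in> ?S" using h(1) by simp
    then show "k \<in> c ` ?S" using h(2) by blast
  qed
  then have "c ` ?S = UNIV" by blast
  moreover have "finite (c ` ?S)" by (rule finite_imageI[OF fin])
  ultimately show False using infinite_UNIV_int by simp
qed

text \<open>The situation after a similarity that turns a translation of \<open>N\<close> into the
  unit horizontal one. Discreteness is kept in the form of \<open>fin\<close>, cocompactness in the
  form of the one non-horizontal translation \<open>vertical\<close>.\<close>

locale diagonal_extension = dihedral_extension G N s c
  for G N :: "(real^2 \<Rightarrow> real^2) set" and s c +
  fixes x0 y0 :: real
  assumes form: "g \<in> G \<Longrightarrow> \<exists>e \<alpha> d \<beta>. g = tri (sg e) 0 \<alpha> (sg d) \<beta>"
    and fin: "finite {g \<in> G. norm (g 0) \<le> R}"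
    and unit: "tri 1 0 1 1 0 \<in> N"
    and vertical: "tri 1 0 x0 1 y0 \<in> G" "y0 \<noteq> 0"
    and horizontal: "tri 1 0 x 1 y \<in> N \<Longrightarrow> y = 0"

lemma tri_translation: "tri 1 0 x 1 y = translation (vector [x, y])"
  by (simp add: fun_eq_iff vec2_eq_iff)

lemma diagonal_coordinates:
  assumes "(G, N) \<in> seifert_fibrations"
  obtains \<phi> s c x0 y0 where "affinity \<phi>"
    "diagonal_extension (conjugate \<phi> G) (conjugate \<phi> N) s c x0 y0"
proof -
  obtain s c where tsg: "two_space_group G" and de: "dihedral_extension G N s c"
    using assms unfolding seifert_fibrations_iff by blast
  interpret dihedral_extension G N s c by fact
  have iso: "dist (g x) (g y) = dist x y" if "g \<in> G" for g x y
    using tsg that by (auto simp: two_space_group_def subgroup_isometries_E2_iff)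
  have fin: "finite {g \<in> G. norm (g 0) \<le> R}" for R
    using finite_bounded_displacement[OF G iso] tsg by (auto simp: two_space_group_def)
  obtain w1 w2 where w: "translation w1 \<in> G" "translation w2 \<in> G" "det2 w1 w2 \<noteq> 0"
    using two_independent_translations[OF G iso coarsely_transitive_if_compact[OF tsg]] by metis
  obtain u where u: "translation u \<in> N" "u \<noteq> 0"
    using nonzero_translation_in_kernel[OF de w] by blast
  define n where "n = (u$1)\<^sup>2 + (u$2)\<^sup>2"
  have n: "n > 0"
    using u(2) by (auto simp: n_def vec2_eq_iff sum_power2_gt_zero_iff)
  \<comment> \<open>With vectors read as complex numbers, \<phi> is division by \<open>u\<close> and
    \<open>\<phi>'\<close> is multiplication by \<open>u\<close>.\<close>
  define \<phi> :: "real^2 \<Rightarrow> real^2" where "\<phi> v = vector [(u$1 * v$1 + u$2 * v$2) / n, (u$1 * v$2 - u$2 * v$1) / n]" for v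
  define \<phi>' :: "real^2 \<Rightarrow> real^2" where "\<phi>' v = vector [u$1 * v$1 - u$2 * v$2, u$2 * v$1 + u$1 * v$2]" for v
  have inv: "\<phi> \<circ> \<phi>' = id" "\<phi>' \<circ> \<phi> = id"
    using n by (auto simp: fun_eq_iff vec2_eq_iff \<phi>_def \<phi>'_def field_simps)
      (auto simp: n_def algebra_simps power2_eq_square)
  have b: "bij \<phi>" using o_bij[OF inv(2,1)] .
  have \<phi>'_inv: "fun_inv \<phi> = \<phi>'" using inv by (metis inv_unique_comp)
  have lin: "linear \<phi>"
    using n by (auto simp: linear_iff vec2_eq_iff \<phi>_def field_simps)
  have aff: "affinity \<phi>"
    unfolding affinity_def using lin b by (intro exI[of _ \<phi>] exI[of _ 0]) auto
  let ?s = "\<lambda>g. s (fun_inv \<phi> \<circ> g \<circ> \<phi>)" and ?c = "\<lambda>g. c (fun_inv \<phi> \<circ> g \<circ> \<phi>)"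
  have de': "dihedral_extension (conjugate \<phi> G) (conjugate \<phi> N) ?s ?c"
    by (rule dihedral_extension_conjugate[OF b de])
  have mem: "h \<in> conjugate \<phi> S" if "g \<in> S" "\<phi> \<circ> g = h \<circ> \<phi>" for g h S
  proof -
    have "fun_inv \<phi> \<circ> h \<circ> \<phi> = fun_inv \<phi> \<circ> (\<phi> \<circ> g)" using that(2) by (simp add: o_assoc)
    also have "\<dots> = g" using bij_inv_simps[OF b] by (simp add: fun_eq_iff)
    finally show ?thesis using that(1) in_conjugate_iff[OF b] by simp
  qed
  have tr: "\<phi> \<circ> translation v = translation (\<phi> v) \<circ> \<phi>" for v
    using linear_add[OF lin] by (simp add: fun_eq_iff)
  have \<phi>u: "\<phi> u = vector [1, 0]"
  proof -
    have "u$1 * u$1 + u$2 * u$2 = n" by (simp add: n_def power2_eq_square)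
    then show ?thesis using n by (simp add: \<phi>_def vec2_eq_iff)
  qed
  have fin': "finite {g \<in> conjugate \<phi> G. norm (g 0) \<le> R}" for R
  proof (rule finite_subset)
    have n': "norm (\<phi> v) = norm v / norm u" for v
    proof -
      have "(u$1 * v$1 + u$2 * v$2)\<^sup>2 + (u$1 * v$2 - u$2 * v$1)\<^sup>2 = n * ((v$1)\<^sup>2 + (v$2)\<^sup>2)"
        by (simp add: n_def algebra_simps power2_eq_square)
      then have "norm (\<phi> v) = sqrt (((v$1)\<^sup>2 + (v$2)\<^sup>2) / n)"
        using n by (simp add: norm_vec2 \<phi>_def power_divide add_divide_distrib[symmetric] power2_eq_square)
      then show ?thesis by (simp add: norm_vec2 n_def real_sqrt_divide)
    qed
    show "{g \<in> conjugate \<phi> G. norm (g 0) \<le> R} \<subseteq> conjugate \<phi> {g \<in> G. norm (g 0) \<le> R * norm u}"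
    proof
      fix h assume "h \<in> {g \<in> conjugate \<phi> G. norm (g 0) \<le> R}"
      then obtain g where g: "g \<in> G" "h = \<phi> \<circ> g \<circ> fun_inv \<phi>" "norm (h 0) \<le> R"
        by (auto simp: conjugate_def)
      have "\<phi>' 0 = 0" by (simp add: \<phi>'_def vec2_eq_iff)
      then have "h 0 = \<phi> (g 0)" using g(2) \<phi>'_inv by simp
      then have "norm (g 0) \<le> R * norm u" using g(3) u(2) n' by (simp add: field_simps)
      then show "h \<in> conjugate \<phi> {g \<in> G. norm (g 0) \<le> R * norm u}"
        using g by (auto simp: conjugate_def)
    qed
    show "finite (conjugate \<phi> {g \<in> G. norm (g 0) \<le> R * norm u})"
      unfolding conjugate_def using fin by simp
  qed
  have unit: "tri 1 0 1 1 0 \<in> conjugate \<phi> N"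
    using mem[OF u(1) tr] unfolding \<phi>u tri_translation .
  \<comment> \<open>The vector \<open>u\<close> cannot be parallel to both of two independent
    vectors.\<close>
  obtain w3 where w3: "translation w3 \<in> G" "det2 u w3 \<noteq> 0"
  proof -
    have "u$1 * det2 w1 w2 = w1$1 * det2 u w2 - w2$1 * det2 u w1"
      "u$2 * det2 w1 w2 = w1$2 * det2 u w2 - w2$2 * det2 u w1"
      by (simp_all add: det2_def algebra_simps)
    then have "det2 u w1 \<noteq> 0 \<or> det2 u w2 \<noteq> 0" using u(2) w(3) by (auto simp: vec2_eq_iff)
    then show thesis using that w by blast
  qed
  have vert: "tri 1 0 (\<phi> w3 $ 1) 1 (\<phi> w3 $ 2) \<in> conjugate \<phi> G"
  proof -
    have "vector [\<phi> w3 $ 1, \<phi> w3 $ 2] = \<phi> w3" by (simp add: vec2_eq_iff)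
    then show ?thesis using mem[OF w3(1) tr] unfolding tri_translation by simp
  qed
  have vert0: "\<phi> w3 $ 2 \<noteq> 0" using w3(2) n by (simp add: \<phi>_def det2_def)
  have horiz: "y = 0" if "tri 1 0 x 1 y \<in> conjugate \<phi> N" for x y
    using kernel_translations_parallel[OF de' fin' unit[unfolded tri_translation] that[unfolded tri_translation]]
    by (simp add: det2_def)
  have form: "\<exists>e \<alpha> d \<beta>. h = tri (sg e) 0 \<alpha> (sg d) \<beta>" if "h \<in> conjugate \<phi> G" for h
  proof -
    obtain g where g: "g \<in> G" "h = \<phi> \<circ> g \<circ> fun_inv \<phi>" using \<open>h \<in> conjugate \<phi> G\<close> by (auto simp: conjugate_def)
    obtain \<sigma> a b k l where \<sigma>: "\<sigma> = 1 \<or> \<sigma> = -1" and ab: "a\<^sup>2 + b\<^sup>2 = 1" and gr: "g = rigid \<sigma> a b k l"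
      using isometry_rigid[OF iso[OF g(1)]] by metis
    \<comment> \<open>\<open>w\<close> is the image of \<open>u\<close> under the linear part of
      \<open>g\<close>. Translation by it is a conjugate of translation by \<open>u\<close>, so it
      lies in \<open>N\<close> and \<open>w\<close> is parallel to \<open>u\<close>. Equality of
      lengths then gives \<open>w = t u\<close> with \<open>t\<close> a sign.\<close>
    define w where "w = (vector [a * u$1 - \<sigma> * b * u$2, b * u$1 + \<sigma> * a * u$2] :: real^2)"
    have gt: "g \<circ> translation u = translation w \<circ> g"
      unfolding gr by (simp add: fun_eq_iff vec2_eq_iff w_def algebra_simps)
    have "translation w \<circ> g \<circ> fun_inv g = translation w"
      using bij_inv_simps(1)[OF G_bij[OF g(1)]] by (simp add: fun_eq_iff)
    then have "translation w \<in> N" using N_normal[OF g(1) u(1)] unfolding gt by simp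
    then have dw: "det2 u w = 0" using kernel_translations_parallel[OF de fin u(1)] by simp
    define t where "t = (u$1 * w$1 + u$2 * w$2) / n"
    have wt: "w$1 = t * u$1" "w$2 = t * u$2"
    proof -
      have "w$1 * n = (u$1 * w$1 + u$2 * w$2) * u$1" "w$2 * n = (u$1 * w$1 + u$2 * w$2) * u$2"
        using dw unfolding n_def det2_def by algebra+
      then show "w$1 = t * u$1" "w$2 = t * u$2" using n by (simp_all add: t_def field_simps)
    qed
    have "(w$1)\<^sup>2 + (w$2)\<^sup>2 = n"
    proof -
      have "(w$1)\<^sup>2 + (w$2)\<^sup>2 = (a\<^sup>2 + b\<^sup>2) * n"
        using \<sigma> by (auto simp: w_def n_def algebra_simps power2_eq_square)
      then show ?thesis using ab by simp
    qed
    then have "t\<^sup>2 * n = n" unfolding wt n_def by (simp add: algebra_simps power2_eq_square)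
    then have t: "t = 1 \<or> t = -1" using n by (simp add: power2_eq_1_iff)
    have eq1: "a * u$1 - \<sigma> * b * u$2 = t * u$1" and eq2: "b * u$1 + \<sigma> * a * u$2 = t * u$2"
      using wt by (simp_all add: w_def)
    \<comment> \<open>For an orthogonal matrix with eigenvector \<open>u\<close> and eigenvalue
      \<open>t\<close> a sign, the transpose has the same eigenvector and eigenvalue; this is the
      content of \<open>r1\<close> and \<open>r2\<close>.\<close>
    have "t * (a * u$1 + b * u$2) = (a\<^sup>2 + b\<^sup>2) * u$1"
      using eq1[symmetric] eq2[symmetric] by (simp add: algebra_simps power2_eq_square) algebra
    then have r1: "a * u$1 + b * u$2 = t * u$1" using t ab by auto
    have "t * \<sigma> * (a * u$2 - b * u$1) = (a\<^sup>2 + b\<^sup>2) * u$2"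
      using eq1[symmetric] eq2[symmetric] \<sigma> by (auto simp: algebra_simps power2_eq_square) algebra+
    then have r2: "a * u$2 - b * u$1 = \<sigma> * t * u$2" using t \<sigma> ab by auto
    have c1: "u$1 * (g v $ 1) + u$2 * (g v $ 2) = t * (u$1 * v$1 + u$2 * v$2) + (u$1 * k + u$2 * l)" for v
    proof -
      have "u$1 * (g v $ 1) + u$2 * (g v $ 2) =
          (a * u$1 + b * u$2) * v$1 + \<sigma> * (a * u$2 - b * u$1) * v$2 + (u$1 * k + u$2 * l)"
        by (simp add: gr algebra_simps)
      also have "\<dots> = t * u$1 * v$1 + \<sigma> * (\<sigma> * t * u$2) * v$2 + (u$1 * k + u$2 * l)"
        unfolding r1 r2 by simp
      finally show ?thesis using \<sigma> by (auto simp: algebra_simps)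
    qed
    have c2: "u$1 * (g v $ 2) - u$2 * (g v $ 1) = \<sigma> * t * (u$1 * v$2 - u$2 * v$1) + (u$1 * l - u$2 * k)" for v
    proof -
      have "u$1 * (g v $ 2) - u$2 * (g v $ 1) =
          \<sigma> * (a * u$1 + b * u$2) * v$2 - (a * u$2 - b * u$1) * v$1 + (u$1 * l - u$2 * k)"
        by (simp add: gr algebra_simps)
      also have "\<dots> = \<sigma> * (t * u$1) * v$2 - (\<sigma> * t * u$2) * v$1 + (u$1 * l - u$2 * k)"
        unfolding r1 r2 by simp
      finally show ?thesis by (simp add: algebra_simps)
    qed
    have "\<phi> (g v) = tri t 0 (\<phi> (vector [k, l]) $ 1) (\<sigma> * t) (\<phi> (vector [k, l]) $ 2) (\<phi> v)" for v
      using c1[of v] c2[of v] by (simp add: vec2_eq_iff \<phi>_def add_divide_distrib[symmetric])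
    then have "h = tri t 0 (\<phi> (vector [k, l]) $ 1) (\<sigma> * t) (\<phi> (vector [k, l]) $ 2)"
      using bij_inv_simps(1)[OF b] by (simp add: g(2) fun_eq_iff)
    moreover have "t = sg (t = -1)" "\<sigma> * t = sg (\<sigma> * t = -1)" using t \<sigma> by (auto simp: sg_def)
    ultimately show ?thesis by metis
  qed
  have "diagonal_extension (conjugate \<phi> G) (conjugate \<phi> N) ?s ?c (\<phi> w3 $ 1) (\<phi> w3 $ 2)"
    unfolding diagonal_extension_def diagonal_extension_axioms_def
    using de' form fin' unit vert vert0 horiz by blast
  then show thesis using that aff by blast
qed

section \<open>Action on the lines and along the lines\<close>

context diagonal_extension
begin

lemma formE:
  assumes "g \<in> G"
  obtains e \<alpha> d \<beta> where "g = tri (sg e) 0 \<alpha> (sg d) \<beta>"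
  using form assms by blast

text \<open>A reflection in the second coordinate cannot lie in \<open>N\<close>: its commutator with a non-horizontal
  translation would be a non-horizontal translation in \<open>N\<close>.\<close>

lemma N_fixes_lines:
  assumes N: "tri (sg e) 0 \<alpha> (sg d) \<beta> \<in> N"
  shows "\<not> d \<and> \<beta> = 0"
proof -
  let ?n = "tri (sg e) 0 \<alpha> (sg d) \<beta>" and ?t = "tri 1 0 x0 1 y0"
  have n: "?n \<in> G" "s ?n = 1" "c ?n = 0" using N by (auto simp: N_def)
  note t = vertical(1)
  have "(?t \<circ> ?n) \<circ> fun_inv (?n \<circ> ?t) \<in> N"
    using n t by (intro coset_N G_comp) (simp_all add: s_comp c_comp)
  moreover have "?t \<circ> ?n = tri 1 0 (x0 - sg e * x0) 1 (y0 - sg d * y0) \<circ> (?n \<circ> ?t)"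
    by (simp add: tri_comp tri_eq_iff algebra_simps)
  then have "(?t \<circ> ?n) \<circ> fun_inv (?n \<circ> ?t) = tri 1 0 (x0 - sg e * x0) 1 (y0 - sg d * y0)"
    using G_inv_r[OF G_comp[OF n(1) t]] by (simp add: o_assoc[symmetric])
  ultimately have "tri 1 0 (x0 - sg e * x0) 1 (y0 - sg d * y0) \<in> N" by simp
  then have "y0 - sg d * y0 = 0" by (rule horizontal)
  then have d: "\<not> d" using vertical(2) by (auto simp: sg_def split: if_splits)
  have "?n \<circ> ?n \<in> N" using N_perm_group N by (simp add: perm_group_def)
  moreover have "?n \<circ> ?n = tri 1 0 (sg e * \<alpha> + \<alpha>) 1 (2 * \<beta>)"
    using d by (simp add: tri_comp tri_eq_iff)
  ultimately have "2 * \<beta> = 0" using horizontal by metis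
  then show ?thesis using d by simp
qed

text \<open>The two elements differ by a factor in \<open>N\<close>, which fixes every horizontal
  line. So the action on the second coordinate depends on \<open>s\<close> and \<open>c\<close>
  alone.\<close>

lemma same_line_action:
  assumes g: "tri (sg e) 0 \<alpha> (sg d) \<beta> \<in> G" and h: "tri (sg e') 0 \<alpha>' (sg d') \<beta>' \<in> G"
    and eq: "s (tri (sg e) 0 \<alpha> (sg d) \<beta>) = s (tri (sg e') 0 \<alpha>' (sg d') \<beta>')"
      "c (tri (sg e) 0 \<alpha> (sg d) \<beta>) = c (tri (sg e') 0 \<alpha>' (sg d') \<beta>')"
  shows "d = d' \<and> \<beta> = \<beta>'"
proof -
  let ?g = "tri (sg e) 0 \<alpha> (sg d) \<beta>" and ?h = "tri (sg e') 0 \<alpha>' (sg d') \<beta>'"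
  have n: "?g \<circ> fun_inv ?h \<in> N" by (rule coset_N[OF g h eq])
  then obtain e1 \<alpha>1 d1 \<beta>1 where n1: "?g \<circ> fun_inv ?h = tri (sg e1) 0 \<alpha>1 (sg d1) \<beta>1"
    using N_sub form by blast
  then have "\<not> d1" "\<beta>1 = 0" using N_fixes_lines n by auto
  then have "?g \<circ> fun_inv ?h \<circ> ?h = tri (sg e1) 0 \<alpha>1 1 0 \<circ> ?h" unfolding n1 by simp
  then have "?g = tri (sg e1) 0 \<alpha>1 1 0 \<circ> ?h"
    using G_inv_l[OF h] by (simp add: o_assoc[symmetric])
  then show ?thesis by (simp add: tri_comp tri_eq_iff)
qed

lemma scaleR_vec2: "r *\<^sub>R (vector [x, y] :: real^2) = vector [r * x, r * y]"
  by (simp add: vec2_eq_iff)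

lemma finite_horizontal: "finite {\<alpha>. tri 1 0 \<alpha> 1 0 \<in> G \<and> \<bar>\<alpha>\<bar> \<le> R}"
proof -
  have "inj_on (\<lambda>\<alpha>. tri 1 0 \<alpha> 1 0) {\<alpha>. tri 1 0 \<alpha> 1 0 \<in> G \<and> \<bar>\<alpha>\<bar> \<le> R}"
    by (auto simp: inj_on_def tri_eq_iff)
  moreover have "(\<lambda>\<alpha>. tri 1 0 \<alpha> 1 0) ` {\<alpha>. tri 1 0 \<alpha> 1 0 \<in> G \<and> \<bar>\<alpha>\<bar> \<le> R} \<subseteq> {g \<in> G. norm (g 0) \<le> R}"
    by (auto simp: norm_vec2)
  ultimately show ?thesis by (rule inj_on_finite[OF _ _ fin])
qed

lemma horizontal_group:
  assumes N': "perm_group N'" "N' \<subseteq> G" and a: "tri 1 0 a 1 0 \<in> N'" "a \<noteq> 0"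
  obtains p where "p > 0" "\<And>\<alpha>. tri 1 0 \<alpha> 1 0 \<in> N' \<longleftrightarrow> (\<exists>k::int. \<alpha> = of_int k * p)"
proof -
  let ?S = "{\<alpha>. tri 1 0 \<alpha> 1 0 \<in> N'}"
  have "x - y \<in> ?S" if "x \<in> ?S" "y \<in> ?S" for x y
  proof -
    have "fun_inv (tri 1 0 y 1 0) \<in> N'" using that perm_groupD(4)[OF N'(1)] by simp
    then have "tri 1 0 x 1 0 \<circ> fun_inv (tri 1 0 y 1 0) \<in> N'" using that perm_groupD(2)[OF N'(1)] by simp
    then show ?thesis by (simp add: tri_inverse tri_comp)
  qed
  moreover have "finite {x \<in> ?S. \<bar>x\<bar> \<le> R}" for R
    by (rule finite_subset[OF _ finite_horizontal[of R]]) (use N'(2) in auto)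
  moreover have "a \<in> ?S" using a by simp
  ultimately obtain p where "p > 0" "?S = range (\<lambda>k::int. of_int k * p)"
    using discrete_subgroup_of_reals[of ?S a] a(2) by blast
  then show thesis using that by (auto simp: set_eq_iff)
qed

text \<open>An element acting trivially on the second coordinate has finite order modulo \<open>N\<close>.\<close>

lemma trivial_line_action:
  assumes g: "tri (sg e) 0 \<alpha> 1 0 \<in> G" and s1: "s (tri (sg e) 0 \<alpha> 1 0) = 1"
  shows "c (tri (sg e) 0 \<alpha> 1 0) = 0"
proof -
  let ?g = "tri (sg e) 0 \<alpha> 1 0"
  obtain p where p: "p > 0" "\<And>\<alpha>. tri 1 0 \<alpha> 1 0 \<in> G \<longleftrightarrow> (\<exists>k::int. \<alpha> = of_int k * p)"
    using horizontal_group[OF G order_refl, of 1] unit N_sub by auto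
  obtain m :: int where m: "1 = of_int m * p" using p(2)[of 1] unit N_sub by auto
  have gg: "?g \<circ> ?g = tri 1 0 (sg e * \<alpha> + \<alpha>) 1 0" by (simp add: tri_comp tri_eq_iff)
  let ?a = "sg e * \<alpha> + \<alpha>"
  have ggG: "tri 1 0 ?a 1 0 \<in> G" using G_comp[OF g g] unfolding gg .
  have sgg: "s (tri 1 0 ?a 1 0) = 1" using s_comp[OF g g] s1 unfolding gg by simp
  have cgg: "c (tri 1 0 ?a 1 0) = 2 * c ?g" using c_comp[OF g g] s1 unfolding gg by simp
  obtain k :: int where k: "?a = of_int k * p" using ggG p(2) by blast
  \<comment> \<open>The \<open>m\<close>-th multiple of the square of \<open>?g\<close> is
    translation by the integer \<open>k\<close>, a multiple of the unit translation in
    \<open>N\<close>; its value under \<open>c\<close> is computed in both ways.\<close>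
  have "c (tri 1 0 (of_int m * ?a) 1 0) = m * c (tri 1 0 ?a 1 0)"
    using translation_multiple[OF dihedral_extension_axioms, of "vector [?a, 0]" m] ggG sgg
    unfolding tri_translation scaleR_vec2 by simp
  moreover have "of_int m * ?a = of_int k" using k m by (metis mult.assoc mult.commute mult.right_neutral)
  moreover have "c (tri 1 0 (of_int k * 1) 1 0) = k * c (tri 1 0 1 1 0)"
    using translation_multiple[OF dihedral_extension_axioms, of "vector [1, 0]" k] unit
    unfolding tri_translation scaleR_vec2 by (simp add: N_def)
  moreover have "c (tri 1 0 1 1 0) = 0" using unit by (simp add: N_def)
  ultimately have "m * (2 * c ?g) = 0" using cgg by simp
  moreover have "m \<noteq> 0" using m by auto
  ultimately show ?thesis by simp
qed

text \<open>\<kappa> is the height by which a lift of the translation by 1 moves lines, and \<mu> is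
  the offset of a lift of the reflection at 0. By \<open>same_line_action\<close> one element for
  each value of \<open>s\<close> and \<open>c\<close> decides all others.\<close>

lemma line_action:
  obtains \<kappa> \<mu> where "\<kappa> \<noteq> 0" and "\<And>g. g \<in> G \<Longrightarrow>
    \<exists>e \<alpha>. g = tri (sg e) 0 \<alpha> (of_int (s g)) (\<kappa> * of_int (c g) + (if s g = 1 then 0 else \<mu>))"
proof -
  obtain t where t: "t \<in> G" "s t = 1" "c t = 1" using ex_t by blast
  obtain et \<alpha>t dt \<kappa> where tt: "t = tri (sg et) 0 \<alpha>t (sg dt) \<kappa>" using formE[OF t(1)] .
  have dt: "\<not> dt"
  proof
    assume dt
    then have "t \<circ> t = tri (sg False) 0 (sg et * \<alpha>t + \<alpha>t) 1 0"
      by (simp add: tt tri_comp tri_eq_iff)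
    then have "c (t \<circ> t) = 0"
      using trivial_line_action[of False] G_comp[OF t(1) t(1)] s_comp[OF t(1) t(1)] t by simp
    then show False using c_comp[OF t(1) t(1)] t by simp
  qed
  have \<kappa>: "\<kappa> \<noteq> 0"
    using trivial_line_action[of et \<alpha>t] t dt by (auto simp: tt)
  have nat: "\<exists>h\<in>G. \<exists>e \<alpha>. s h = 1 \<and> c h = int n \<and> h = tri (sg e) 0 \<alpha> (sg False) (\<kappa> * of_int (int n))" for n
  proof (induction n)
    case 0
    have "id = tri (sg False) 0 0 (sg False) (\<kappa> * of_int (int 0))" by (simp add: tri_id)
    then show ?case using G_id s_id c_id of_nat_0 by metis
  next
    case (Suc n)
    then obtain h e \<alpha> where h: "h \<in> G" "s h = 1" "c h = int n" "h = tri (sg e) 0 \<alpha> (sg False) (\<kappa> * of_int (int n))"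
      by blast
    have "t \<circ> h = tri (sg (et \<noteq> e)) 0 (sg et * \<alpha> + \<alpha>t) (sg False) (\<kappa> * of_int (int (Suc n)))"
      using dt by (simp add: tt h(4) tri_comp tri_eq_iff sg_xor algebra_simps)
    moreover have "t \<circ> h \<in> G" "s (t \<circ> h) = 1" "c (t \<circ> h) = int (Suc n)"
      using t h(1-3) G_comp[OF t(1) h(1)] s_comp[OF t(1) h(1)] c_comp[OF t(1) h(1)] by auto
    ultimately show ?case by blast
  qed
  have int: "\<exists>h\<in>G. \<exists>e \<alpha>. s h = 1 \<and> c h = k \<and> h = tri (sg e) 0 \<alpha> (sg False) (\<kappa> * of_int k)" for k
  proof (cases "k \<ge> 0")
    case True
    then show ?thesis using nat[of "nat k"] by simp
  next
    case False
    then obtain h e \<alpha> where h: "h \<in> G" "s h = 1" "c h = - k" "h = tri (sg e) 0 \<alpha> (sg False) (\<kappa> * of_int (- k))"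
      using nat[of "nat (- k)"] by auto
    have "fun_inv h = tri (sg e) 0 (- sg e * \<alpha>) (sg False) (\<kappa> * of_int k)"
      unfolding h(4) by (subst tri_inverse) (auto simp: tri_eq_iff sg_def)
    then show ?thesis
      using G_inv[OF h(1)] s_inv[OF h(1)] c_inv[OF h(1)] h(2,3) by (intro bexI[of _ "fun_inv h"]) auto
  qed
  have trans: "\<exists>e \<alpha>. g = tri (sg e) 0 \<alpha> 1 (\<kappa> * of_int (c g))" if g: "g \<in> G" "s g = 1" for g
  proof -
    obtain e \<alpha> d \<beta> where gt: "g = tri (sg e) 0 \<alpha> (sg d) \<beta>" using formE[OF g(1)] .
    obtain h e' \<alpha>' where h: "h \<in> G" "s h = 1" "c h = c g" "h = tri (sg e') 0 \<alpha>' (sg False) (\<kappa> * of_int (c g))"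
      using int by blast
    have "d = False \<and> \<beta> = \<kappa> * of_int (c g)"
      using same_line_action[of e \<alpha> d \<beta> e' \<alpha>' False] g h gt by metis
    then show ?thesis using gt by (metis sg_simps(2))
  qed
  show thesis
  proof (cases "\<exists>r\<in>G. s r = -1 \<and> c r = 0")
    case False
    then have "s g = 1" if "g \<in> G" for g using ex_r that by blast
    then show thesis using that[OF \<kappa>, of 0] trans by auto
  next
    case True
    then obtain r where r: "r \<in> G" "s r = -1" "c r = 0" by blast
    obtain er \<alpha>r dr \<mu> where rt: "r = tri (sg er) 0 \<alpha>r (sg dr) \<mu>" using formE[OF r(1)] .
    \<comment> \<open>If \<open>r\<close> merely translated the lines, it would commute there with
      \<open>t\<close>. But \<open>r \<circ> t\<close> and \<open>h \<circ> r\<close>, with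
      \<open>h\<close> in place of the inverse of \<open>t\<close>, have the same image in the
      dihedral group, so \<kappa> would equal its negative.\<close>
    have dr: dr
    proof (rule ccontr)
      assume dr: "\<not> dr"
      obtain h e' \<alpha>' where h: "h \<in> G" "s h = 1" "c h = -1" "h = tri (sg e') 0 \<alpha>' (sg False) (\<kappa> * of_int (-1))"
        using int by blast
      have rtc: "r \<circ> t = tri (sg (er \<noteq> et)) 0 (sg er * \<alpha>t + \<alpha>r) (sg False) (\<kappa> + \<mu>)"
        using dr dt by (simp add: tt rt tri_comp tri_eq_iff sg_xor)
      have hrc: "h \<circ> r = tri (sg (e' \<noteq> er)) 0 (sg e' * \<alpha>r + \<alpha>') (sg False) (\<mu> - \<kappa>)"
        using dr by (simp add: h(4) rt tri_comp tri_eq_iff sg_xor)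
      have "s (r \<circ> t) = s (h \<circ> r)" "c (r \<circ> t) = c (h \<circ> r)"
        using r t h(1-3) by (simp_all add: s_comp c_comp)
      then have "\<kappa> + \<mu> = \<mu> - \<kappa>"
        using same_line_action[of "er \<noteq> et" "sg er * \<alpha>t + \<alpha>r" False "\<kappa> + \<mu>"
            "e' \<noteq> er" "sg e' * \<alpha>r + \<alpha>'" False "\<mu> - \<kappa>"]
          G_comp[OF r(1) t(1)] G_comp[OF h(1) r(1)] unfolding rtc[symmetric] hrc[symmetric] by blast
      then show False using \<kappa> by simp
    qed
    have refl: "\<exists>e \<alpha>. g = tri (sg e) 0 \<alpha> (-1) (\<kappa> * of_int (c g) + \<mu>)" if g: "g \<in> G" "s g = -1" for g
    proof -
      obtain e \<alpha> d \<beta> where gt: "g = tri (sg e) 0 \<alpha> (sg d) \<beta>" using formE[OF g(1)] .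
      obtain h e' \<alpha>' where h: "h \<in> G" "s h = 1" "c h = c g" "h = tri (sg e') 0 \<alpha>' (sg False) (\<kappa> * of_int (c g))"
        using int by blast
      have hr: "h \<circ> r = tri (sg (e' \<noteq> er)) 0 (sg e' * \<alpha>r + \<alpha>') (sg True) (\<kappa> * of_int (c g) + \<mu>)"
        using dr by (simp add: h(4) rt tri_comp tri_eq_iff sg_xor)
      have "s (h \<circ> r) = -1" "c (h \<circ> r) = c g"
        using r h(1-3) by (simp_all add: s_comp c_comp)
      then have "d = True \<and> \<beta> = \<kappa> * of_int (c g) + \<mu>"
        using same_line_action[of e \<alpha> d \<beta> "e' \<noteq> er" "sg e' * \<alpha>r + \<alpha>'" True "\<kappa> * of_int (c g) + \<mu>"]
          G_comp[OF h(1) r(1)] g unfolding hr[symmetric] gt[symmetric] by simp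
      then show ?thesis using gt by (metis sg_simps(1))
    qed
    show thesis using that[OF \<kappa>, of \<mu>] trans refl s by fastforce
  qed
qed

text \<open>\<open>p\<close> is the least positive horizontal translation of \<open>N\<close>. If
  \<open>N\<close> contains reflections, composing with a fixed one of offset
  \<open>\<alpha>0\<close> turns the others into translations.\<close>

lemma fiber_action:
  obtains p \<alpha>0 f where "p > 0" and "\<And>g. g \<in> N \<longleftrightarrow>
    (\<exists>e (k::int). (e \<longrightarrow> f) \<and> g = tri (sg e) 0 (of_int k * p + (if e then \<alpha>0 else 0)) 1 0)"
proof -
  obtain p where p: "p > 0" "\<And>\<alpha>. tri 1 0 \<alpha> 1 0 \<in> N \<longleftrightarrow> (\<exists>k::int. \<alpha> = of_int k * p)"
    using horizontal_group[OF N_perm_group N_sub unit] by auto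
  have form': "\<exists>e \<alpha>. g = tri (sg e) 0 \<alpha> 1 0" if gN: "g \<in> N" for g
  proof -
    obtain e \<alpha> d \<beta> where g: "g = tri (sg e) 0 \<alpha> (sg d) \<beta>" using formE gN N_sub by blast
    then show ?thesis using N_fixes_lines[of e \<alpha> d \<beta>] gN by auto
  qed
  show thesis
  proof (cases "\<exists>\<alpha>. tri (- 1) 0 \<alpha> 1 0 \<in> N")
    case False
    have "g \<in> N \<longleftrightarrow> (\<exists>e (k::int). (e \<longrightarrow> False) \<and> g = tri (sg e) 0 (of_int k * p + (if e then 0 else 0)) 1 0)" for g
    proof
      assume g: "g \<in> N"
      then obtain e \<alpha> where gt: "g = tri (sg e) 0 \<alpha> 1 0" using form' by blast
      then have "\<not> e" using False g by (auto simp: sg_def split: if_splits)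
      then have "tri 1 0 \<alpha> 1 0 \<in> N" using g gt by simp
      then obtain k :: int where "\<alpha> = of_int k * p" using p(2) by blast
      then show "\<exists>e (k::int). (e \<longrightarrow> False) \<and> g = tri (sg e) 0 (of_int k * p + (if e then 0 else 0)) 1 0"
        using gt \<open>\<not> e\<close> by (intro exI[of _ False] exI[of _ k]) simp
    next
      assume "\<exists>e (k::int). (e \<longrightarrow> False) \<and> g = tri (sg e) 0 (of_int k * p + (if e then 0 else 0)) 1 0"
      then obtain k :: int where "g = tri 1 0 (of_int k * p) 1 0" by auto
      then show "g \<in> N" using p(2) by blast
    qed
    then show thesis using that[of p False 0] p(1) by simp
  next
    case True
    then obtain \<alpha>0 where \<alpha>0: "tri (- 1) 0 \<alpha>0 1 0 \<in> N" by blast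
    have shift: "tri (- 1) 0 \<alpha> 1 0 \<in> N \<longleftrightarrow> tri 1 0 (\<alpha> - \<alpha>0) 1 0 \<in> N" for \<alpha>
    proof
      assume "tri (- 1) 0 \<alpha> 1 0 \<in> N"
      then have "tri (- 1) 0 \<alpha> 1 0 \<circ> tri (- 1) 0 \<alpha>0 1 0 \<in> N" using \<alpha>0 perm_groupD(2)[OF N_perm_group] by blast
      moreover have "tri (- 1) 0 \<alpha> 1 0 \<circ> tri (- 1) 0 \<alpha>0 1 0 = tri 1 0 (\<alpha> - \<alpha>0) 1 0" by (simp add: tri_comp)
      ultimately show "tri 1 0 (\<alpha> - \<alpha>0) 1 0 \<in> N" by simp
    next
      assume "tri 1 0 (\<alpha> - \<alpha>0) 1 0 \<in> N"
      then have "tri 1 0 (\<alpha> - \<alpha>0) 1 0 \<circ> tri (- 1) 0 \<alpha>0 1 0 \<in> N" using \<alpha>0 perm_groupD(2)[OF N_perm_group] by blast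
      then show "tri (- 1) 0 \<alpha> 1 0 \<in> N" by (simp add: tri_comp)
    qed
    have "g \<in> N \<longleftrightarrow> (\<exists>e (k::int). (e \<longrightarrow> True) \<and> g = tri (sg e) 0 (of_int k * p + (if e then \<alpha>0 else 0)) 1 0)" for g
    proof
      assume g: "g \<in> N"
      then obtain e \<alpha> where gt: "g = tri (sg e) 0 \<alpha> 1 0" using form' by blast
      have "\<exists>k::int. \<alpha> - (if e then \<alpha>0 else 0) = of_int k * p"
      proof (cases e)
        case True
        then have "tri 1 0 (\<alpha> - \<alpha>0) 1 0 \<in> N" using g gt shift[of \<alpha>] by simp
        then show ?thesis using p(2)[of "\<alpha> - \<alpha>0"] True by simp
      next
        case False
        then have "tri 1 0 \<alpha> 1 0 \<in> N" using g gt by simp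
        then show ?thesis using p(2)[of \<alpha>] False by simp
      qed
      then obtain k :: int where "\<alpha> = of_int k * p + (if e then \<alpha>0 else 0)" by (auto simp: algebra_simps)
      then show "\<exists>e (k::int). (e \<longrightarrow> True) \<and> g = tri (sg e) 0 (of_int k * p + (if e then \<alpha>0 else 0)) 1 0"
        using gt by blast
    next
      assume "\<exists>e (k::int). (e \<longrightarrow> True) \<and> g = tri (sg e) 0 (of_int k * p + (if e then \<alpha>0 else 0)) 1 0"
      then obtain e and k :: int where "g = tri (sg e) 0 (of_int k * p + (if e then \<alpha>0 else 0)) 1 0" by blast
      moreover have "tri 1 0 (of_int k * p) 1 0 \<in> N" using p(2) by blast
      ultimately show "g \<in> N" using shift[of "of_int k * p + \<alpha>0"] by (cases e) simp_all
    qed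
    then show thesis using that[of p True \<alpha>0] p(1) by simp
  qed
qed

lemma rescale:
  obtains \<phi> s' c' f where "affinity \<phi>" "dihedral_extension (conjugate \<phi> G) (conjugate \<phi> N) s' c'"
    "conjugate \<phi> N = pattern_fiber f"
    "\<And>g. g \<in> conjugate \<phi> G \<Longrightarrow> \<exists>e \<alpha>. g = tri (sg e) 0 \<alpha> (of_int (s' g)) (of_int (c' g))"
proof -
  obtain \<kappa> \<mu> where \<kappa>: "\<kappa> \<noteq> 0" and la: "\<And>g. g \<in> G \<Longrightarrow>
    \<exists>e \<alpha>. g = tri (sg e) 0 \<alpha> (of_int (s g)) (\<kappa> * of_int (c g) + (if s g = 1 then 0 else \<mu>))"
    using line_action by metis
  obtain p \<alpha>0 f where p: "p > 0" and fa: "\<And>g. g \<in> N \<longleftrightarrow>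
    (\<exists>e (k::int). (e \<longrightarrow> f) \<and> g = tri (sg e) 0 (of_int k * p + (if e then \<alpha>0 else 0)) 1 0)"
    using fiber_action by metis
  \<comment> \<open>Scales \<open>p\<close> to 2 and \<kappa> to 1, and moves the fixed points
    \<open>\<alpha>0 / 2\<close> and \<open>\<mu> / 2\<close> of the two chosen reflections to
    0.\<close>
  define \<phi> where "\<phi> = tri (2 / p) 0 (- \<alpha>0 / p) (1 / \<kappa>) (- \<mu> / (2 * \<kappa>))"
  have aff: "affinity \<phi>" unfolding \<phi>_def using p \<kappa> by (intro affinity_tri) auto
  have b: "bij \<phi>" by (rule affinity_bij[OF aff])
  have conj: "\<phi> \<circ> g \<circ> fun_inv \<phi> = h" if "\<phi> \<circ> g = h \<circ> \<phi>" for g h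
    unfolding that using bij_inv_simps[OF b] by (simp add: fun_eq_iff)
  have fib: "\<phi> \<circ> tri (sg e) 0 (of_int k * p + (if e then \<alpha>0 else 0)) 1 0 \<circ> fun_inv \<phi> =
      tri (sg e) 0 (of_int (2 * k)) 1 0" for e and k :: int
    using p \<kappa> by (intro conj) (auto simp: \<phi>_def tri_comp tri_eq_iff field_simps)
  have "conjugate \<phi> N = pattern_fiber f"
  proof (intro equalityI subsetI)
    fix h assume "h \<in> conjugate \<phi> N"
    then obtain g where g: "g \<in> N" "h = \<phi> \<circ> g \<circ> fun_inv \<phi>" by (auto simp: conjugate_def)
    then obtain e and k :: int where "e \<longrightarrow> f" "g = tri (sg e) 0 (of_int k * p + (if e then \<alpha>0 else 0)) 1 0"
      using fa by blast
    then have "e \<longrightarrow> f" "h = tri (sg e) 0 (of_int (2 * k)) 1 0" using g(2) fib by auto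
    moreover have "even (2 * k)" by simp
    ultimately show "h \<in> pattern_fiber f" unfolding pattern_fiber_def by blast
  next
    fix h assume "h \<in> pattern_fiber f"
    then obtain e A where h: "e \<longrightarrow> f" "even A" "h = tri (sg e) 0 (of_int A) 1 0"
      unfolding pattern_fiber_def by blast
    then obtain k where k: "A = 2 * k" by blast
    have "tri (sg e) 0 (of_int k * p + (if e then \<alpha>0 else 0)) 1 0 \<in> N" using fa h(1) by blast
    then show "h \<in> conjugate \<phi> N"
      unfolding h(3) k fib[symmetric] conjugate_def by blast
  qed
  moreover have "\<exists>e \<alpha>. h = tri (sg e) 0 \<alpha> (of_int (s (fun_inv \<phi> \<circ> h \<circ> \<phi>))) (of_int (c (fun_inv \<phi> \<circ> h \<circ> \<phi>)))"
    if hG: "h \<in> conjugate \<phi> G" for h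
  proof -
    let ?g = "fun_inv \<phi> \<circ> h \<circ> \<phi>"
    have gG: "?g \<in> G" using hG in_conjugate_iff[OF b] by blast
    have hg: "h = \<phi> \<circ> ?g \<circ> fun_inv \<phi>" using b by (simp add: fun_eq_iff bij_inv_simps)
    obtain e \<alpha> where g: "?g = tri (sg e) 0 \<alpha> (of_int (s ?g)) (\<kappa> * of_int (c ?g) + (if s ?g = 1 then 0 else \<mu>))"
      using la[OF gG] by blast
    have "\<phi> \<circ> tri (sg e) 0 \<alpha> (of_int (s ?g)) (\<kappa> * of_int (c ?g) + (if s ?g = 1 then 0 else \<mu>)) =
       tri (sg e) 0 (2 / p * \<alpha> - \<alpha>0 / p + sg e * \<alpha>0 / p) (of_int (s ?g)) (of_int (c ?g)) \<circ> \<phi>"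
      using p \<kappa> s[OF gG] by (auto simp: \<phi>_def tri_comp tri_eq_iff field_simps)
    then have "\<phi> \<circ> ?g = tri (sg e) 0 (2 / p * \<alpha> - \<alpha>0 / p + sg e * \<alpha>0 / p) (of_int (s ?g)) (of_int (c ?g)) \<circ> \<phi>"
      using g by metis
    from conj[OF this] show ?thesis using hg by metis
  qed
  ultimately show thesis
    using that[OF aff dihedral_extension_conjugate[OF b dihedral_extension_axioms]] by blast
qed

end

lemma normal_coordinates:
  assumes "(G, N) \<in> seifert_fibrations"
  obtains \<phi> s c f where "affinity \<phi>" "dihedral_extension (conjugate \<phi> G) (conjugate \<phi> N) s c"
    "conjugate \<phi> N = pattern_fiber f"
    "\<And>g. g \<in> conjugate \<phi> G \<Longrightarrow> \<exists>e \<alpha>. g = tri (sg e) 0 \<alpha> (of_int (s g)) (of_int (c g))"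
proof -
  obtain \<phi> s c x0 y0 where \<phi>: "affinity \<phi>" and
    D: "diagonal_extension (conjugate \<phi> G) (conjugate \<phi> N) s c x0 y0"
    using diagonal_coordinates[OF assms] by metis
  obtain \<psi> s' c' f where \<psi>: "affinity \<psi>"
    and e: "dihedral_extension (conjugate \<psi> (conjugate \<phi> G)) (conjugate \<psi> (conjugate \<phi> N)) s' c'"
    and f: "conjugate \<psi> (conjugate \<phi> N) = pattern_fiber f"
    and g: "\<And>g. g \<in> conjugate \<psi> (conjugate \<phi> G) \<Longrightarrow> \<exists>e \<alpha>. g = tri (sg e) 0 \<alpha> (of_int (s' g)) (of_int (c' g))"
    using diagonal_extension.rescale[OF D] by metis
  note cc = conjugate_conjugate[OF affinity_bij[OF \<psi>] affinity_bij[OF \<phi>]]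
  show thesis using that[OF affinity_comp[OF \<psi> \<phi>]] e f g unfolding cc by blast
qed

section \<open>Classification\<close>

lemma common_lifts:
  assumes "dihedral_extension G N s c" "dihedral_extension G' N s' c'"
    and t: "t \<in> G \<inter> G'" "s t = 1" "s' t = 1" "c t = 1" "c' t = 1"
  shows "\<exists>h\<in>G \<inter> G'. s h = 1 \<and> s' h = 1 \<and> c h = k \<and> c' h = k"
proof -
  interpret A: dihedral_extension G N s c by fact
  interpret B: dihedral_extension G' N s' c' by fact
  have nat: "\<exists>h\<in>G \<inter> G'. s h = 1 \<and> s' h = 1 \<and> c h = int n \<and> c' h = int n" for n
  proof (induction n)
    case 0
    show ?case using A.G_id B.G_id A.s_id B.s_id A.c_id B.c_id by (metis IntI of_nat_0)
  next
    case (Suc n)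
    then obtain h where h: "h \<in> G" "h \<in> G'" "s h = 1" "s' h = 1" "c h = int n" "c' h = int n" by blast
    have "t \<circ> h \<in> G \<inter> G'" "s (t \<circ> h) = 1" "s' (t \<circ> h) = 1" "c (t \<circ> h) = int (Suc n)" "c' (t \<circ> h) = int (Suc n)"
      using t h by (simp_all add: A.G_comp B.G_comp A.s_comp B.s_comp A.c_comp B.c_comp)
    then show ?case by blast
  qed
  show ?thesis
  proof (cases "k \<ge> 0")
    case True
    then show ?thesis using nat[of "nat k"] by simp
  next
    case False
    obtain h where h: "h \<in> G" "h \<in> G'" "s h = 1" "s' h = 1" "c h = int (nat (- k))" "c' h = int (nat (- k))"
      using nat by blast
    have "fun_inv h \<in> G \<inter> G'" "s (fun_inv h) = 1" "s' (fun_inv h) = 1" "c (fun_inv h) = k" "c' (fun_inv h) = k"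
      using h False by (simp_all add: A.G_inv B.G_inv A.s_inv B.s_inv A.c_inv B.c_inv)
    then show ?thesis by blast
  qed
qed

lemma subset_if_common_lifts:
  assumes "dihedral_extension G N s c" "perm_group G'" "N \<subseteq> G'"
    and lift: "\<And>g. g \<in> G \<Longrightarrow> \<exists>h\<in>G \<inter> G'. s h = s g \<and> c h = c g"
  shows "G \<subseteq> G'"
proof
  interpret A: dihedral_extension G N s c by fact
  fix g assume g: "g \<in> G"
  then obtain h where h: "h \<in> G" "h \<in> G'" "s h = s g" "c h = c g" using lift by blast
  then have "g \<circ> fun_inv h \<in> G'" using A.coset_N[OF g h(1)] assms(3) by auto
  then have "g \<circ> fun_inv h \<circ> h \<in> G'" using perm_groupD(2)[OF assms(2)] h(2) by blast
  then show "g \<in> G'" using A.G_inv_l[OF h(1)] by (simp add: o_assoc[symmetric])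
qed

text \<open>The powers of \<open>t\<close> represent all cosets of \<open>N\<close> in either
  group.\<close>

lemma eq_if_common_translation:
  assumes A: "dihedral_extension G N s c" and B: "dihedral_extension G' N s' c'"
    and triv: "\<And>g. g \<in> G \<Longrightarrow> s g = 1" "\<And>g. g \<in> G' \<Longrightarrow> s' g = 1"
    and t: "t \<in> G" "t \<in> G'" "c t = 1" "c' t = 1"
  shows "G = G'"
proof
  interpret A: dihedral_extension G N s c by fact
  interpret B: dihedral_extension G' N s' c' by fact
  have lift: "\<exists>h\<in>G \<inter> G'. s h = 1 \<and> s' h = 1 \<and> c h = k \<and> c' h = k" for k
    using common_lifts[OF A B, of t] t triv by blast
  show "G \<subseteq> G'"
  proof (rule subset_if_common_lifts[OF A B.G B.N_sub])
    fix g assume g: "g \<in> G"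
    show "\<exists>h\<in>G \<inter> G'. s h = s g \<and> c h = c g" using lift[of "c g"] triv(1)[OF g] by auto
  qed
  show "G' \<subseteq> G"
  proof (rule subset_if_common_lifts[OF B A.G A.N_sub])
    fix g assume g: "g \<in> G'"
    show "\<exists>h\<in>G' \<inter> G. s' h = s' g \<and> c' h = c' g" using lift[of "c' g"] triv(2)[OF g] by auto
  qed
qed

text \<open>Two adjacent reflections generate the infinite dihedral group: their product lifts the
  translation by 1, and its powers, alone or followed by a composition with \<open>r1\<close>,
  represent all cosets of the common subgroup \<open>N\<close>.\<close>

lemma eq_if_common_reflections:
  assumes A: "dihedral_extension G N s c" and B: "dihedral_extension G' N s' c'"
    and r1: "r1 \<in> G" "r1 \<in> G'" "s r1 = -1" "s' r1 = -1" "c r1 = 0" "c' r1 = 0"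
    and r2: "r2 \<in> G" "r2 \<in> G'" "s r2 = -1" "s' r2 = -1" "c r2 = 1" "c' r2 = 1"
  shows "G = G'"
proof
  interpret A: dihedral_extension G N s c by fact
  interpret B: dihedral_extension G' N s' c' by fact
  have t: "r2 \<circ> r1 \<in> G \<inter> G'" "s (r2 \<circ> r1) = 1" "s' (r2 \<circ> r1) = 1" "c (r2 \<circ> r1) = 1" "c' (r2 \<circ> r1) = 1"
    using r1 r2 by (simp_all add: A.G_comp B.G_comp A.s_comp B.s_comp A.c_comp B.c_comp)
  have lift: "\<exists>h\<in>G \<inter> G'. s h = a \<and> s' h = a \<and> c h = k \<and> c' h = k" if a: "a = 1 \<or> a = -1" for a k
  proof -
    have "\<exists>h\<in>G \<inter> G'. s h = 1 \<and> s' h = 1 \<and> c h = k \<and> c' h = k"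
      using t by (rule common_lifts[OF A B])
    then obtain h where h: "h \<in> G" "h \<in> G'" "s h = 1" "s' h = 1" "c h = k" "c' h = k"
      by (elim bexE conjE IntE)
    have hr: "h \<circ> r1 \<in> G \<inter> G'" "s (h \<circ> r1) = -1" "s' (h \<circ> r1) = -1" "c (h \<circ> r1) = k" "c' (h \<circ> r1) = k"
      using r1 h by (simp_all add: A.G_comp B.G_comp A.s_comp B.s_comp A.c_comp B.c_comp)
    from a show ?thesis
    proof
      assume "a = 1"
      then show ?thesis using h by auto
    next
      assume "a = -1"
      then show ?thesis using hr(2-5) by (intro bexI[OF _ hr(1)]) simp
    qed
  qed
  show "G \<subseteq> G'"
  proof (rule subset_if_common_lifts[OF A B.G B.N_sub])
    fix g assume g: "g \<in> G"
    show "\<exists>h\<in>G \<inter> G'. s h = s g \<and> c h = c g" using lift[OF A.s[OF g], of "c g"] by auto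
  qed
  show "G' \<subseteq> G"
  proof (rule subset_if_common_lifts[OF B A.G A.N_sub])
    fix g assume g: "g \<in> G'"
    show "\<exists>h\<in>G' \<inter> G. s' h = s' g \<and> c' h = c' g" using lift[OF B.s[OF g], of "c' g"] by auto
  qed
qed

text \<open>The automorphism of the infinite dihedral group exchanging the two generating reflections.\<close>

lemma dihedral_extension_flip:
  assumes "dihedral_extension G N s c"
  shows "dihedral_extension G N s (\<lambda>g. if s g = 1 then - c g else 1 - c g)"
proof -
  interpret dihedral_extension G N s c by fact
  show ?thesis
  proof
    show "\<exists>t\<in>G. s t = 1 \<and> (if s t = 1 then - c t else 1 - c t) = 1"
      using onto[of "-1"] by force
    show "(\<exists>r\<in>G. s r = -1 \<and> (if s r = 1 then - c r else 1 - c r) = 0) \<or> (\<forall>g\<in>G. s g = 1)"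
    proof (cases "\<forall>g\<in>G. s g = 1")
      case False
      then obtain g where "g \<in> G" "s g = -1" using s by blast
      then obtain r where "r \<in> G" "s r = -1" "c r = 1" using onto_reflection[of g 1] by auto
      then show ?thesis by (intro disjI1 bexI[of _ r]) simp_all
    qed simp
    fix g h assume gh: "g \<in> G" "h \<in> G"
    show "(if s (g \<circ> h) = 1 then - c (g \<circ> h) else 1 - c (g \<circ> h)) =
        s g * (if s h = 1 then - c h else 1 - c h) + (if s g = 1 then - c g else 1 - c g)"
      using s[OF gh(1)] s[OF gh(2)] by (auto simp: s_comp[OF gh] c_comp[OF gh])
  qed (use G s s_comp N_def in auto)
qed

text \<open>
  \<open>(e\<^sub>1, a\<^sub>1)\<close> and \<open>(e\<^sub>2, a\<^sub>2)\<close> are the sign and parity in the first coordinate of lifts of the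
  generating reflections \<open>-y\<close> and \<open>1 - y\<close> of the base. If the base is a circle, only the product of the two
  occurs in the group.
\<close>

definition cell :: "bool \<Rightarrow> bool \<Rightarrow> bool \<Rightarrow> bool \<Rightarrow> bool \<Rightarrow> bool \<Rightarrow> bool \<Rightarrow> bool \<Rightarrow> bool \<Rightarrow> bool \<Rightarrow> bool" where
  "cell f b e1 a1 e2 a2 e a d n \<longleftrightarrow> (d \<longrightarrow> b) \<and>
     (f \<or> e = ((n \<and> e1 \<noteq> e2) \<noteq> (d \<and> e1))) \<and> a = ((n \<and> a1 \<noteq> a2) \<noteq> (d \<and> a1))"

text \<open>Over the field with two elements \<open>cell\<close> is the graph of a linear map from
  \<open>(d, n)\<close> to \<open>(e, a)\<close>, with \<open>d\<close> set to 0 unless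
  \<open>b\<close> holds and with \<open>e\<close> left free if \<open>f\<close> holds. At (1, 0)
  the map gives the first reflection, at (1, 1) the second, at (0, 1) their product.\<close>

lemma pattern_cell: "pattern (cell f b e1 a1 e2 a2) f b"
proof
  fix e a d n e' a' d' n'
  assume "cell f b e1 a1 e2 a2 e a d n" "cell f b e1 a1 e2 a2 e' a' d' n'"
  then show "cell f b e1 a1 e2 a2 (e \<noteq> e') (a \<noteq> a') (d \<noteq> d') (n \<noteq> n')"
    unfolding cell_def by argo
qed (auto simp: cell_def)

type_synonym code = "bool \<times> bool \<times> bool \<times> bool \<times> bool \<times> bool"

fun model :: "code \<Rightarrow> fibration" where
  "model (f, b, e1, a1, e2, a2) = (pattern_group (cell f b e1 a1 e2 a2), pattern_fiber f)"

text \<open>The lift of \<open>y + 1\<close> keeps or reverses the orientation of the circle fiber: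
  torus and Klein bottle.\<close>

definition paren_dot_codes :: "code set" where
  "paren_dot_codes = {False} \<times> {False} \<times>
     {(False, False, False, False), (False, False, True, False)}"

text \<open>The lift of \<open>y + 1\<close> keeps or exchanges the two ends of the interval fiber:
  annulus and Moebius band.\<close>

definition bracket_dot_codes :: "code set" where
  "bracket_dot_codes = {True} \<times> {False} \<times>
     {(False, False, False, False), (False, False, False, True)}"

text \<open>Each of the two reflections of the base lifts to a map that keeps or exchanges the ends
  of the interval fiber; the entries are the unordered pairs of these two kinds.\<close>

definition bracket_dash_codes :: "code set" where
  "bracket_dash_codes = {True} \<times> {True} \<times>
     {(False, False, False, False), (False, False, False, True),
      (False, True, False, True)}"

text \<open>Over a circle fiber a reflection of the base lifts to a mirror reflection, a glide
  reflection or a half turn; the entries are the six unordered pairs of these three kinds.\<close>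

definition paren_dash_codes :: "code set" where
  "paren_dash_codes = {False} \<times> {True} \<times>
     {(False, False, False, False), (False, False, False, True),
      (False, True, False, True), (False, False, True, False),
      (False, True, True, False), (True, False, True, False)}"

definition codes :: "code set" where
  "codes = paren_dot_codes \<union> bracket_dot_codes \<union> bracket_dash_codes \<union> paren_dash_codes"

text \<open>Such a map commutes with horizontal translations. A nonzero shear or horizontal shift
  does not commute with a reflection of the fiber, hence the second hypothesis.\<close>

lemma conjugate_fiber:
  assumes "q \<noteq> 0" "f \<Longrightarrow> k = 0 \<and> d = 0"
  shows "conjugate (tri 1 k d q w) (pattern_fiber f) = pattern_fiber f"
proof -
  have b: "bij (tri 1 k d q w)" using assms(1) by (intro tri_inverse) auto
  have "tri 1 k d q w \<circ> n \<circ> fun_inv (tri 1 k d q w) = n" if n: "n \<in> pattern_fiber f" for n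
  proof -
    obtain e A where "e \<longrightarrow> f" "n = tri (sg e) 0 (of_int A) 1 0" using n by (auto simp: pattern_fiber_def)
    then have "tri 1 k d q w \<circ> n = n \<circ> tri 1 k d q w"
      using assms(2) by (auto simp: tri_comp tri_eq_iff sg_def)
    then show ?thesis using bij_inv_simps[OF b] by (simp add: fun_eq_iff)
  qed
  then show ?thesis unfolding conjugate_def by force
qed

lemma of_bool_int: "of_bool a = real_of_int (of_bool a)" "odd (of_bool a :: int) = a"
  by (cases a; simp)+

text \<open>Reduces the conjugacy of groups to the normalization of a single generator: by
  \<open>eq_if_common_translation\<close>, \<open>N\<close> and the image of \<open>t\<close>
  determine the conjugated group.\<close>

lemma conjugate_to_circle_model:
  assumes de: "dihedral_extension G (pattern_fiber f) s c" and triv: "\<And>g. g \<in> G \<Longrightarrow> s g = 1"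
    and t: "t \<in> G" "c t = 1" and \<phi>: "\<phi> = tri 1 k d q w" "q \<noteq> 0" "f \<Longrightarrow> k = 0 \<and> d = 0"
    and t': "\<phi> \<circ> t = tri (sg e) 0 (of_bool a) 1 1 \<circ> \<phi>"
  shows "affinely_conjugate (G, pattern_fiber f) (model (f, False, False, False, e, a))"
proof -
  let ?H = "cell f False False False e a"
  interpret P: pattern ?H f False by (rule pattern_cell)
  have aff: "affinity \<phi>" unfolding \<phi>(1) using \<phi>(2) by (intro affinity_tri) auto
  have b: "bij \<phi>" by (rule affinity_bij[OF aff])
  have N: "conjugate \<phi> (pattern_fiber f) = pattern_fiber f" unfolding \<phi>(1) by (rule conjugate_fiber[OF \<phi>(2,3)])
  have unconj: "fun_inv \<phi> \<circ> (\<phi> \<circ> g \<circ> fun_inv \<phi>) \<circ> \<phi> = g" for g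
    using b by (simp add: fun_eq_iff bij_inv_simps)
  have t'': "\<phi> \<circ> t \<circ> fun_inv \<phi> = tri (sg e) 0 (of_bool a) 1 1"
    unfolding t' using bij_inv_simps[OF b] by (simp add: fun_eq_iff)
  have "?H e (odd (of_bool a :: int)) False (odd (1::int))" by (auto simp: cell_def of_bool_int)
  from P.pattern_groupI[OF this] have mem: "tri (sg e) 0 (of_bool a) 1 1 \<in> pattern_group ?H" by simp
  have "conjugate \<phi> G = pattern_group ?H"
  proof (rule eq_if_common_translation[OF dihedral_extension_conjugate[OF b de, unfolded N] P.dihedral_extension_pattern])
    show "s (fun_inv \<phi> \<circ> g \<circ> \<phi>) = 1" if "g \<in> conjugate \<phi> G" for g
      using triv that in_conjugate_iff[OF b] by blast
    show "line_sign g = 1" if "g \<in> pattern_group ?H" for g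
      using that P.H_base by (auto elim!: P.pattern_groupE)
    show "tri (sg e) 0 (of_bool a) 1 1 \<in> conjugate \<phi> G"
      unfolding t''[symmetric] conjugate_def using t(1) by blast
    show "c (fun_inv \<phi> \<circ> tri (sg e) 0 (of_bool a) 1 1 \<circ> \<phi>) = 1"
      unfolding t''[symmetric] unconj by (rule t(2))
  qed (use mem in simp_all)
  then show ?thesis unfolding affinely_conjugate_def using aff N by auto
qed

lemma conjugate_to_interval_model:
  assumes de: "dihedral_extension G (pattern_fiber f) s c"
    and r1: "r1 \<in> G" "s r1 = -1" "c r1 = 0" and r2: "r2 \<in> G" "s r2 = -1" "c r2 = 1"
    and \<phi>: "\<phi> = tri 1 k d q w" "q \<noteq> 0" "f \<Longrightarrow> k = 0 \<and> d = 0"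
    and r1': "\<phi> \<circ> r1 = tri (sg e1) 0 (of_bool a1) (-1) 0 \<circ> \<phi>"
    and r2': "\<phi> \<circ> r2 = tri (sg e2) 0 (of_bool a2) (-1) 1 \<circ> \<phi>"
  shows "affinely_conjugate (G, pattern_fiber f) (model (f, True, e1, a1, e2, a2))"
proof -
  let ?H = "cell f True e1 a1 e2 a2"
  let ?r1 = "tri (sg e1) 0 (of_bool a1) (-1) 0" and ?r2 = "tri (sg e2) 0 (of_bool a2) (-1) 1"
  interpret P: pattern ?H f True by (rule pattern_cell)
  have aff: "affinity \<phi>" unfolding \<phi>(1) using \<phi>(2) by (intro affinity_tri) auto
  have b: "bij \<phi>" by (rule affinity_bij[OF aff])
  have N: "conjugate \<phi> (pattern_fiber f) = pattern_fiber f" unfolding \<phi>(1) by (rule conjugate_fiber[OF \<phi>(2,3)])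
  have unconj: "fun_inv \<phi> \<circ> (\<phi> \<circ> g \<circ> fun_inv \<phi>) \<circ> \<phi> = g" for g
    using b by (simp add: fun_eq_iff bij_inv_simps)
  have r'': "\<phi> \<circ> r1 \<circ> fun_inv \<phi> = ?r1" "\<phi> \<circ> r2 \<circ> fun_inv \<phi> = ?r2"
    unfolding r1' r2' using bij_inv_simps[OF b] by (simp_all add: fun_eq_iff)
  have "?H e1 (odd (of_bool a1 :: int)) True (odd (0::int))" by (auto simp: cell_def of_bool_int)
  from P.pattern_groupI[OF this] have m1: "?r1 \<in> pattern_group ?H" by simp
  have "?H e2 (odd (of_bool a2 :: int)) True (odd (1::int))" by (auto simp: cell_def of_bool_int)
  from P.pattern_groupI[OF this] have m2: "?r2 \<in> pattern_group ?H" by simp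
  have mem: "?r1 \<in> conjugate \<phi> G" "?r2 \<in> conjugate \<phi> G"
    unfolding r''[symmetric] conjugate_def using r1(1) r2(1) by blast+
  have sc: "s (fun_inv \<phi> \<circ> ?r1 \<circ> \<phi>) = -1" "c (fun_inv \<phi> \<circ> ?r1 \<circ> \<phi>) = 0"
    "s (fun_inv \<phi> \<circ> ?r2 \<circ> \<phi>) = -1" "c (fun_inv \<phi> \<circ> ?r2 \<circ> \<phi>) = 1"
    unfolding r''[symmetric] unconj using r1 r2 by auto
  have "conjugate \<phi> G = pattern_group ?H"
    by (rule eq_if_common_reflections[OF dihedral_extension_conjugate[OF b de, unfolded N]
          P.dihedral_extension_pattern, of ?r1 ?r2])
      (fact mem m1 m2 sc | simp)+
  then show ?thesis unfolding affinely_conjugate_def using aff N by auto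
qed

section \<open>Reduction of the generators to normal form\<close>

locale normalized_extension = dihedral_extension G "pattern_fiber f" s c for G f s c +
  assumes normal_form: "g \<in> G \<Longrightarrow> \<exists>e \<alpha>. g = tri (sg e) 0 \<alpha> (of_int (s g)) (of_int (c g))"
begin

lemma N_mult:
  assumes "n \<in> pattern_fiber f" "g \<in> G"
  shows "n \<circ> g \<in> G" "s (n \<circ> g) = s g" "c (n \<circ> g) = c g"
    and "g \<circ> n \<in> G" "s (g \<circ> n) = s g" "c (g \<circ> n) = c g"
  using assms by (auto simp: N_def G_comp s_comp c_comp)

text \<open>Composition with an even translation of \<open>N\<close> leaves only the parity of
  \<alpha>. The integrality hypothesis is doubled because membership of a translation by
  \<open>2 * \<alpha>\<close> in \<open>N\<close> delivers it in this form.\<close>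

lemma reduce_parity:
  assumes g: "tri (sg e) 0 \<alpha> \<sigma> \<beta> \<in> G" and int: "2 * \<alpha> = of_int (2 * m)"
  shows "\<exists>g\<in>G. g = tri (sg e) 0 (of_bool (odd m)) \<sigma> \<beta> \<and>
    s g = s (tri (sg e) 0 \<alpha> \<sigma> \<beta>) \<and> c g = c (tri (sg e) 0 \<alpha> \<sigma> \<beta>)"
proof -
  let ?n = "tri (sg False) 0 (of_int (of_bool (odd m) - m)) 1 0"
  have "even (of_bool (odd m) - m)" by (cases "odd m") auto
  then have n: "?n \<in> pattern_fiber f" unfolding pattern_fiber_def by blast
  have "?n \<circ> tri (sg e) 0 \<alpha> \<sigma> \<beta> = tri (sg e) 0 (of_bool (odd m)) \<sigma> \<beta>"
    using int by (simp add: tri_comp tri_eq_iff)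
  from N_mult(1-3)[OF n g, unfolded this] show ?thesis by blast
qed

text \<open>The reflection \<open>?r\<close> in \<open>N\<close> absorbs the sign \<open>e\<close>.
  Conjugating \<open>?r\<close> by the resulting lift gives a reflection in \<open>N\<close> with
  offset \<open>2 * \<alpha>\<close>, so \<alpha> is an integer and can be reduced to its
  parity.\<close>

lemma bracket_lift:
  assumes f and g: "g \<in> G"
  shows "\<exists>a h. h \<in> G \<and> s h = s g \<and> c h = c g \<and> h = tri 1 0 (of_bool a) (of_int (s g)) (of_int (c g))"
proof -
  let ?r = "tri (- 1) 0 0 1 0"
  have "?r = tri (sg True) 0 (of_int 0) 1 0" "even (0::int)" by auto
  then have r: "?r \<in> pattern_fiber f" using \<open>f\<close> unfolding pattern_fiber_def by blast
  obtain e \<alpha> where ge: "g = tri (sg e) 0 \<alpha> (of_int (s g)) (of_int (c g))" using normal_form[OF g] by blast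
  have "\<exists>h. h \<in> G \<and> s h = s g \<and> c h = c g \<and> h = tri 1 0 \<alpha> (of_int (s g)) (of_int (c g))"
  proof (cases e)
    case False
    then have "g = tri 1 0 \<alpha> (of_int (s g)) (of_int (c g))" using ge by (metis sg_simps(2))
    then show ?thesis using g by blast
  next
    case True
    have "tri (sg e) 0 \<alpha> (of_int (s g)) (of_int (c g)) \<circ> ?r = tri 1 0 \<alpha> (of_int (s g)) (of_int (c g))"
      using True by (simp add: tri_comp)
    then have "g \<circ> ?r = tri 1 0 \<alpha> (of_int (s g)) (of_int (c g))" using ge by metis
    from N_mult(4-6)[OF r g, unfolded this] show ?thesis by blast
  qed
  then obtain h where h: "h \<in> G" "s h = s g" "c h = c g" "h = tri 1 0 \<alpha> (of_int (s g)) (of_int (c g))" by blast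
  have "h \<circ> ?r = tri (- 1) 0 (2 * \<alpha>) 1 0 \<circ> h"
    unfolding h(4) by (simp add: tri_comp)
  then have "h \<circ> ?r \<circ> fun_inv h = tri (- 1) 0 (2 * \<alpha>) 1 0"
    using G_inv_r[OF h(1)] by (simp add: o_assoc[symmetric])
  then have "tri (- 1) 0 (2 * \<alpha>) 1 0 \<in> pattern_fiber f" using N_normal[OF h(1) r] by simp
  then obtain m where "2 * \<alpha> = of_int (2 * m)" by (auto simp: pattern_fiber_def tri_eq_iff elim!: evenE)
  then show ?thesis
    using reduce_parity[of False \<alpha> "of_int (s g)" "of_int (c g)" m] h by (metis sg_simps(2))
qed

text \<open>If the fiber orientation is kept, the square of the lift is a translation in
  \<open>N\<close> by \<open>2 * \<alpha>\<close>, so \<alpha> is an integer. Otherwise the lift is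
  a half turn, its \<alpha> is arbitrary, and it is left to the later choice of coordinates.\<close>

lemma reflection_lift:
  assumes g: "g \<in> G" "s g = -1"
  shows "\<exists>e \<alpha> h a. h \<in> G \<and> s h = -1 \<and> c h = c g \<and> h = tri (sg e) 0 \<alpha> (-1) (of_int (c g)) \<and>
    (\<not> e \<longrightarrow> \<alpha> = of_bool a) \<and> (e \<longrightarrow> \<not> a)"
proof -
  obtain e \<alpha> where "g = tri (sg e) 0 \<alpha> (of_int (s g)) (of_int (c g))" using normal_form[OF g(1)] by blast
  then have ge: "g = tri (sg e) 0 \<alpha> (-1) (of_int (c g))" using g(2) by (metis of_int_1 of_int_minus)
  show ?thesis
  proof (cases e)
    case True
    then show ?thesis using ge g by (intro exI[of _ e] exI[of _ \<alpha>] exI[of _ g] exI[of _ False]) simp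
  next
    case False
    have "tri 1 0 \<alpha> (-1) (of_int (c g)) \<circ> tri 1 0 \<alpha> (-1) (of_int (c g)) = tri 1 0 (2 * \<alpha>) 1 0"
      by (simp add: tri_comp)
    then have "g \<circ> g = tri 1 0 (2 * \<alpha>) 1 0" using ge False by (metis sg_simps(2))
    moreover have "g \<circ> g \<in> pattern_fiber f" using g by (simp add: N_def G_comp s_comp c_comp)
    ultimately obtain m where "2 * \<alpha> = of_int (2 * m)"
      by (auto simp: pattern_fiber_def tri_eq_iff elim!: evenE)
    then obtain h where "h \<in> G" "h = tri (sg e) 0 (of_bool (odd m)) (-1) (of_int (c g))" "s h = s g" "c h = c g"
      using reduce_parity[of e \<alpha> "-1" "of_int (c g)" m] ge g(1) by metis
    then show ?thesis using g(2) False by (intro exI[of _ e] exI[of _ "of_bool (odd m)"] exI[of _ h] exI[of _ "odd m"]) simp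
  qed
qed

lemma classify_circle_base:
  assumes triv: "\<And>g. g \<in> G \<Longrightarrow> s g = 1"
  shows "\<exists>x\<in>codes. affinely_conjugate (G, pattern_fiber f) (model x)"
proof -
  obtain t where t: "t \<in> G" "c t = 1" using ex_t by blast
  show ?thesis
  proof (cases f)
    case True
    obtain a h where h: "h \<in> G" "c h = 1" "h = tri 1 0 (of_bool a) 1 1"
      using bracket_lift[OF True t(1)] t triv by auto
    have "affinely_conjugate (G, pattern_fiber f) (model (f, False, False, False, False, a))"
      by (rule conjugate_to_circle_model[OF dihedral_extension_axioms triv h(1,2), of "tri 1 0 0 1 0" 0 0 1 0])
        (simp_all add: h(3) tri_id)
    then show ?thesis by (rule bexI) (use True in \<open>auto simp: codes_def bracket_dot_codes_def\<close>)
  next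
    case False
    obtain e \<alpha> where te: "t = tri (sg e) 0 \<alpha> 1 1" using normal_form[OF t(1)] t triv by auto
    \<comment> \<open>If the orientation of the fiber is reversed, a shift moves the fixed point
      \<open>\<alpha> / 2\<close> to 0; otherwise a shear straightens the translation to a vertical
      one.\<close>
    define k d where "k = (if e then 0 else - \<alpha>)" and "d = (if e then - \<alpha> / 2 else 0)"
    have "affinely_conjugate (G, pattern_fiber f) (model (f, False, False, False, e, False))"
      by (rule conjugate_to_circle_model[OF dihedral_extension_axioms triv t, of "tri 1 k d 1 0" k d 1 0])
        (use False in \<open>auto simp: te k_def d_def tri_comp tri_eq_iff sg_def field_simps\<close>)
    then show ?thesis by (rule bexI) (use False in \<open>auto simp: codes_def paren_dot_codes_def\<close>)
  qed
qed

lemma classify_interval_base: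
  assumes "r \<in> G" "s r = -1"
  shows "\<exists>x\<in>codes. affinely_conjugate (G, pattern_fiber f) (model x)"
proof -
  obtain q1 q2 where q: "q1 \<in> G" "s q1 = -1" "c q1 = 0" "q2 \<in> G" "s q2 = -1" "c q2 = 1"
    using onto_reflection[OF assms, of 0] onto_reflection[OF assms, of 1] by blast
  \<comment> \<open>On the base this is \<open>1/2 - y\<close>, which exchanges the fixed points 0
    and 1/2 of the two generating reflections. It serves to put an unordered pair of lifts into the
    order used by the codes.\<close>
  let ?flip = "\<lambda>d. tri 1 0 d (-1) (1/2)"
  note flip = conjugate_to_interval_model[OF dihedral_extension_flip[OF dihedral_extension_axioms]]
  show ?thesis
  proof (cases f)
    case True
    obtain a1 r1 where r1: "r1 \<in> G" "s r1 = -1" "c r1 = 0" "r1 = tri 1 0 (of_bool a1) (-1) 0"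
      using bracket_lift[OF True q(1)] q by auto
    obtain a2 r2 where r2: "r2 \<in> G" "s r2 = -1" "c r2 = 1" "r2 = tri 1 0 (of_bool a2) (-1) 1"
      using bracket_lift[OF True q(4)] q by auto
    show ?thesis
    proof (cases "a1 \<longrightarrow> a2")
      case a: True
      have "affinely_conjugate (G, pattern_fiber f) (model (f, True, False, a1, False, a2))"
        by (rule conjugate_to_interval_model[OF dihedral_extension_axioms, of r1 r2 "tri 1 0 0 1 0" 0 0 1 0])
          (fact r1(1-3) r2(1-3) | simp add: r1(4) r2(4) tri_id)+
      then show ?thesis by (rule bexI) (use True a in \<open>auto simp: codes_def bracket_dash_codes_def\<close>)
    next
      case a: False
      have "affinely_conjugate (G, pattern_fiber f) (model (f, True, False, a2, False, a1))"
        by (rule flip[of r2 r1 "?flip 0" 0 0 "-1" "1/2"])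
          (fact r1(1-3) r2(1-3) | simp add: r1(2,3) r2(2,3) | simp add: r1(4) r2(4) tri_comp)+
      then show ?thesis by (rule bexI) (use True a in \<open>auto simp: codes_def bracket_dash_codes_def\<close>)
    qed
  next
    case False
    obtain e1 \<alpha>1 r1 a1 where r1: "r1 \<in> G" "s r1 = -1" "c r1 = 0" "r1 = tri (sg e1) 0 \<alpha>1 (-1) 0"
      "\<not> e1 \<Longrightarrow> \<alpha>1 = of_bool a1" "e1 \<Longrightarrow> \<not> a1"
      using reflection_lift[OF q(1,2)] q(3) by auto
    obtain e2 \<alpha>2 r2 a2 where r2: "r2 \<in> G" "s r2 = -1" "c r2 = 1" "r2 = tri (sg e2) 0 \<alpha>2 (-1) 1"
      "\<not> e2 \<Longrightarrow> \<alpha>2 = of_bool a2" "e2 \<Longrightarrow> \<not> a2"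
      using reflection_lift[OF q(4,5)] q(6) by auto
    \<comment> \<open>The codes list mirror reflections before glide reflections and both before
      half turns.\<close>
    define swap where "swap \<longleftrightarrow> (e1 \<and> \<not> e2) \<or> (\<not> e1 \<and> \<not> e2 \<and> a1 \<and> \<not> a2)"
    show ?thesis
    proof (cases swap)
      case sw: True
      define d where "d = (if e1 then - \<alpha>1 / 2 else 0)"
      have "affinely_conjugate (G, pattern_fiber f) (model (f, True, e2, a2, e1, a1))"
      proof (rule flip[of r2 r1 "?flip d" 0 d "-1" "1/2"])
        show "?flip d \<circ> r2 = tri (sg e2) 0 (of_bool a2) (-1) 0 \<circ> ?flip d"
          using sw r2(5) by (auto simp: r2(4) swap_def d_def tri_comp tri_eq_iff)
        show "?flip d \<circ> r1 = tri (sg e1) 0 (of_bool a1) (-1) 1 \<circ> ?flip d"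
          using r1(5,6) by (cases e1) (auto simp: r1(4) d_def tri_comp tri_eq_iff)
      qed (fact r1(1-3) r2(1-3) | simp add: r1(2,3) r2(2,3) False)+
      then show ?thesis by (rule bexI) (use False sw r1(6) r2(6) in \<open>auto simp: codes_def paren_dash_codes_def swap_def\<close>)
    next
      case sw: False
      \<comment> \<open>Two half turns have their centers at \<open>(\<alpha>1 / 2, 0)\<close> and
        \<open>(\<alpha>2 / 2, 1/2)\<close>: the shift moves the first onto the vertical axis, and
        the shear then brings the second there. If only \<open>r2\<close> is a half turn, the shift
        by half of \<open>\<alpha>2\<close> suffices, since the other lift commutes with horizontal
        shifts.\<close>
      define k d where "k = (if e1 then \<alpha>1 - \<alpha>2 else 0)"
        and "d = (if e1 then - \<alpha>1 / 2 else if e2 then - \<alpha>2 / 2 else 0)"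
      have "affinely_conjugate (G, pattern_fiber f) (model (f, True, e1, a1, e2, a2))"
      proof (rule conjugate_to_interval_model[OF dihedral_extension_axioms, of r1 r2 "tri 1 k d 1 0" k d 1 0])
        show "tri 1 k d 1 0 \<circ> r1 = tri (sg e1) 0 (of_bool a1) (-1) 0 \<circ> tri 1 k d 1 0"
          using r1(5,6) by (cases e1) (auto simp: r1(4) k_def d_def tri_comp tri_eq_iff)
        show "tri 1 k d 1 0 \<circ> r2 = tri (sg e2) 0 (of_bool a2) (-1) 1 \<circ> tri 1 k d 1 0"
          using r2(5,6) sw by (cases e1; cases e2) (auto simp: r2(4) k_def d_def tri_comp tri_eq_iff swap_def)
      qed (fact r1(1-3) r2(1-3) | simp add: False)+
      then show ?thesis by (rule bexI) (use False sw r1(6) r2(6) in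
        \<open>cases e1; cases a1; cases e2; cases a2; simp add: codes_def paren_dash_codes_def swap_def\<close>)
    qed
  qed
qed

lemma classify: "\<exists>x\<in>codes. affinely_conjugate (G, pattern_fiber f) (model x)"
  using classify_circle_base classify_interval_base s by metis

end

lemma conjugate_to_model:
  assumes "F \<in> seifert_fibrations"
  shows "\<exists>x\<in>codes. affinely_conjugate F (model x)"
proof -
  obtain G N where F: "F = (G, N)" by (cases F)
  obtain \<phi> s c f where \<phi>: "affinity \<phi>" and de: "dihedral_extension (conjugate \<phi> G) (conjugate \<phi> N) s c"
    and N: "conjugate \<phi> N = pattern_fiber f"
    and form: "\<And>g. g \<in> conjugate \<phi> G \<Longrightarrow> \<exists>e \<alpha>. g = tri (sg e) 0 \<alpha> (of_int (s g)) (of_int (c g))"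
    using normal_coordinates[of G N] assms unfolding F by metis
  interpret normalized_extension "conjugate \<phi> G" f s c
    using de form unfolding N normalized_extension_def normalized_extension_axioms_def by blast
  obtain x where x: "x \<in> codes" "affinely_conjugate (conjugate \<phi> G, pattern_fiber f) (model x)"
    using classify by blast
  moreover have "affinely_conjugate F (conjugate \<phi> G, pattern_fiber f)"
    unfolding affinely_conjugate_def F using \<phi> N by auto
  ultimately show ?thesis using affinely_conjugate_trans by blast
qed

section \<open>Distinguishing the models\<close>

text \<open>
  An isomorphism invariant of \<open>(G, N)\<close> that separates the models. Its first two entries determine the type.
  The next three record the kinds of lifts of a reflection of the base: with trivial action on the translations of \<open>N\<close>
  and square in the squares of \<open>N\<close>, with trivial action and another square, with nontrivial action. The last two tell the
  torus from the Klein bottle, and the annulus from the Moebius band.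
\<close>

definition centralizes_squares :: "('a \<Rightarrow> 'a) set \<Rightarrow> ('a \<Rightarrow> 'a) \<Rightarrow> bool" where
  "centralizes_squares N g \<longleftrightarrow> (\<forall>u\<in>N. g \<circ> (u \<circ> u) = u \<circ> u \<circ> g)"

definition quotient_involutions :: "('a \<Rightarrow> 'a) set \<Rightarrow> ('a \<Rightarrow> 'a) set \<Rightarrow> ('a \<Rightarrow> 'a) set" where
  "quotient_involutions G N = {g \<in> G. g \<notin> N \<and> g \<circ> g \<in> N}"

definition square_in :: "('a \<Rightarrow> 'a) set \<Rightarrow> ('a \<Rightarrow> 'a) \<Rightarrow> bool" where
  "square_in N g \<longleftrightarrow> (\<exists>h\<in>N. g \<circ> g = h \<circ> h)"

fun signature :: "fibration \<Rightarrow> bool list" where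
  "signature (G, N) =
    [\<exists>g\<in>N. g \<noteq> id \<and> g \<circ> g = id,
     quotient_involutions G N \<noteq> {},
     \<exists>g\<in>quotient_involutions G N. centralizes_squares N g \<and> square_in N g,
     \<exists>g\<in>quotient_involutions G N. centralizes_squares N g \<and> \<not> square_in N g,
     \<exists>g\<in>quotient_involutions G N. \<not> centralizes_squares N g,
     \<exists>g\<in>G. \<not> centralizes_squares N g,
     \<exists>g\<in>G. \<exists>r\<in>N. \<forall>h\<in>N. g \<circ> r \<noteq> h \<circ> h \<circ> r \<circ> g]"

lemma eq_image_if_preimage:
  assumes "\<And>x. k x \<in> A \<longleftrightarrow> x \<in> B" "A \<subseteq> range k" shows "A = k ` B"
  using assms by blast

lemma signature_conjugate:
  assumes b: "bij \<phi>"
  shows "signature (conjugate \<phi> G, conjugate \<phi> N) = signature (G, N)"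
proof -
  let ?k = "\<lambda>g. \<phi> \<circ> g \<circ> fun_inv \<phi>"
  have comp: "?k g \<circ> ?k h = ?k (g \<circ> h)" for g h
    using bij_inv_simps[OF b] by (simp add: fun_eq_iff)
  have eq: "?k g = ?k h \<longleftrightarrow> g = h" for g h
  proof
    assume "?k g = ?k h"
    then have "fun_inv \<phi> \<circ> ?k g \<circ> \<phi> = fun_inv \<phi> \<circ> ?k h \<circ> \<phi>" by simp
    then show "g = h" using bij_inv_simps[OF b] by (simp add: fun_eq_iff)
  qed simp
  have id: "?k g = id \<longleftrightarrow> g = id" for g
    using eq[of g id] bij_inv_simps[OF b] by simp
  have "inj ?k" by (rule injI) (simp only: eq)
  then have mem: "?k g \<in> ?k ` S \<longleftrightarrow> g \<in> S" for g S by (rule inj_image_mem_iff)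
  have cs: "centralizes_squares (?k ` N) (?k g) \<longleftrightarrow> centralizes_squares N g" for g
    unfolding centralizes_squares_def by (simp only: ball_simps comp eq)
  have sq: "square_in (?k ` N) (?k g) \<longleftrightarrow> square_in N g" for g
    unfolding square_in_def by (simp only: bex_simps comp eq)
  have qi: "quotient_involutions (?k ` G) (?k ` N) = ?k ` quotient_involutions G N"
  proof -
    have "?k g \<in> quotient_involutions (?k ` G) (?k ` N) \<longleftrightarrow> g \<in> quotient_involutions G N" for g
      unfolding quotient_involutions_def mem_Collect_eq comp mem ..
    moreover have "quotient_involutions (?k ` G) (?k ` N) \<subseteq> range ?k"
      unfolding quotient_involutions_def by fast
    ultimately show ?thesis by (intro eq_image_if_preimage)
  qed
  have "(\<exists>g\<in>?k ` N. g \<noteq> id \<and> g \<circ> g = id) \<longleftrightarrow> (\<exists>g\<in>N. g \<noteq> id \<and> g \<circ> g = id)"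
    by (simp only: bex_simps comp id)
  moreover have "(\<exists>g\<in>?k ` G. \<exists>r\<in>?k ` N. \<forall>h\<in>?k ` N. g \<circ> r \<noteq> h \<circ> h \<circ> r \<circ> g) \<longleftrightarrow>
      (\<exists>g\<in>G. \<exists>r\<in>N. \<forall>h\<in>N. g \<circ> r \<noteq> h \<circ> h \<circ> r \<circ> g)"
    by (simp only: bex_simps ball_simps comp eq)
  ultimately show ?thesis
    unfolding conjugate_def signature.simps qi by (simp only: bex_simps cs sq image_is_empty)
qed

lemma signature_if_affinely_conjugate:
  assumes "affinely_conjugate F1 F2" shows "signature F1 = signature F2"
proof -
  obtain \<phi> where "affinity \<phi>" "conjugate \<phi> (fst F1) = fst F2" "conjugate \<phi> (snd F1) = snd F2"
    using assms unfolding affinely_conjugate_def by blast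
  then show ?thesis using signature_conjugate[OF affinity_bij, of \<phi> "fst F1" "snd F1"] by simp
qed

context pattern
begin

lemma even_translation_in_fiber: "even A \<Longrightarrow> tri 1 0 (of_int A) 1 0 \<in> pattern_fiber f"
  unfolding pattern_fiber_def by (intro CollectI exI[of _ False] exI[of _ A]) simp

lemma fiberE:
  assumes "u \<in> pattern_fiber f"
  obtains e B where "e \<longrightarrow> f" "u = tri (sg e) 0 (of_int (2 * B)) 1 0"
proof -
  obtain e A where u: "even A" "e \<longrightarrow> f" "u = tri (sg e) 0 (of_int A) 1 0"
    using assms unfolding pattern_fiber_def by blast
  then obtain B where "A = 2 * B" by (elim evenE)
  then show thesis using that u(2,3) by blast
qed

lemma fiber_square:
  "tri (sg e) 0 (of_int (2 * B)) 1 0 \<circ> tri (sg e) 0 (of_int (2 * B)) 1 0 =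
    tri 1 0 (of_int (if e then 0 else 4 * B)) 1 0"
  by (simp add: tri_comp tri_eq_iff)

text \<open>The involutions of the infinite dihedral group are its reflections, since its nontrivial
  translations have infinite order.\<close>

lemma quotient_involution_iff:
  assumes "H e (odd A) d (odd M)"
  shows "tri (sg e) 0 (of_int A) (sg d) (of_int M) \<in> quotient_involutions (pattern_group H) (pattern_fiber f) \<longleftrightarrow> d"
proof -
  let ?g = "tri (sg e) 0 (of_int A) (sg d) (of_int M)"
  have G: "?g \<in> pattern_group H" using pattern_groupI[OF assms] .
  have sq: "?g \<circ> ?g = tri 1 0 (of_int (if e then 0 else 2 * A)) 1 (of_int (if d then 0 else 2 * M))"
    by (simp add: tri_comp tri_eq_iff)
  show ?thesis
  proof (cases d)
    case True
    have "even (if e then 0 else 2 * A)" by simp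
    from even_translation_in_fiber[OF this] have "?g \<circ> ?g \<in> pattern_fiber f" unfolding sq using True by simp
    moreover have "?g \<notin> pattern_fiber f" using True by (auto simp: pattern_fiber_def tri_eq_iff)
    ultimately show ?thesis using G True by (simp add: quotient_involutions_def)
  next
    case False
    have "?g \<in> pattern_fiber f" if "?g \<circ> ?g \<in> pattern_fiber f"
    proof -
      have "M = 0" using that False unfolding sq by (auto simp: pattern_fiber_def tri_eq_iff)
      then have "even A" "e \<longrightarrow> f" using assms H_fiber False by auto
      then show ?thesis unfolding pattern_fiber_def using \<open>M = 0\<close> False by auto
    qed
    then show ?thesis using False by (auto simp: quotient_involutions_def)
  qed
qed

text \<open>Reflections in \<open>N\<close> have trivial square, so the squares of \<open>N\<close>
  are the translations by multiples of 4. Commuting with these means keeping the orientation of the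
  fibers, whether or not \<open>N\<close> contains reflections.\<close>

lemma centralizes_squares_iff:
  "centralizes_squares (pattern_fiber f) (tri (sg e) 0 (of_int A) (sg d) (of_int M)) \<longleftrightarrow> \<not> e"
proof
  let ?g = "tri (sg e) 0 (of_int A) (sg d) (of_int M)"
  assume "centralizes_squares (pattern_fiber f) ?g"
  then have "?g \<circ> (tri 1 0 (of_int 2) 1 0 \<circ> tri 1 0 (of_int 2) 1 0) = tri 1 0 (of_int 2) 1 0 \<circ> tri 1 0 (of_int 2) 1 0 \<circ> ?g"
    using even_translation_in_fiber[of 2] unfolding centralizes_squares_def by simp
  then show "\<not> e" by (simp add: tri_comp tri_eq_iff sg_def split: if_splits)
next
  assume e: "\<not> e"
  show "centralizes_squares (pattern_fiber f) (tri (sg e) 0 (of_int A) (sg d) (of_int M))"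
    unfolding centralizes_squares_def
  proof
    fix u assume "u \<in> pattern_fiber f"
    then obtain e' B where "u = tri (sg e') 0 (of_int (2 * B)) 1 0" by (elim fiberE)
    then have "u \<circ> u = tri 1 0 (of_int (if e' then 0 else 4 * B)) 1 0" by (simp only: fiber_square)
    then show "tri (sg e) 0 (of_int A) (sg d) (of_int M) \<circ> (u \<circ> u) = u \<circ> u \<circ> tri (sg e) 0 (of_int A) (sg d) (of_int M)"
      using e by (simp add: tri_comp tri_eq_iff)
  qed
qed

text \<open>The square is the translation by \<open>2 * A\<close>, and the squares of
  \<open>N\<close> are the translations by multiples of 4.\<close>

lemma square_in_fiber_iff:
  "square_in (pattern_fiber f) (tri 1 0 (of_int A) (- 1) (of_int M)) \<longleftrightarrow> even A"
proof
  let ?g = "tri 1 0 (of_int A) (- 1) (of_int M)"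
  have sq: "?g \<circ> ?g = tri 1 0 (of_int (2 * A)) 1 0" by (simp add: tri_comp tri_eq_iff)
  {
    assume "square_in (pattern_fiber f) ?g"
    then obtain u where "u \<in> pattern_fiber f" "?g \<circ> ?g = u \<circ> u" unfolding square_in_def by blast
    then obtain e' B where "tri 1 0 (of_int (2 * A)) 1 0 = tri 1 0 (of_int (if e' then 0 else 4 * B)) 1 0"
      unfolding sq by (metis fiberE fiber_square)
    then have "real_of_int (2 * A) = real_of_int (if e' then 0 else 4 * B)" by (simp only: tri_eq_iff)
    then have "2 * A = (if e' then 0 else 4 * B)" by (simp only: of_int_eq_iff)
    then show "even A" by (cases e') auto
  next
    assume "even A"
    then have "tri 1 0 (of_int A) 1 0 \<in> pattern_fiber f" by (rule even_translation_in_fiber)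
    moreover have "?g \<circ> ?g = tri 1 0 (of_int A) 1 0 \<circ> tri 1 0 (of_int A) 1 0"
      by (simp add: tri_comp)
    ultimately show "square_in (pattern_fiber f) ?g" unfolding square_in_def by blast
  }
qed

lemma ex_involution_iff:
  "(\<exists>g\<in>quotient_involutions (pattern_group H) (pattern_fiber f). P g) \<longleftrightarrow>
    (\<exists>e A M. H e (odd A) True (odd M) \<and> P (tri (sg e) 0 (of_int A) (- 1) (of_int M)))"
proof
  assume "\<exists>g\<in>quotient_involutions (pattern_group H) (pattern_fiber f). P g"
  then obtain g where g: "g \<in> quotient_involutions (pattern_group H) (pattern_fiber f)" "P g" by blast
  then obtain e A d M where h: "g = tri (sg e) 0 (of_int A) (sg d) (of_int M)" "H e (odd A) d (odd M)"
    by (auto simp: quotient_involutions_def elim: pattern_groupE)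
  then have d using quotient_involution_iff g(1) by simp
  then show "\<exists>e A M. H e (odd A) True (odd M) \<and> P (tri (sg e) 0 (of_int A) (- 1) (of_int M))"
    using g(2) h by auto
next
  assume "\<exists>e A M. H e (odd A) True (odd M) \<and> P (tri (sg e) 0 (of_int A) (- 1) (of_int M))"
  then obtain e A M where h: "H e (odd A) True (odd M)" "P (tri (sg e) 0 (of_int A) (- 1) (of_int M))" by blast
  then show "\<exists>g\<in>quotient_involutions (pattern_group H) (pattern_fiber f). P g"
    using quotient_involution_iff[OF h(1)] by auto
qed

lemma ex_parity: "(\<exists>A::int. P (odd A)) \<longleftrightarrow> (\<exists>a. P a)"
proof
  assume "\<exists>a. P a"
  then obtain a where "P a" by blast
  then have "P (odd (of_bool a :: int))" by (simp add: of_bool_int)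
  then show "\<exists>A::int. P (odd A)" by blast
qed blast

lemma ex_parity2: "(\<exists>A M. P (odd (A::int)) (odd (M::int))) \<longleftrightarrow> (\<exists>a n. P a n)"
  using ex_parity[of "\<lambda>a. \<exists>M::int. P a (odd M)"] ex_parity[of "P _"] by auto

lemma signature_pattern:
  "signature (pattern_group H, pattern_fiber f) =
    [f, b, \<exists>n. H False False True n, \<exists>n. H False True True n, \<exists>a n. H True a True n,
     \<exists>a d n. H True a d n, f \<and> (\<exists>e d n. H e True d n)]"
proof -
  let ?G = "pattern_group H" and ?N = "pattern_fiber f"
  let ?R = "quotient_involutions ?G ?N"
  have 1: "(\<exists>g\<in>?N. g \<noteq> id \<and> g \<circ> g = id) \<longleftrightarrow> f"
  proof
    assume "\<exists>g\<in>?N. g \<noteq> id \<and> g \<circ> g = id"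
    then obtain g where g: "g \<in> ?N" "g \<noteq> id" "g \<circ> g = id" by blast
    obtain e B where eB: "e \<longrightarrow> f" "g = tri (sg e) 0 (of_int (2 * B)) 1 0" using g(1) by (rule fiberE)
    have "tri 1 0 (of_int (if e then 0 else 4 * B)) 1 0 = tri 1 0 0 1 0"
      using g(3) unfolding eB(2) fiber_square tri_id .
    then have "e \<or> B = 0" by (simp add: tri_eq_iff split: if_splits)
    moreover have "\<not> (\<not> e \<and> B = 0)" using g(2) by (auto simp: eB(2) tri_id)
    ultimately show f using eB(1) by blast
  next
    assume f
    have "tri (sg True) 0 (of_int 0) 1 0 \<in> ?N" using \<open>f\<close> unfolding pattern_fiber_def by fastforce
    moreover have "tri (sg True) 0 (of_int 0) 1 0 \<noteq> id"
      unfolding tri_id[symmetric] tri_eq_iff by simp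
    moreover have "tri (sg True) 0 (of_int 0) 1 0 \<circ> tri (sg True) 0 (of_int 0) 1 0 = id"
      unfolding tri_comp tri_id[symmetric] tri_eq_iff by simp
    ultimately show "\<exists>g\<in>?N. g \<noteq> id \<and> g \<circ> g = id" by blast
  qed
  have par: "(\<exists>e A M. H e (odd (A::int)) True (odd (M::int)) \<and> Q e (odd A)) \<longleftrightarrow>
      (\<exists>e a n. H e a True n \<and> Q e a)" for Q
    using ex_parity2[of "\<lambda>a n. H e a True n \<and> Q e a" for e] by simp
  have cs: "centralizes_squares ?N (tri (sg e) 0 (of_int A) (- 1) (of_int M)) \<longleftrightarrow> \<not> e" for e A M
    using centralizes_squares_iff[of e A True M] by simp
  have sq: "square_in ?N (tri (sg e) 0 (of_int A) (- 1) (of_int M)) \<longleftrightarrow> even A" if "\<not> e" for e A M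
    using square_in_fiber_iff[of A M] that by simp
  have 2: "?R \<noteq> {} \<longleftrightarrow> b"
  proof -
    have "?R \<noteq> {} \<longleftrightarrow> (\<exists>g\<in>?R. True)" by blast
    also have "\<dots> \<longleftrightarrow> (\<exists>e a n. H e a True n)"
      unfolding ex_involution_iff using par[of "\<lambda>_ _. True"] by simp
    finally show ?thesis using H_base H_reflection by blast
  qed
  have 3: "(\<exists>g\<in>?R. centralizes_squares ?N g \<and> square_in ?N g) \<longleftrightarrow> (\<exists>n. H False False True n)"
  proof -
    have "(\<exists>g\<in>?R. centralizes_squares ?N g \<and> square_in ?N g) \<longleftrightarrow>
        (\<exists>e A M. H e (odd (A::int)) True (odd (M::int)) \<and> \<not> e \<and> \<not> odd A)"
      unfolding ex_involution_iff cs using sq by (intro ex_cong1 conj_cong refl) simp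
    then show ?thesis unfolding par[of "\<lambda>e a. \<not> e \<and> \<not> a"] by (simp add: ex_bool_eq)
  qed
  have 4: "(\<exists>g\<in>?R. centralizes_squares ?N g \<and> \<not> square_in ?N g) \<longleftrightarrow> (\<exists>n. H False True True n)"
  proof -
    have "(\<exists>g\<in>?R. centralizes_squares ?N g \<and> \<not> square_in ?N g) \<longleftrightarrow>
        (\<exists>e A M. H e (odd (A::int)) True (odd (M::int)) \<and> \<not> e \<and> odd A)"
      unfolding ex_involution_iff cs using sq by (intro ex_cong1 conj_cong refl) simp
    then show ?thesis unfolding par[of "\<lambda>e a. \<not> e \<and> a"] by (simp add: ex_bool_eq)
  qed
  have 5: "(\<exists>g\<in>?R. \<not> centralizes_squares ?N g) \<longleftrightarrow> (\<exists>a n. H True a True n)"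
    unfolding ex_involution_iff cs not_not par[of "\<lambda>e a. e"] by (simp add: ex_bool_eq)
  have 6: "(\<exists>g\<in>?G. \<not> centralizes_squares ?N g) \<longleftrightarrow> (\<exists>a d n. H True a d n)"
  proof
    assume "\<exists>g\<in>?G. \<not> centralizes_squares ?N g"
    then obtain g where g: "g \<in> ?G" "\<not> centralizes_squares ?N g" by blast
    obtain e A d M where "g = tri (sg e) 0 (of_int A) (sg d) (of_int M)" "H e (odd A) d (odd M)"
      using g(1) by (rule pattern_groupE)
    then have "H True (odd A) d (odd M)" using g(2) centralizes_squares_iff[of e A d M] by simp
    then show "\<exists>a d n. H True a d n" by blast
  next
    assume "\<exists>a d n. H True a d n"
    then obtain d where "\<exists>a n. H True a d n" by blast
    then obtain A M :: int where "H True (odd A) d (odd M)" using ex_parity2[of "\<lambda>a n. H True a d n"] by blast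
    note G = pattern_groupI[OF this]
    have "\<not> centralizes_squares ?N (tri (sg True) 0 (of_int A) (sg d) (of_int M))"
      unfolding centralizes_squares_iff by simp
    then show "\<exists>g\<in>?G. \<not> centralizes_squares ?N g" using G by (rule bexI)
  qed
  \<comment> \<open>The inequality says that the commutator of \<open>g\<close> and \<open>r\<close>
    is not a square of an element of \<open>N\<close>. If \<open>r\<close> is a translation, the
    commutator is always such a square; if \<open>r\<close> is a reflection, it is a translation
    congruent to \<open>2 * A\<close> modulo 4.\<close>
  have 7: "(\<exists>g\<in>?G. \<exists>r\<in>?N. \<forall>h\<in>?N. g \<circ> r \<noteq> h \<circ> h \<circ> r \<circ> g) \<longleftrightarrow> f \<and> (\<exists>e d n. H e True d n)"
  proof
    assume "\<exists>g\<in>?G. \<exists>r\<in>?N. \<forall>h\<in>?N. g \<circ> r \<noteq> h \<circ> h \<circ> r \<circ> g"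
    then obtain g r where gr: "g \<in> ?G" "r \<in> ?N" "\<And>h. h \<in> ?N \<Longrightarrow> g \<circ> r \<noteq> h \<circ> h \<circ> r \<circ> g" by blast
    obtain e A d M where g: "g = tri (sg e) 0 (of_int A) (sg d) (of_int M)" "H e (odd A) d (odd M)"
      using gr(1) by (rule pattern_groupE)
    obtain e' B where r: "e' \<longrightarrow> f" "r = tri (sg e') 0 (of_int (2 * B)) 1 0" using gr(2) by (rule fiberE)
    have "e' \<and> odd A"
    proof (rule ccontr)
      assume "\<not> (e' \<and> odd A)"
      then have "even (if e' then A else 0)" by simp
      \<comment> \<open>Half of the commutator translation, so that translation by \<open>C\<close>
        is the required square root.\<close>
      moreover define C where "C = (if e' then A else 0) - (if e then 2 * B else 0)"
      ultimately have "even C" by simp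
      then have "tri 1 0 (of_int C) 1 0 \<in> ?N" by (rule even_translation_in_fiber)
      moreover have "g \<circ> r = tri 1 0 (of_int C) 1 0 \<circ> tri 1 0 (of_int C) 1 0 \<circ> r \<circ> g"
        by (simp add: g(1) r(2) tri_comp tri_eq_iff C_def sg_def)
      ultimately show False using gr(3) by blast
    qed
    then show "f \<and> (\<exists>e d n. H e True d n)" using r(1) g(2) by auto
  next
    assume "f \<and> (\<exists>e d n. H e True d n)"
    then obtain e d n where f and n: "H e True d n" by blast
    then have "\<exists>a n. H e a d n \<and> a" by blast
    then obtain A M :: int where AM: "H e (odd A) d (odd M)" "odd A"
      using ex_parity2[of "\<lambda>a n. H e a d n \<and> a"] by blast
    let ?g = "tri (sg e) 0 (of_int A) (sg d) (of_int M)" and ?r = "tri (sg True) 0 (of_int (2 * 0)) 1 0"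
    have "?r \<in> ?N" using \<open>f\<close> unfolding pattern_fiber_def by fastforce
    moreover have "?g \<circ> ?r \<noteq> h \<circ> h \<circ> ?r \<circ> ?g" if h: "h \<in> ?N" for h
    proof
      assume eq: "?g \<circ> ?r = h \<circ> h \<circ> ?r \<circ> ?g"
      obtain e' B where "h = tri (sg e') 0 (of_int (2 * B)) 1 0" using h by (rule fiberE)
      then have "h \<circ> h = tri 1 0 (of_int (if e' then 0 else 4 * B)) 1 0" by (simp only: fiber_square)
      then have "real_of_int (2 * A) = real_of_int (if e' then 0 else 4 * B)"
        using eq by (simp add: tri_comp tri_eq_iff split: if_splits)
      then have "2 * A = (if e' then 0 else 4 * B)" by (simp only: of_int_eq_iff)
      then show False using AM(2) by (cases e') auto
    qed
    ultimately show "\<exists>g\<in>?G. \<exists>r\<in>?N. \<forall>h\<in>?N. g \<circ> r \<noteq> h \<circ> h \<circ> r \<circ> g"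
      by (intro bexI[OF _ pattern_groupI[OF AM(1)]] bexI[of _ ?r] ballI)
  qed
  show ?thesis unfolding signature.simps 1 2 3 4 5 6 7 ..
qed

end

lemma signature_model:
  "signature (model (f, b, e1, a1, e2, a2)) =
    (let H = cell f b e1 a1 e2 a2 in
    [f, b, \<exists>n. H False False True n, \<exists>n. H False True True n, \<exists>a n. H True a True n,
     \<exists>a d n. H True a d n, f \<and> (\<exists>e d n. H e True d n)])"
  unfolding model.simps Let_def by (rule pattern.signature_pattern[OF pattern_cell])

text \<open>An unordered pair is determined by the set of its members, so for an interval base the
  entries recording which kinds of lift occur suffice. For a circle base the last two entries
  decide. The rest is evaluation on thirteen codes.\<close>

lemma models_not_conjugate:
  assumes "x \<in> codes" "y \<in> codes" "affinely_conjugate (model x) (model y)"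
  shows "x = y"
proof -
  have "inj_on (\<lambda>x. signature (model x)) codes"
    unfolding codes_def paren_dot_codes_def bracket_dot_codes_def bracket_dash_codes_def paren_dash_codes_def
    by (simp add: signature_model cell_def ex_bool_eq insert_Times_insert del: signature.simps model.simps)
  then show ?thesis using signature_if_affinely_conjugate[OF assms(3)] assms(1,2) by (auto dest: inj_onD)
qed

text \<open>The coordinate comes from the classification: it is the second coordinate of a conjugate
  model, carried back by the conjugating affinity.\<close>

lemma fibered_plane_seifert:
  assumes "(G, N) \<in> seifert_fibrations"
  shows "\<exists>s c Y. fibered_plane G N s c Y"
proof -
  obtain x where "affinely_conjugate (G, N) (model x)" using conjugate_to_model[OF assms] by blast
  then have "affinely_conjugate (model x) (G, N)" by (rule affinely_conjugate_sym)
  moreover obtain f b e1 a1 e2 a2 where x: "x = (f, b, e1, a1, e2, a2)" by (cases x)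
  ultimately obtain \<phi> where "affinity \<phi>" "conjugate \<phi> (pattern_group (cell f b e1 a1 e2 a2)) = G"
    "conjugate \<phi> (pattern_fiber f) = N" unfolding affinely_conjugate_def by auto
  then show ?thesis
    using fibered_plane_conjugate[OF _ pattern.fibered_plane_pattern[OF pattern_cell]] by blast
qed

lemma affinely_equivalent_iff:
  assumes "F1 \<in> seifert_fibrations" "F2 \<in> seifert_fibrations"
  shows "affinely_equivalent F1 F2 \<longleftrightarrow> affinely_conjugate F1 F2"
proof -
  obtain G1 N1 G2 N2 where F: "F1 = (G1, N1)" "F2 = (G2, N2)" by (cases F1; cases F2)
  then show ?thesis
    using fibered_plane_seifert[of G1 N1] fibered_plane_seifert[of G2 N2] assms
      affinely_equivalent_if_conjugate conjugate_if_affinely_equivalent by metis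
qed

lemma model_seifert: "model x \<in> seifert_fibrations"
proof -
  obtain f b e1 a1 e2 a2 where x: "x = (f, b, e1, a1, e2, a2)" by (cases x)
  show ?thesis unfolding x model.simps by (rule pattern.pattern_seifert[OF pattern_cell])
qed

section \<open>Counting the classes\<close>

lemma equivalence_class:
  assumes "F \<in> seifert_fibrations"
  shows "affine_equivalence `` {F} = {F' \<in> seifert_fibrations. affinely_conjugate F F'}"
proof (intro equalityI subsetI)
  fix F' assume "F' \<in> affine_equivalence `` {F}"
  then have "F' \<in> seifert_fibrations" "affinely_equivalent F F'" by (auto simp: affine_equivalence_def)
  then show "F' \<in> {F' \<in> seifert_fibrations. affinely_conjugate F F'}"
    using affinely_equivalent_iff[OF assms] by blast
next
  fix F' assume "F' \<in> {F' \<in> seifert_fibrations. affinely_conjugate F F'}"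
  then have "F' \<in> seifert_fibrations" "affinely_equivalent F F'"
    using affinely_equivalent_iff[OF assms] by blast+
  then show "F' \<in> affine_equivalence `` {F}" using assms unfolding affine_equivalence_def by blast
qed

text \<open>Sending a code to the class of its model is a bijection from \<open>A\<close> onto the
  quotient. Keeping \<open>A\<close> general gives the total count and the count of each type at
  once.\<close>

lemma card_quotient:
  assumes A: "A \<subseteq> codes" and K: "K = {F \<in> seifert_fibrations. \<exists>x\<in>A. affinely_conjugate F (model x)}"
  shows "card (K // affine_equivalence) = card A"
proof -
  let ?cls = "\<lambda>F. affine_equivalence `` {F}"
  have "K // affine_equivalence = (\<lambda>x. ?cls (model x)) ` A"
  proof (intro equalityI subsetI)
    fix Q assume "Q \<in> K // affine_equivalence"
    then obtain F where F: "F \<in> K" "Q = ?cls F" by (auto simp: quotient_def)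
    then obtain x where x: "x \<in> A" "affinely_conjugate F (model x)" "F \<in> seifert_fibrations" by (auto simp: K)
    have "?cls F = ?cls (model x)"
      unfolding equivalence_class[OF x(3)] equivalence_class[OF model_seifert]
      using x(2) affinely_conjugate_trans affinely_conjugate_sym by blast
    then show "Q \<in> (\<lambda>x. ?cls (model x)) ` A" using F x(1) by blast
  next
    fix Q assume "Q \<in> (\<lambda>x. ?cls (model x)) ` A"
    then obtain x where x: "x \<in> A" "Q = ?cls (model x)" by blast
    then have "model x \<in> K" unfolding K using model_seifert affinely_conjugate_refl by blast
    then show "Q \<in> K // affine_equivalence" using x(2) by (auto simp: quotient_def)
  qed
  moreover have "inj_on (\<lambda>x. ?cls (model x)) A"
  proof (rule inj_onI)
    fix x y assume xy: "x \<in> A" "y \<in> A" "?cls (model x) = ?cls (model y)"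
    then have "model y \<in> ?cls (model x)"
      unfolding equivalence_class[OF model_seifert] using model_seifert affinely_conjugate_refl by blast
    then show "x = y"
      unfolding equivalence_class[OF model_seifert] using models_not_conjugate xy A by blast
  qed
  ultimately show ?thesis by (simp add: card_image)
qed

lemma type_of_conjugate:
  assumes "affinely_conjugate F (model (f, b, e1, a1, e2, a2))"
  shows "is_circle (generic_fiber F) \<longleftrightarrow> \<not> f" "is_closed_interval (generic_fiber F) \<longleftrightarrow> f"
    and "is_circle (base_space F) \<longleftrightarrow> \<not> b" "is_closed_interval (base_space F) \<longleftrightarrow> b"
proof -
  interpret pattern "cell f b e1 a1 e2 a2" f b by (rule pattern_cell)
  obtain \<phi> where \<phi>: "affinity \<phi>" "conjugate \<phi> (pattern_group (cell f b e1 a1 e2 a2)) = fst F"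
    "conjugate \<phi> (pattern_fiber f) = snd F"
    using affinely_conjugate_sym[OF assms] unfolding affinely_conjugate_def by auto
  show "is_circle (generic_fiber F) \<longleftrightarrow> \<not> f" "is_closed_interval (generic_fiber F) \<longleftrightarrow> f"
    using generic_fiber_conjugate[OF \<phi>(1)] circle_not_closed_interval unfolding \<phi>(2,3) by auto
  show "is_circle (base_space F) \<longleftrightarrow> \<not> b" "is_closed_interval (base_space F) \<longleftrightarrow> b"
    using base_space_conjugate[OF \<phi>(1)] circle_not_closed_interval unfolding \<phi>(2,3) by auto
qed

text \<open>The type of \<open>F\<close> can be read from the first two bits of any model conjugate
  to it, so a condition on the topology of fiber and base selects a set of codes.\<close>

lemma fibrations_of_type:
  assumes T: "\<And>F f b e1 a1 e2 a2. affinely_conjugate F (model (f, b, e1, a1, e2, a2)) \<Longrightarrow> P F \<longleftrightarrow> f = ff \<and> b = bb"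
    and A: "A \<subseteq> codes" "\<And>f b z. (f, b, z) \<in> codes \<Longrightarrow> (f, b, z) \<in> A \<longleftrightarrow> f = ff \<and> b = bb"
  shows "{F \<in> seifert_fibrations. P F} = {F \<in> seifert_fibrations. \<exists>x\<in>A. affinely_conjugate F (model x)}"
proof (intro Collect_cong conj_cong refl)
  fix F assume "F \<in> seifert_fibrations"
  then obtain x where x: "x \<in> codes" "affinely_conjugate F (model x)" using conjugate_to_model by blast
  obtain f b e1 a1 e2 a2 where xf: "x = (f, b, e1, a1, e2, a2)" by (cases x)
  show "P F \<longleftrightarrow> (\<exists>x\<in>A. affinely_conjugate F (model x))"
  proof
    assume "P F"
    then have "f = ff \<and> b = bb" using T x(2) unfolding xf by blast
    then have "x \<in> A" using A(2) x(1) unfolding xf by blast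
    then show "\<exists>x\<in>A. affinely_conjugate F (model x)" using x(2) by blast
  next
    assume "\<exists>x\<in>A. affinely_conjugate F (model x)"
    then obtain y where y: "y \<in> A" "affinely_conjugate F (model y)" by blast
    obtain f' b' e1' a1' e2' a2' where yf: "y = (f', b', e1', a1', e2', a2')" by (cases y)
    have "f' = ff \<and> b' = bb" using A y(1) unfolding yf by blast
    then show "P F" using T y(2) unfolding yf by blast
  qed
qed

theorem theorem13:
  shows "card (seifert_fibrations // affine_equivalence) = 13 \<and>
         card (paren_dot // affine_equivalence) = 2 \<and>
         card (bracket_dot // affine_equivalence) = 2 \<and>
         card (bracket_dash // affine_equivalence) = 3 \<and>
         card (paren_dash // affine_equivalence) = 6"
proof (intro conjI)
  note code_defs = codes_def paren_dot_codes_def bracket_dot_codes_def bracket_dash_codes_def paren_dash_codes_def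
  have "seifert_fibrations = {F \<in> seifert_fibrations. \<exists>x\<in>codes. affinely_conjugate F (model x)}"
    using conjugate_to_model by blast
  then have "card (seifert_fibrations // affine_equivalence) = card codes"
    by (rule card_quotient[OF order_refl])
  also have "card codes = 13" unfolding code_defs by (simp add: insert_Times_insert)
  finally show "card (seifert_fibrations // affine_equivalence) = 13" .
  have "card (paren_dot // affine_equivalence) = card paren_dot_codes" unfolding paren_dot_def
    by (rule card_quotient[OF _ fibrations_of_type[where ff = False and bb = False]])
      (use type_of_conjugate in \<open>auto simp: code_defs\<close>)
  then show "card (paren_dot // affine_equivalence) = 2" by (simp add: paren_dot_codes_def insert_Times_insert)
  have "card (bracket_dot // affine_equivalence) = card bracket_dot_codes" unfolding bracket_dot_def
    by (rule card_quotient[OF _ fibrations_of_type[where ff = True and bb = False]])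
      (use type_of_conjugate in \<open>auto simp: code_defs\<close>)
  then show "card (bracket_dot // affine_equivalence) = 2" by (simp add: bracket_dot_codes_def insert_Times_insert)
  have "card (bracket_dash // affine_equivalence) = card bracket_dash_codes" unfolding bracket_dash_def
    by (rule card_quotient[OF _ fibrations_of_type[where ff = True and bb = True]])
      (use type_of_conjugate in \<open>auto simp: code_defs\<close>)
  then show "card (bracket_dash // affine_equivalence) = 3" by (simp add: bracket_dash_codes_def insert_Times_insert)
  have "card (paren_dash // affine_equivalence) = card paren_dash_codes" unfolding paren_dash_def
    by (rule card_quotient[OF _ fibrations_of_type[where ff = False and bb = True]])
      (use type_of_conjugate in \<open>auto simp: code_defs\<close>)
  then show "card (paren_dash // affine_equivalence) = 6" by (simp add: paren_dash_codes_def insert_Times_insert)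
qed

end
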